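(* Let $N\geq 2$, $\ell\geq 2$, $\frac{2N}{N+2}<p<N$, $p^*:=\frac{Np}{N-p}$, and let $\beta_{ij}\in\mathbb{R}$ ($i,j=1,\dots,\ell$) satisfy $\beta_{ii}>0$ for all $i$ and $\beta_{ij}<0$ for $i\neq j$. Then the system $$\begin{cases}-\Delta_p u_i=\sum_{j=1}^\ell\beta_{ij}|u_j|^{\frac{p^*}{2}}|u_i|^{\frac{p^*}{2}-2}u_i,\\ u_i\in D^{1,p}(\mathbb{R}^N),\qquad i=1,\dots,\ell,\end{cases}$$ does not have a least energy fully nontrivial solution; that is, there is no $\mathbf{u}\in\mathcal{M}(\mathbb{R}^N)$ with $\mathcal{J}(\mathbf{u})=\inf_{\mathbf{v}\in\mathcal{M}(\mathbb{R}^N)}\mathcal{J}(\mathbf{v})$.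
   Context: $\Delta_p u:=\mathrm{div}(|\nabla u|^{p-2}\nabla u)$ and $D^{1,p}(\mathbb{R}^N):=\{u\in L^{p^*}(\mathbb{R}^N):\partial_i u\in L^p(\mathbb{R}^N),\ i=1,\dots,N\}$ with norm $\|u\|_p:=(\int_{\mathbb{R}^N}|\nabla u|^p)^{1/p}$. The condition on $p$ gives $p^*>2$. For $\mathbf{u}=(u_1,\dots,u_\ell)\in(D^{1,p}(\mathbb{R}^N))^\ell$ the energy is $$\mathcal{J}(\mathbf{u}):=\frac1p\sum_{i=1}^\ell\|u_i\|_p^p-\frac1{p^*}\sum_{i,j=1}^\ell\beta_{ij}\int_{\mathbb{R}^N}|u_j|^{\frac{p^*}{2}}|u_i|^{\frac{p^*}{2}}.$$ The Nehari-type set is $$\mathcal{M}(\mathbb{R}^N):=\Big\{\mathbf{u}\in(D^{1,p}(\mathbb{R}^N))^\ell: u_i\neq 0\text{ and }\|u_i\|_p^p=\sum_{j=1}^\ell\beta_{ij}\int_{\mathbb{R}^N}|u_j|^{\frac{p^*}{2}}|u_i|^{\frac{p^*}{2}}\text{ for all }i=1,\dots,\ell\Big\}.$$ It contains every fully nontrivial solution, i.e. every solution all of whose components are nontrivial. A least energy fully nontrivial solution is by definition an element of $\mathcal{M}(\mathbb{R}^N)$ at which $\mathcal{J}$ attains its infimum over $\mathcal{M}(\mathbb{R}^N)$. *)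

theory Defs
  imports "HOL-Analysis.Analysis"
begin

text \<open>Elements of Lebesgue and Sobolev spaces are represented by functions on \<open>real^'n\<close>
  (so N is \<open>CARD('n)\<close>), understood up to equality almost everywhere.\<close>

definition critical_exponent :: "nat \<Rightarrow> real \<Rightarrow> real" where
  "critical_exponent N p = real N * p / (real N - p)"

definition Lp :: "real \<Rightarrow> (real^'n \<Rightarrow> real) set" where
  "Lp q = {f \<in> borel_measurable lebesgue. integrable lebesgue (\<lambda>x. \<bar>f x\<bar> powr q)}"

definition locally_integrable :: "(real^'n \<Rightarrow> real) \<Rightarrow> bool" where
  "locally_integrable f \<longleftrightarrow> (\<forall>K. compact K \<longrightarrow> set_integrable lebesgue K f)"

definition partial_deriv :: "'n \<Rightarrow> (real^'n \<Rightarrow> real) \<Rightarrow> real^'n \<Rightarrow> real" where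
  "partial_deriv i \<phi> x = frechet_derivative \<phi> (at x) (axis i 1)"

primrec C_k :: "nat \<Rightarrow> (real^'n \<Rightarrow> real) \<Rightarrow> bool" where
  "C_k 0 \<phi> \<longleftrightarrow> continuous_on UNIV \<phi>"
| "C_k (Suc k) \<phi> \<longleftrightarrow> (\<forall>x. \<phi> differentiable (at x)) \<and> (\<forall>i. C_k k (partial_deriv i \<phi>))"

definition test_function :: "(real^'n \<Rightarrow> real) \<Rightarrow> bool" where
  "test_function \<phi> \<longleftrightarrow> (\<forall>k. C_k k \<phi>) \<and> compact (closure {x. \<phi> x \<noteq> 0})"

definition weak_partial :: "'n \<Rightarrow> (real^'n \<Rightarrow> real) \<Rightarrow> (real^'n \<Rightarrow> real) \<Rightarrow> bool" where
  "weak_partial i u g \<longleftrightarrow> locally_integrable u \<and> locally_integrable g \<and>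
     (\<forall>\<phi>. test_function \<phi> \<longrightarrow>
        (LINT x|lebesgue. u x * partial_deriv i \<phi> x) = - (LINT x|lebesgue. g x * \<phi> x))"

text \<open>Weak derivatives are unique only almost everywhere; the gradient is a choice of
  representative, and is used below only under an integral sign.\<close>

definition weak_gradient :: "(real^'n \<Rightarrow> real) \<Rightarrow> real^'n \<Rightarrow> real^'n" where
  "weak_gradient u = (SOME g. \<forall>i. weak_partial i u (\<lambda>x. g x $ i))"

definition D1p :: "real \<Rightarrow> (real^'n \<Rightarrow> real) set" where
  "D1p p = {u \<in> Lp (critical_exponent CARD('n) p). \<forall>i. \<exists>g \<in> Lp p. weak_partial i u g}"

definition D1p_norm :: "real \<Rightarrow> (real^'n \<Rightarrow> real) \<Rightarrow> real" where
  "D1p_norm p u = (LINT x|lebesgue. norm (weak_gradient u x) powr p) powr (1 / p)"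

definition coupling :: "real \<Rightarrow> (real^'n \<Rightarrow> real) \<Rightarrow> (real^'n \<Rightarrow> real) \<Rightarrow> real" where
  "coupling p v w =
     (LINT x|lebesgue. \<bar>v x\<bar> powr (critical_exponent CARD('n) p / 2) *
                       \<bar>w x\<bar> powr (critical_exponent CARD('n) p / 2))"

definition energy ::
  "real \<Rightarrow> ('l::finite \<Rightarrow> 'l \<Rightarrow> real) \<Rightarrow> ('l \<Rightarrow> real^'n \<Rightarrow> real) \<Rightarrow> real" where
  "energy p \<beta> u =
     1 / p * (\<Sum>i\<in>UNIV. D1p_norm p (u i) powr p)
     - 1 / critical_exponent CARD('n) p *
         (\<Sum>i\<in>UNIV. \<Sum>j\<in>UNIV. \<beta> i j * coupling p (u j) (u i))"

definition nehari ::
  "real \<Rightarrow> ('l::finite \<Rightarrow> 'l \<Rightarrow> real) \<Rightarrow> ('l \<Rightarrow> real^'n \<Rightarrow> real) set" where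
  "nehari p \<beta> = {u. \<forall>i. u i \<in> D1p p
      \<and> \<not> (AE x in lebesgue. u i x = 0)
      \<and> D1p_norm p (u i) powr p = (\<Sum>j\<in>UNIV. \<beta> i j * coupling p (u j) (u i))}"

text \<open>On the Nehari set the energy equals \<open>(1/p - 1/p*)\<close> times the sum of the
  \<open>p\<close>-th powers of the norms, hence is nonnegative for \<open>0 < p < N\<close>;
  so the real-valued infimum below is a genuine one.\<close>

definition least_energy_fully_nontrivial_solution ::
  "real \<Rightarrow> ('l::finite \<Rightarrow> 'l \<Rightarrow> real) \<Rightarrow> ('l \<Rightarrow> real^'n \<Rightarrow> real) \<Rightarrow> bool" where
  "least_energy_fully_nontrivial_solution p \<beta> u \<longleftrightarrow>
     u \<in> nehari p \<beta> \<and>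
     energy p \<beta> u = (INF v\<in>(nehari p \<beta> :: ('l \<Rightarrow> real^'n \<Rightarrow> real) set). energy p \<beta> v)"

end

theory Submission
  imports Defs "HOL-Real_Asymp.Real_Asymp"
begin

text \<open>
  On the Nehari set the energy is a positive multiple of \<open>\<Sum>i \<parallel>u\<^sub>i\<parallel>\<^sup>p\<close>. Translating the components
  of any \<open>w\<close> with nonzero components infinitely far from each other makes the couplings negligible, and rescaling
  the components brings them back to the Nehari set (a fixed point problem solved with Brouwer's
  theorem). Hence the infimum is at most the sum of the decoupled energies of the \<open>w\<^sub>i\<close>. Applied to
  a minimizer \<open>u\<close> itself this forces all couplings to vanish, so the supports of the \<open>u\<^sub>i\<close> are
  disjoint; applied to \<open>u\<close> with one component replaced by some \<open>w\<close> with \<open>\<bar>w\<bar> \<ge> \<bar>u\<^sub>i\<bar>\<close> it shows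
  \<open>\<parallel>w\<parallel> \<ge> \<parallel>u\<^sub>i\<parallel>\<close>.

  The last property replaces the strong maximum principle. With a Gaussian \<open>\<eta>\<close> and a suitable
  \<open>C\<^sup>1\<close> function \<open>\<Psi>(s) > \<bar>s\<bar>\<close>, the competitor \<open>w = \<eta> \<Psi>(u\<^sub>i/\<eta>)\<close> and the convexity of \<open>t\<^sup>p\<close> bound
  \<open>\<integral> \<bar>\<nabla>u\<^sub>i\<bar>\<^sup>p / (\<bar>u\<^sub>i\<bar> + \<epsilon>)\<^sup>p\<close> on bounded sets independently of \<open>\<epsilon>\<close>. Therefore normalized logarithms
  of \<open>u\<^sub>i\<close> converge to the indicator of \<open>u\<^sub>i \<noteq> 0\<close> while their gradients tend to \<open>0\<close>. So this indicator is
  constant, every \<open>u\<^sub>i\<close> is nonzero almost everywhere, and two of them cannot have disjoint supports.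
\<close>

section \<open>Smooth functions\<close>

text \<open>Competitors are rescaled before they are compared. With a the p-th power of the norm of
  w, b its self-coupling and q the critical exponent, the multiple of w that solves the decoupled
  Nehari equation for index i has energy proportional to (a / (\<beta> i i * b)) powr (p / (q - p))
  * a, which grows with a and decreases with b. If |w| >= |u i| then b cannot drop, so minimality
  forbids a smaller a.

  The Gaussian is there because |u i| + \<epsilon> leaves L^q. On s >= 0 the profile \<Psi> is a
  primitive of 1 - \<rho>^p with \<rho> = \<epsilon> / (s + \<epsilon>). Then |grad w| is at most a
  convex combination, with weights 1 - \<rho>^p and \<rho>^p, of |grad u i| and a multiple of
  (\<epsilon> / \<rho>) |grad \<eta>|. After taking p-th powers the weight \<rho>^p cancels in the
  second term, so the integral of \<rho>^p |grad u i|^p is of order \<epsilon>^p.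

  Everything rests on comparing integrals; no Euler-Lagrange equation or regularity theory enters.
  The price is a chain rule for weak derivatives and the constancy of functions with zero weak
  gradient. Both come from writing increments of a function as integrals of its weak
  derivative.\<close>

definition smooth :: "(real^'n::finite \<Rightarrow> real) \<Rightarrow> bool" where
  "smooth f \<longleftrightarrow> (\<forall>k. C_k k f)"

lemma partial_deriv_eq:
  assumes "(f has_derivative D) (at x)"
  shows "partial_deriv i f x = D (axis i 1)"
  using frechet_derivative_at[OF assms] by (simp add: partial_deriv_def)

lemma C_k_continuous: "C_k k f \<Longrightarrow> continuous_on UNIV f"
  by (cases k) (auto intro!: differentiable_imp_continuous_on simp: differentiable_on_def
      intro: differentiable_at_withinI)

lemma C_k_Suc_imp: "C_k (Suc k) f \<Longrightarrow> C_k k f"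
proof (induction k arbitrary: f)
  case 0
  then show ?case using C_k_continuous[of "Suc 0" f] by simp
next
  case (Suc k)
  then show ?case by (metis C_k.simps(2))
qed

text \<open>Coinduction for smoothness: it suffices to exhibit a class closed under one
  differentiation, so no formula for derivatives of order k is ever written down.\<close>

lemma smoothI:
  assumes "f \<in> S"
    and "\<And>f x. f \<in> S \<Longrightarrow> f differentiable (at x)"
    and "\<And>f i. f \<in> S \<Longrightarrow> partial_deriv i f \<in> S"
  shows "smooth f"
proof -
  have "C_k k f" if "f \<in> S" for k f
    using that
  proof (induction k arbitrary: f)
    case 0
    then show ?case
      using assms(2) by (auto intro!: differentiable_imp_continuous_on simp: differentiable_on_def
      intro: differentiable_at_withinI)
  next
    case (Suc k)
    then show ?case using assms by simp
  qed
  then show ?thesis using assms(1) by (simp add: smooth_def)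
qed

lemma smooth_continuous: "smooth f \<Longrightarrow> continuous_on UNIV f"
  using C_k_continuous by (auto simp: smooth_def)

lemma smooth_differentiable: "smooth f \<Longrightarrow> f differentiable (at x)"
  unfolding smooth_def by (metis C_k.simps(2))

lemma smooth_partial_deriv: "smooth f \<Longrightarrow> smooth (partial_deriv i f)"
  unfolding smooth_def by (metis C_k.simps(2))

lemma has_derivative_frechet:
  "f differentiable (at x) \<Longrightarrow> (f has_derivative frechet_derivative f (at x)) (at x)"
  using frechet_derivative_works by blast

lemma partial_deriv_const: "partial_deriv i (\<lambda>x::real^'n::finite. c) = (\<lambda>x. 0)"
  by (rule ext, subst partial_deriv_eq[OF has_derivative_const]) simp

lemma smooth_const: "smooth (\<lambda>x::real^'n::finite. c)"
  by (rule smoothI[where S = "range (\<lambda>c x. c)"]) (auto simp: partial_deriv_const)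

lemma partial_deriv_component:
  "partial_deriv i (\<lambda>x::real^'n::finite. x $ j) = (\<lambda>x. if i = j then 1 else 0)"
proof
  fix x :: "real^'n"
  have "((\<lambda>x::real^'n. x $ j) has_derivative (\<lambda>x. x $ j)) (at x)"
    by (intro bounded_linear_imp_has_derivative bounded_linear_vec_nth)
  from partial_deriv_eq[OF this]
  show "partial_deriv i (\<lambda>x::real^'n. x $ j) x = (if i = j then 1 else 0)"
    by (auto simp: axis_def)
qed

lemma differentiable_vec_nth: "(\<lambda>x::real^'n::finite. x $ j) differentiable (at x)"
  using bounded_linear_imp_has_derivative[OF bounded_linear_vec_nth] by (rule differentiableI)

lemma smooth_component: "smooth (\<lambda>x::real^'n::finite. x $ j)"
  by (rule smoothI[where S = "insert (\<lambda>x. x $ j) (range (\<lambda>c x. c))"])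
    (auto simp: partial_deriv_component partial_deriv_const differentiable_vec_nth)

lemma partial_deriv_add:
  assumes "f differentiable (at x)" "g differentiable (at x)"
  shows "partial_deriv i (\<lambda>x. f x + g x) x = partial_deriv i f x + partial_deriv i g x"
  using partial_deriv_eq[OF has_derivative_add[OF has_derivative_frechet[OF assms(1)]
     has_derivative_frechet[OF assms(2)]]]
  by (simp add: partial_deriv_def)

lemma partial_deriv_mult:
  assumes "f differentiable (at x)" "g differentiable (at x)"
  shows "partial_deriv i (\<lambda>x. f x * g x) x = f x * partial_deriv i g x + partial_deriv i f x * g x"
  using partial_deriv_eq[OF has_derivative_mult[OF has_derivative_frechet[OF assms(1)]
     has_derivative_frechet[OF assms(2)]]]
  by (simp add: partial_deriv_def)

lemma C_k_add: "C_k k f \<Longrightarrow> C_k k g \<Longrightarrow> C_k k (\<lambda>x. f x + g x)"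
proof (induction k arbitrary: f g)
  case 0
  then show ?case by (auto intro: continuous_on_add)
next
  case (Suc k)
  then have "partial_deriv i (\<lambda>x. f x + g x) = (\<lambda>x. partial_deriv i f x + partial_deriv i g x)" for i
    by (auto simp: partial_deriv_add)
  with Suc show ?case by (auto intro: differentiable_add)
qed

lemma C_k_mult: "C_k k f \<Longrightarrow> C_k k g \<Longrightarrow> C_k k (\<lambda>x. f x * g x)"
proof (induction k arbitrary: f g)
  case 0
  then show ?case by (auto intro: continuous_on_mult)
next
  case (Suc k)
  then have "partial_deriv i (\<lambda>x. f x * g x) = (\<lambda>x. f x * partial_deriv i g x + partial_deriv i f x * g x)" for i
    by (auto simp: partial_deriv_mult)
  moreover have "C_k k f" "C_k k g" using Suc.prems C_k_Suc_imp by auto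
  ultimately show ?case using Suc by (auto intro!: differentiable_mult C_k_add)
qed

lemma smooth_add: "smooth f \<Longrightarrow> smooth g \<Longrightarrow> smooth (\<lambda>x. f x + g x)"
  by (simp add: smooth_def C_k_add)

lemma smooth_mult: "smooth f \<Longrightarrow> smooth g \<Longrightarrow> smooth (\<lambda>x. f x * g x)"
  by (simp add: smooth_def C_k_mult)

lemma smooth_sum: "(\<And>i. i \<in> I \<Longrightarrow> smooth (f i)) \<Longrightarrow> smooth (\<lambda>x. \<Sum>i\<in>I. f i x)"
  by (induction I rule: infinite_finite_induct) (auto intro: smooth_const smooth_add)

lemma smooth_prod: "(\<And>i. i \<in> I \<Longrightarrow> smooth (f i)) \<Longrightarrow> smooth (\<lambda>x. \<Prod>i\<in>I. f i x)"
  by (induction I rule: infinite_finite_induct) (auto intro: smooth_const smooth_mult)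

lemma partial_deriv_exp:
  assumes "f differentiable (at x)"
  shows "partial_deriv i (\<lambda>x. exp (f x)) x = exp (f x) * partial_deriv i f x"
proof -
  have "((\<lambda>x. exp (f x)) has_derivative (\<lambda>h. exp (f x) * frechet_derivative f (at x) h)) (at x)"
    using has_derivative_frechet[OF assms] by (auto intro!: derivative_eq_intros)
  from partial_deriv_eq[OF this] show ?thesis by (simp add: partial_deriv_def)
qed

lemma C_k_exp: "C_k k f \<Longrightarrow> C_k k (\<lambda>x. exp (f x))"
proof (induction k arbitrary: f)
  case 0
  then show ?case by (auto intro: continuous_on_exp)
next
  case (Suc k)
  then have "partial_deriv i (\<lambda>x. exp (f x)) = (\<lambda>x. exp (f x) * partial_deriv i f x)" for i
    by (auto simp: partial_deriv_exp)
  moreover have "C_k k f" using Suc.prems C_k_Suc_imp by auto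
  moreover have "(\<lambda>x. exp (f x)) differentiable (at x)" for x
    using Suc.prems by (auto intro!: differentiableI[OF has_derivative_exp[OF has_derivative_frechet]])
  ultimately show ?case using Suc by (auto intro!: C_k_mult)
qed

lemma smooth_exp: "smooth f \<Longrightarrow> smooth (\<lambda>x. exp (f x))"
  by (simp add: smooth_def C_k_exp)

lemma partial_deriv_shift:
  assumes "f differentiable (at (x + a))"
  shows "partial_deriv i (\<lambda>x. f (x + a)) x = partial_deriv i f (x + a)"
proof -
  have "((\<lambda>x. f (x + a)) has_derivative frechet_derivative f (at (x + a))) (at x)"
    using has_derivative_compose[of "\<lambda>x. x + a" "\<lambda>x. x" x UNIV f, OF _ has_derivative_frechet[OF assms]]
      has_derivative_add[OF has_derivative_ident has_derivative_const, of a "at x"] by simp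
  from partial_deriv_eq[OF this] show ?thesis by (simp add: partial_deriv_def)
qed

lemma differentiable_shift:
  assumes "f differentiable (at (x + a))"
  shows "(\<lambda>x. f (x + a)) differentiable (at x)"
proof -
  have "((\<lambda>x. f (x + a)) has_derivative frechet_derivative f (at (x + a))) (at x)"
    using has_derivative_compose[of "\<lambda>x. x + a" "\<lambda>x. x" x UNIV f, OF _ has_derivative_frechet[OF assms]]
      has_derivative_add[OF has_derivative_ident has_derivative_const, of a "at x"] by simp
  then show ?thesis by (rule differentiableI)
qed

lemma smooth_shift:
  assumes "smooth f" shows "smooth (\<lambda>x. f (x + a))"
  by (rule smoothI[where S = "(\<lambda>f x. f (x + a)) ` Collect smooth"])
   (use assms in \<open>auto simp: smooth_differentiable partial_deriv_shift smooth_partial_deriv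
      intro: differentiable_shift intro!: image_eqI[of _ _ "partial_deriv _ _"]\<close>)

section \<open>Flat functions behind the cut-offs\<close>

lemma flat_diff_at_0:
  fixes P :: "real poly"
  shows "((\<lambda>t. if t > 0 then poly P (1/t) * exp (-1/t) else 0) has_field_derivative 0) (at 0)"
proof -
  have *: "((\<lambda>x. poly Q x * exp (- x)) \<longlongrightarrow> 0) at_top" for Q :: "real poly"
  proof -
    have "((\<lambda>x. \<Sum>i\<le>degree Q. coeff Q i * (x ^ i / exp x)) \<longlongrightarrow> (\<Sum>i\<le>degree Q. coeff Q i * 0)) at_top"
      by (intro tendsto_intros tendsto_power_div_exp_0)
    then show ?thesis
      by (simp add: poly_altdef sum_distrib_right exp_minus divide_inverse mult.assoc)
  qed
  \<comment> \<open>With x = 1/t the difference quotient at 0 from the right is again a polynomial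
    in x times exp(-x); the extra factor 1/t appears as \<open>pCons 0 P\<close>.\<close>
  have "((\<lambda>t. poly (pCons 0 P) (inverse t) * exp (- (inverse t))) \<longlongrightarrow> 0) (at_right 0)"
    by (rule filterlim_compose[OF * filterlim_inverse_at_top_right])
  then have r: "((\<lambda>t. ((if t > 0 then poly P (1/t) * exp (-1/t) else 0) - 0) / (t - 0)) \<longlongrightarrow> 0) (at_right (0::real))"
    by (rule Lim_transform_eventually)
      (auto simp: eventually_at_filter divide_inverse)
  have l: "((\<lambda>t. ((if t > 0 then poly P (1/t) * exp (-1/t) else 0) - 0) / (t - 0)) \<longlongrightarrow> 0) (at_left (0::real))"
    by (rule Lim_transform_eventually[OF tendsto_const]) (auto simp: eventually_at_filter)
  show ?thesis
    using filterlim_split_at[OF l r] by (simp add: has_field_derivative_iff)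
qed

text \<open>The polynomial parameter makes the family closed under differentiation: for t > 0 and x
  = 1/t, the derivative of P(x) exp(-x) with respect to t is x^2 (P - P')(x) exp(-x).\<close>

definition flat_exp :: "real poly \<Rightarrow> real \<Rightarrow> real" where
  "flat_exp P t = (if t > 0 then poly P (1/t) * exp (-1/t) else 0)"

lemma flat_deriv:
  "(flat_exp P has_field_derivative flat_exp (monom 1 2 * (P - pderiv P)) t) (at t)"
proof (cases t "0::real" rule: linorder_cases)
  case less
  have "((\<lambda>_. 0) has_field_derivative 0) (at t)" by simp
  moreover have "\<forall>\<^sub>F x in nhds t. flat_exp P x = 0"
    using less by (auto simp: flat_exp_def eventually_nhds intro!: exI[of _ "{..<0}"])
  ultimately show ?thesis
    using less by (subst DERIV_cong_ev[OF refl _ refl, of _ "\<lambda>_. 0"]) (auto simp: flat_exp_def)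
next
  case equal
  then show ?thesis using flat_diff_at_0[of P] by (simp add: flat_exp_def[abs_def])
next
  case greater
  have "((\<lambda>t. poly P (1/t) * exp (-1/t)) has_field_derivative flat_exp (monom 1 2 * (P - pderiv P)) t) (at t)"
    using greater
    by (auto intro!: derivative_eq_intros DERIV_chain2[OF poly_DERIV]
       simp: flat_exp_def poly_monom field_simps power2_eq_square)
  moreover have "\<forall>\<^sub>F x in nhds t. flat_exp P x = poly P (1/x) * exp (-1/x)"
    using greater by (auto simp: flat_exp_def eventually_nhds intro!: exI[of _ "{0<..}"])
  ultimately show ?thesis
    using greater by (subst DERIV_cong_ev[OF refl _ refl, of _ "\<lambda>t. poly P (1/t) * exp (-1/t)"]) auto
qed

lemma smooth_flat: "smooth (\<lambda>x::real^'n::finite. flat_exp P (c * x $ i + d))"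
proof -
  have D: "((\<lambda>x::real^'n. flat_exp P (c * x $ i + d)) has_derivative
     (\<lambda>h. flat_exp (monom 1 2 * (P - pderiv P)) (c * x $ i + d) * (c * h $ i))) (at x)" for P x
  proof -
    have 1: "((\<lambda>x::real^'n. c * x $ i + d) has_derivative (\<lambda>h. c * h $ i)) (at x)"
      by (auto intro!: derivative_eq_intros bounded_linear_imp_has_derivative bounded_linear_vec_nth)
    show ?thesis
      using has_derivative_compose[OF 1, of "flat_exp P"] flat_deriv[of P]
      by (simp add: has_field_derivative_def)
  qed
  \<comment> \<open>Both cases stay inside the class handed to \<open>smoothI\<close>: the slope c
    is absorbed into the polynomial, and the zero function is \<open>flat_exp 0\<close>.\<close>
  have pd: "partial_deriv j (\<lambda>x::real^'n. flat_exp P (c * x $ i + d)) =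
     (if i = j then \<lambda>x. flat_exp (smult c (monom 1 2 * (P - pderiv P))) (c * x $ i + d) else (\<lambda>x. flat_exp 0 (c * x $ i + d)))" for P j
    by (rule ext, subst partial_deriv_eq[OF D]) (simp add: axis_def flat_exp_def)
  show ?thesis
    by (rule smoothI[where S = "range (\<lambda>P x. flat_exp P (c * x $ i + d))"])
     (use D in \<open>auto simp: pd intro: differentiableI\<close>)
qed

section \<open>Test functions and the fundamental lemma\<close>

lemma distr_lebesgue_shift: "distr lebesgue lebesgue (\<lambda>x. x + a) = (lebesgue :: 'a::euclidean_space measure)"
  and measurable_lebesgue_shift: "(\<lambda>x. x + a) \<in> lebesgue \<rightarrow>\<^sub>M (lebesgue :: 'a::euclidean_space measure)"
proof -
  have eq: "(\<lambda>x. a + (\<Sum>j\<in>Basis. (1 * (x \<bullet> j)) *\<^sub>R j)) = (\<lambda>x::'a. x + a)"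
    by (simp add: euclidean_representation add.commute)
  have "lebesgue = density (distr lebesgue lebesgue (\<lambda>x::'a. x + a)) (\<lambda>_. 1)"
    using lebesgue_affine_euclidean[of "\<lambda>_. 1" a, unfolded eq] by simp
  then show "distr lebesgue lebesgue (\<lambda>x. x + a) = (lebesgue :: 'a measure)"
    by (simp add: density_1)
  show "(\<lambda>x. x + a) \<in> lebesgue \<rightarrow>\<^sub>M (lebesgue :: 'a measure)"
    using lebesgue_affine_measurable[of "\<lambda>_. 1" a, unfolded eq] by simp
qed

lemma measurable_shift:
  "f \<in> borel_measurable lebesgue \<Longrightarrow> (\<lambda>x. f (x + a)) \<in> borel_measurable lebesgue"
  for a :: "'a::euclidean_space"
  using measurable_compose[OF measurable_lebesgue_shift] by blast

lemma integral_shift: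
  fixes f :: "'a::euclidean_space \<Rightarrow> real"
  assumes "f \<in> borel_measurable lebesgue"
  shows "(LINT x|lebesgue. f (x + a)) = (LINT x|lebesgue. f x)"
  using integral_distr[OF measurable_lebesgue_shift[of a] assms] by (simp add: distr_lebesgue_shift)

lemma integrable_shift:
  fixes f :: "'a::euclidean_space \<Rightarrow> real"
  assumes "integrable lebesgue f"
  shows "integrable lebesgue (\<lambda>x. f (x + a))"
  using integrable_distr_eq[OF measurable_lebesgue_shift[of a] borel_measurable_integrable[OF assms]] assms
  by (simp add: distr_lebesgue_shift)

lemma AE_shift:
  fixes a :: "'a::euclidean_space"
  assumes "AE x in lebesgue. P x"
  shows "AE x in lebesgue. P (x + a)"
  using assms by (subst (asm) distr_lebesgue_shift[of a, symmetric])
    (rule AE_distrD[OF measurable_lebesgue_shift])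

text \<open>A product over the coordinates of \<open>flat_exp 1\<close> at n + 1 times the signed
  distances to the two faces of the box. As exp(-1/t) increases to 1, these smooth functions tend
  pointwise to the indicator of the open box, and they vanish off it.\<close>

definition bump :: "real^'n \<Rightarrow> real^'n \<Rightarrow> nat \<Rightarrow> real^'n::finite \<Rightarrow> real" where
  "bump a b n x = (\<Prod>i\<in>UNIV. flat_exp 1 (real (Suc n) * x $ i + - (real (Suc n) * a $ i)) *
      flat_exp 1 (- real (Suc n) * x $ i + real (Suc n) * b $ i))"

lemma flat_1_le: "0 \<le> flat_exp 1 t" "flat_exp 1 t \<le> 1"
  by (auto simp: flat_exp_def)

lemma bump_nonneg: "0 \<le> bump a b n x"
  unfolding bump_def by (intro prod_nonneg ballI mult_nonneg_nonneg flat_1_le)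

lemma bump_le_1: "bump a b n x \<le> 1"
  unfolding bump_def
  by (intro prod_le_1 conjI mult_nonneg_nonneg mult_le_one flat_1_le)

lemma smooth_bump: "smooth (bump a b n)"
  unfolding bump_def[abs_def] by (intro smooth_prod smooth_mult smooth_flat)

lemma flat_scaled_tendsto:
  "(\<lambda>n. flat_exp 1 (real (Suc n) * t)) \<longlonglongrightarrow> (if t > 0 then 1 else 0)"
proof (cases "t > 0")
  case True
  then have "filterlim (\<lambda>n. real (Suc n) * t) at_top sequentially"
    by real_asymp
  then have "(\<lambda>n. exp (- 1 / (real (Suc n) * t))) \<longlonglongrightarrow> exp 0"
    by (intro tendsto_intros real_tendsto_divide_at_top[OF tendsto_const])
  then show ?thesis using True by (simp add: flat_exp_def)
next
  case False
  then have "flat_exp 1 (real (Suc n) * t) = 0" for n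
    by (simp add: flat_exp_def zero_less_mult_iff)
  then show ?thesis using False by (simp del: of_nat_Suc)
qed

lemma bump_tendsto: "(\<lambda>n. bump a b n x) \<longlonglongrightarrow> indicat_real (box a b) x"
proof -
  have "(\<lambda>n. \<Prod>i\<in>UNIV. flat_exp 1 (real (Suc n) * (x $ i - a $ i)) * flat_exp 1 (real (Suc n) * (b $ i - x $ i)))
     \<longlonglongrightarrow> (\<Prod>i\<in>UNIV. (if x $ i - a $ i > 0 then 1 else 0) * (if b $ i - x $ i > 0 then 1 else 0))"
    by (intro tendsto_prod tendsto_mult flat_scaled_tendsto)
  also have "(\<Prod>i\<in>UNIV. (if x $ i - a $ i > 0 then 1 else 0) * (if b $ i - x $ i > 0 then 1 else 0))
      = indicat_real (box a b) x"
    by (auto simp: indicator_def mem_box_cart)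
  finally show ?thesis
    by (simp add: bump_def[abs_def] algebra_simps)
qed

lemma bump_eq_0:
  assumes "x \<notin> box a b"
  shows "bump a b n x = 0"
proof -
  obtain i where "\<not> a $ i < x $ i \<or> \<not> x $ i < b $ i"
    using assms by (auto simp: mem_box_cart)
  then have "real (Suc n) * (x $ i - a $ i) \<le> 0 \<or> real (Suc n) * (b $ i - x $ i) \<le> 0"
    by (auto simp: mult_le_0_iff)
  then have "flat_exp 1 (real (Suc n) * x $ i + - (real (Suc n) * a $ i)) *
      flat_exp 1 (- real (Suc n) * x $ i + real (Suc n) * b $ i) = 0"
    by (auto simp: flat_exp_def algebra_simps)
  then show ?thesis unfolding bump_def by (intro prod_zero) auto
qed

lemma test_function_smooth: "test_function \<phi> \<Longrightarrow> smooth \<phi>"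
  by (simp add: test_function_def smooth_def)

lemma test_functionI:
  assumes "smooth \<phi>" "compact K" "\<And>x. x \<notin> K \<Longrightarrow> \<phi> x = 0"
  shows "test_function \<phi>"
proof -
  have "closure {x. \<phi> x \<noteq> 0} \<subseteq> K"
    using assms by (intro closure_minimal compact_imp_closed) auto
  then show ?thesis
    using assms(1) compact_Int_closed[OF assms(2) closed_closure]
    by (metis inf.absorb2 smooth_def test_function_def)
qed

lemma test_bump: "test_function (bump a b n)"
  by (rule test_functionI[OF smooth_bump compact_cbox[of a b]])
    (meson bump_eq_0 box_subset_cbox subsetD)

lemma measurable_smooth: "smooth f \<Longrightarrow> f \<in> borel_measurable lebesgue"
  by (intro measurable_completion) (simp add: borel_measurable_continuous_onI smooth_continuous)

text \<open>Open boxes are stable under intersection and generate the Borel sets, so Dynkin's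
  argument carries vanishing integrals from boxes to all Borel sets; a density whose integral over
  every Borel set is zero vanishes almost everywhere.\<close>

lemma boxes_zero_imp_AE_zero:
  fixes f :: "'a::euclidean_space \<Rightarrow> real"
  assumes f: "integrable lborel f"
    and z: "\<And>a b. (LINT x:box a b|lborel. f x) = 0"
  shows "AE x in lborel. f x = 0"
proof (rule sigma_finite_measure.density_zero[OF lborel.sigma_finite_measure_axioms f])
  \<comment> \<open>Complements require the integral over the whole space, obtained by exhausting it
    with boxes.\<close>
  have U: "(LINT x|lborel. f x) = 0"
  proof (rule LIMSEQ_unique[of "\<lambda>n. LINT x:box (- (real n *\<^sub>R One)) (real n *\<^sub>R One)|lborel. f x"])
    have "(\<lambda>n. LINT x:box (- (real n *\<^sub>R One)) (real n *\<^sub>R One)|lborel. f x) \<longlonglongrightarrow> (LINT x:(\<Union>n. box (- (real n *\<^sub>R One)) (real n *\<^sub>R One))|lborel. f x)"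
    proof (rule set_integral_cont_up)
      show "incseq (\<lambda>n. box (- (real n *\<^sub>R One)) (real n *\<^sub>R One) :: 'a set)"
        by (auto simp: incseq_def mem_box) force+
    qed (use f in \<open>auto simp: set_integrable_def UN_box_eq_UNIV\<close>)
    then show "(\<lambda>n. LINT x:box (- (real n *\<^sub>R One)) (real n *\<^sub>R One)|lborel. f x) \<longlonglongrightarrow> (LINT x|lborel. f x)"
      by (simp add: UN_box_eq_UNIV set_lebesgue_integral_def)
  qed (simp add: z)
  fix A :: "'a set" assume "A \<in> sets lborel"
  then have A: "A \<in> sigma_sets UNIV (range (\<lambda>(a, b). box a b))"
    by (simp add: borel_eq_box)
  have IS: "Int_stable (range (\<lambda>(a, b). box a b::'a set))"
    by (auto simp: Int_stable_def box_Int_box)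
  have "range (\<lambda>(a, b). box a b::'a set) \<subseteq> Pow UNIV" by simp
  from IS this A show "(LINT x:A|lborel. f x) = 0"
  proof (induction A rule: sigma_sets_induct_disjoint)
    case (compl A)
    have "A \<in> sets lborel" using compl(1) by (simp add: borel_eq_box)
    then have "(LINT x:UNIV - A|lborel. f x) = (LINT x|lborel. f x) - (LINT x:A|lborel. f x)"
    proof -
      have "integrable lborel (\<lambda>x. indicat_real A x *\<^sub>R f x)"
        using \<open>A \<in> sets lborel\<close> f by (rule integrable_mult_indicator)
      then have "(LINT x|lborel. f x - indicat_real A x *\<^sub>R f x) =
          (LINT x|lborel. f x) - (LINT x|lborel. indicat_real A x *\<^sub>R f x)"
        by (intro Bochner_Integration.integral_diff f)
      moreover have "(\<lambda>x. f x - indicat_real A x *\<^sub>R f x) = (\<lambda>x. indicat_real (UNIV - A) x *\<^sub>R f x)"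
        by (auto simp: indicator_def)
      ultimately show ?thesis by (simp add: set_lebesgue_integral_def)
    qed
    then show ?case using U compl by simp
  next
    case (union A)
    have "A i \<in> sets lborel" for i using union(2) by (auto simp: borel_eq_box)
    then have "(LINT x:(\<Union>i. A i)|lborel. f x) = (\<Sum>i. (LINT x:(A i)|lborel. f x))"
      using union(1) f
      by (intro lebesgue_integral_countable_add)
        (auto simp: disjoint_family_on_def set_integrable_def simp del: real_scaleR_def
           intro!: integrable_mult_indicator)
    then show ?case using union by simp
  qed (auto simp: z, simp add: set_lebesgue_integral_def)
qed

lemma lebesgue_borel_representative:
  fixes f :: "'a::euclidean_space \<Rightarrow> real"
  assumes "f \<in> borel_measurable lebesgue"
  obtains f' where "f' \<in> borel_measurable borel" "AE x in lebesgue. f x = f' x"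
  using completion_ex_borel_measurable_real[OF assms] AE_completion by (metis measurable_lborel2)

text \<open>Bump functions on boxes inside the given one are admissible, and dominated convergence
  turns them into indicators. Testing is confined to one box because the identities to which this is
  applied are known only on a bounded region.\<close>

lemma fundamental_lemma:
  fixes f :: "real^'n::finite \<Rightarrow> real"
  assumes f: "set_integrable lebesgue (box a b) f"
    and z: "\<And>\<phi>. test_function \<phi> \<Longrightarrow> (\<And>x. x \<notin> box a b \<Longrightarrow> \<phi> x = 0) \<Longrightarrow>
       (LINT x|lebesgue. f x * \<phi> x) = 0"
  shows "AE x in lebesgue. x \<in> box a b \<longrightarrow> f x = 0"
proof -
  define G where "G x = indicator (box a b) x * f x" for x
  have G: "integrable lebesgue G"
    using f by (simp add: G_def[abs_def] set_integrable_def)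
  obtain G' where G': "G' \<in> borel_measurable borel" "AE x in lebesgue. G x = G' x"
    using lebesgue_borel_representative borel_measurable_integrable[OF G] by metis
  have mG': "G' \<in> borel_measurable lebesgue"
    using G'(1) by (simp add: measurable_completion)
  have "integrable lebesgue G'"
    using integrable_cong_AE[OF borel_measurable_integrable[OF G] mG' G'(2)] G by simp
  then have iG': "integrable lborel G'"
    using integrable_completion[of G' lborel] G' by simp
  have "AE x in lborel. G' x = 0"
  proof (rule boxes_zero_imp_AE_zero[OF iG'])
    fix c d :: "real^'n"
    \<comment> \<open>\<open>G\<close> vanishes off \<open>box a b\<close>, so integrating over an
      arbitrary box amounts to integrating over the intersection, which is again a box.\<close>
    obtain a' b' where ab': "box a b \<inter> box c d = box a' b'"
      using box_Int_box[of a b c d] by blast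
    have "(LINT x|lebesgue. G x * bump a' b' n x) = 0" for n
    proof -
      have "(LINT x|lebesgue. G x * bump a' b' n x) = (LINT x|lebesgue. f x * bump a' b' n x)"
      proof (rule Bochner_Integration.integral_cong[OF refl])
        fix x
        show "G x * bump a' b' n x = f x * bump a' b' n x"
        proof (cases "x \<in> box a b")
          case False
          then have "x \<notin> box a' b'" using ab' by blast
          then show ?thesis by (simp add: bump_eq_0)
        qed (simp add: G_def)
      qed
      also have "\<dots> = 0"
      proof (intro z test_bump bump_eq_0)
        fix x assume "x \<notin> box a b"
        then show "x \<notin> box a' b'" using ab' by blast
      qed
      finally show ?thesis .
    qed
    moreover have "(\<lambda>n. LINT x|lebesgue. G x * bump a' b' n x) \<longlonglongrightarrow>
        (LINT x|lebesgue. G x * indicator (box a' b') x)"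
    proof (rule integral_dominated_convergence[where w = "\<lambda>x. \<bar>G x\<bar>"])
      show "AE x in lebesgue. (\<lambda>n. G x * bump a' b' n x) \<longlonglongrightarrow> G x * indicator (box a' b') x"
        by (intro AE_I2 tendsto_intros bump_tendsto)
      show "AE x in lebesgue. norm (G x * bump a' b' n x) \<le> \<bar>G x\<bar>" for n
        using bump_nonneg[of a' b' n] bump_le_1[of a' b' n]
        by (intro AE_I2) (auto simp: abs_mult intro!: mult_left_le)
      show "(\<lambda>x. G x * bump a' b' n x) \<in> borel_measurable lebesgue" for n
        by (intro borel_measurable_times borel_measurable_integrable[OF G] measurable_smooth smooth_bump)
      show "(\<lambda>x. G x * indicat_real (box a' b') x) \<in> borel_measurable lebesgue"
        by (intro borel_measurable_times borel_measurable_integrable[OF G] borel_measurable_indicator) auto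
    qed (use G in auto)
    ultimately have "(LINT x|lebesgue. G x * indicator (box a' b') x) = 0"
      by (simp add: LIMSEQ_const_iff)
    also have "(LINT x|lebesgue. G x * indicator (box a' b') x) = (LINT x|lebesgue. G' x * indicator (box c d) x)"
    proof (rule integral_cong_AE)
      show "AE x in lebesgue. G x * indicator (box a' b') x = G' x * indicator (box c d) x"
        using G'(2) by eventually_elim (auto simp: ab'[symmetric] G_def indicator_def)
      show "(\<lambda>x. G x * indicat_real (box a' b') x) \<in> borel_measurable lebesgue"
        by (intro borel_measurable_times borel_measurable_integrable[OF G] borel_measurable_indicator) auto
      show "(\<lambda>x. G' x * indicat_real (box c d) x) \<in> borel_measurable lebesgue"
        by (intro borel_measurable_times mG' borel_measurable_indicator) auto
    qed
    also have "\<dots> = (LINT x|lborel. G' x * indicator (box c d) x)"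
      using G' by (intro integral_completion) simp
    finally show "(LINT x:box c d|lborel. G' x) = 0"
      by (simp add: set_lebesgue_integral_def mult.commute)
  qed
  then have "AE x in lebesgue. G' x = 0" by (rule AE_completion)
  with G'(2) show ?thesis
    by eventually_elim (auto simp: G_def)
qed

text \<open>The functions with this property are closed under scaling, sums and L1 limits. The
  starting point is the indicator of an open set instead of a continuous function: if x lies in an
  open set, so does x + X n for large n. Outer regularity then reaches all measurable sets of finite
  measure.\<close>

lemma L1_shift_continuous:
  fixes f :: "'a::euclidean_space \<Rightarrow> real"
  assumes f: "integrable lebesgue f" and X: "X \<longlonglongrightarrow> 0"
  shows "(\<lambda>n. LINT x|lebesgue. \<bar>f (x + X n) - f x\<bar>) \<longlonglongrightarrow> 0"
proof -
  define P where "P f \<longleftrightarrow> (\<lambda>n. LINT x|lebesgue. \<bar>f (x + X n) - f x\<bar>) \<longlonglongrightarrow> 0" for f :: "'a \<Rightarrow> real"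
  have approx: "P f" if f: "integrable lebesgue f"
    and a: "\<And>e. e > 0 \<Longrightarrow> \<exists>g. integrable lebesgue g \<and> P g \<and> (LINT x|lebesgue. \<bar>f x - g x\<bar>) < e" for f
    unfolding P_def
  proof (rule LIMSEQ_I)
    fix e :: real assume "e > 0"
    \<comment> \<open>Three error terms of less than e/4 each: f against g before the shift, f
      against g after it, and the shift of g itself.\<close>
    then obtain g where g: "integrable lebesgue g" "P g" "(LINT x|lebesgue. \<bar>f x - g x\<bar>) < e / 4"
      using a[of "e/4"] by auto
    then obtain N where N: "\<And>n. n \<ge> N \<Longrightarrow> (LINT x|lebesgue. \<bar>g (x + X n) - g x\<bar>) < e / 4"
      using LIMSEQ_D[of _ 0 "e/4"] \<open>e > 0\<close> unfolding P_def by fastforce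
    have "(LINT x|lebesgue. \<bar>f (x + X n) - f x\<bar>) < e" if "n \<ge> N" for n
    proof -
      have i: "integrable lebesgue (\<lambda>x. \<bar>f x - g x\<bar>)" using f g by auto
      have "(LINT x|lebesgue. \<bar>f (x + X n) - f x\<bar>) \<le>
         (LINT x|lebesgue. \<bar>f (x + X n) - g (x + X n)\<bar> + (\<bar>g (x + X n) - g x\<bar> + \<bar>f x - g x\<bar>))"
        using integrable_shift[OF f] integrable_shift[OF g(1)] integrable_shift[OF i] f g
        by (intro integral_mono) auto
      also have "\<dots> = (LINT x|lebesgue. \<bar>f (x + X n) - g (x + X n)\<bar>) +
          ((LINT x|lebesgue. \<bar>g (x + X n) - g x\<bar>) + (LINT x|lebesgue. \<bar>f x - g x\<bar>))"
        using integrable_shift[OF g(1)] integrable_shift[OF i] f g i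
        by (simp add: Bochner_Integration.integral_add)
      also have "(LINT x|lebesgue. \<bar>f (x + X n) - g (x + X n)\<bar>) = (LINT x|lebesgue. \<bar>f x - g x\<bar>)"
        using integral_shift[of "\<lambda>x. \<bar>f x - g x\<bar>"] i by auto
      finally show ?thesis using g(3) N[OF that] \<open>e > 0\<close> by linarith
    qed
    then show "\<exists>N. \<forall>n\<ge>N. norm ((LINT x|lebesgue. \<bar>f (x + X n) - f x\<bar>) - 0) < e"
      by (auto intro!: exI[of _ N])
  qed
  have scale: "P (\<lambda>x. c * f x)" if "P f" for f c
    using tendsto_mult[OF tendsto_const[of "\<bar>c\<bar>"] that[unfolded P_def]]
    by (simp add: P_def abs_mult flip: right_diff_distrib)
  have open_case: "P (indicator U)" if U: "open U" "emeasure lebesgue U < \<infinity>" for U :: "'a set"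
  proof -
    have iU: "integrable lebesgue (indicat_real U)"
      using U by simp
    have ip: "integrable lebesgue (\<lambda>x. indicat_real U x * indicator U (x + X n))" for n
    proof (rule Bochner_Integration.integrable_bound[OF iU])
      show "(\<lambda>x. indicat_real U x * indicator U (x + X n)) \<in> borel_measurable lebesgue"
        using iU integrable_shift[OF iU] by (intro borel_measurable_times borel_measurable_integrable)
    qed (auto simp: indicator_def)
    have "(\<lambda>n. LINT x|lebesgue. indicat_real U x * indicator U (x + X n)) \<longlonglongrightarrow> (LINT x|lebesgue. indicat_real U x)"
    proof (rule integral_dominated_convergence[where w = "indicat_real U"])
      show "AE x in lebesgue. (\<lambda>n. indicat_real U x * indicator U (x + X n)) \<longlonglongrightarrow> indicat_real U x"
      proof (rule AE_I2)
        fix x :: 'a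
        show "(\<lambda>n. indicat_real U x * indicator U (x + X n)) \<longlonglongrightarrow> indicat_real U x"
        proof (cases "x \<in> U")
          case True
          have "(\<lambda>n. x + X n) \<longlonglongrightarrow> x + 0" using X by (intro tendsto_intros)
          then have "\<forall>\<^sub>F n in sequentially. x + X n \<in> U"
            using True U(1) topological_tendstoD by fastforce
          then show ?thesis
            using True by (intro tendsto_eventually) (auto elim: eventually_mono)
        qed simp
      qed
      show "integrable lebesgue (indicat_real U)" by (rule iU)
      then show "indicat_real U \<in> borel_measurable lebesgue" by (rule borel_measurable_integrable)
      show "(\<lambda>x. indicat_real U x * indicator U (x + X n)) \<in> borel_measurable lebesgue" for n
        by (rule borel_measurable_integrable[OF ip])
    qed (auto simp: indicator_def)
    then have *: "(\<lambda>n. 2 * (LINT x|lebesgue. indicat_real U x) - 2 * (LINT x|lebesgue. indicat_real U x * indicator U (x + X n)))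
       \<longlonglongrightarrow> 2 * (LINT x|lebesgue. indicat_real U x) - 2 * (LINT x|lebesgue. indicat_real U x)"
      by (intro tendsto_intros)
    \<comment> \<open>Uses |1_A - 1_B| = 1_A + 1_B - 2 1_A 1_B and the fact that U and its translate
      have equal measure.\<close>
    have "(LINT x|lebesgue. \<bar>indicat_real U (x + X n) - indicator U x\<bar>) =
       2 * (LINT x|lebesgue. indicat_real U x) - 2 * (LINT x|lebesgue. indicat_real U x * indicator U (x + X n))" for n
    proof -
      have "(LINT x|lebesgue. \<bar>indicat_real U (x + X n) - indicator U x\<bar>) =
        (LINT x|lebesgue. (indicat_real U (x + X n) + indicator U x) - 2 * (indicat_real U x * indicator U (x + X n)))"
        by (intro Bochner_Integration.integral_cong) (auto simp: indicator_def)
      also have "\<dots> = (LINT x|lebesgue. indicat_real U (x + X n)) + (LINT x|lebesgue. indicat_real U x)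
         - 2 * (LINT x|lebesgue. indicat_real U x * indicator U (x + X n))"
        using ip[of n] iU integrable_shift[OF iU, of "X n"]
        by (simp add: Bochner_Integration.integral_add Bochner_Integration.integral_diff)
      finally show ?thesis
        using integral_shift[of "indicat_real U" "X n"] iU by (simp add: borel_measurable_integrable)
    qed
    with * show ?thesis by (simp add: P_def)
  qed
  have set_case: "P (indicator A)" if A: "A \<in> sets lebesgue" "emeasure lebesgue A < \<infinity>" for A :: "'a set"
  proof (rule approx)
    show iA: "integrable lebesgue (indicat_real A)" using A by simp
    fix e :: real assume "e > 0"
    then obtain T where T: "open T" "A \<subseteq> T" "(T - A) \<in> lmeasurable" "emeasure lebesgue (T - A) < ennreal e"
      using sets_lebesgue_outer_open[OF A(1)] by metis
    have "T = A \<union> (T - A)" using T by auto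
    then have fin: "emeasure lebesgue T < \<infinity>"
      using emeasure_subadditive[of A lebesgue "T - A"] A T(1,4)
      by (metis T(3) ennreal_add_eq_top fmeasurableD fmeasurableD2 infinity_ennreal_def order.not_eq_order_implies_strict
          order_less_irrefl top.not_eq_extremum top_unique)
    have "(LINT x|lebesgue. \<bar>indicat_real A x - indicator T x\<bar>) = (LINT x|lebesgue. indicat_real (T - A) x)"
      using T(2) by (intro Bochner_Integration.integral_cong) (auto simp: indicator_def)
    also have "\<dots> = measure lebesgue (T - A)" using T by simp
    also have "\<dots> < e" using T(4) \<open>e > 0\<close> T(3)
      by (simp add: emeasure_eq_measure2 ennreal_less_iff)
    finally show "\<exists>g. integrable lebesgue g \<and> P g \<and> (LINT x|lebesgue. \<bar>indicat_real A x - g x\<bar>) < e"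
      using open_case[OF T(1) fin] T(1) fin by (intro exI[of _ "indicat_real T"]) auto
  qed
  have "P f"
    using f
  proof (induction rule: integrable_induct)
    case (base A c)
    then show ?case using scale[OF set_case, of A c] by (simp add: mult.commute)
  next
    case (add f g)
    have "(\<lambda>n. LINT x|lebesgue. \<bar>(f (x + X n) + g (x + X n)) - (f x + g x)\<bar>) \<longlonglongrightarrow> 0"
    proof (rule tendsto_sandwich[OF _ _ tendsto_const])
      show "(\<lambda>n. (LINT x|lebesgue. \<bar>f (x + X n) - f x\<bar>) + (LINT x|lebesgue. \<bar>g (x + X n) - g x\<bar>)) \<longlonglongrightarrow> 0"
        using tendsto_add[OF add.IH(1)[unfolded P_def] add.IH(2)[unfolded P_def]] by simp
      have "(LINT x|lebesgue. \<bar>(f (x + X n) + g (x + X n)) - (f x + g x)\<bar>)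
        \<le> (LINT x|lebesgue. \<bar>f (x + X n) - f x\<bar>) + (LINT x|lebesgue. \<bar>g (x + X n) - g x\<bar>)" for n
      proof -
        note i = integrable_shift[OF add.hyps(1), of "X n"] integrable_shift[OF add.hyps(2), of "X n"] add.hyps
        have "(LINT x|lebesgue. \<bar>(f (x + X n) + g (x + X n)) - (f x + g x)\<bar>)
          \<le> (LINT x|lebesgue. \<bar>f (x + X n) - f x\<bar> + \<bar>g (x + X n) - g x\<bar>)"
          using i by (intro integral_mono) auto
        also have "\<dots> = (LINT x|lebesgue. \<bar>f (x + X n) - f x\<bar>) + (LINT x|lebesgue. \<bar>g (x + X n) - g x\<bar>)"
          using i by (intro Bochner_Integration.integral_add) auto
        finally show ?thesis .
      qed
      then show "\<forall>\<^sub>F n in sequentially. (LINT x|lebesgue. \<bar>(f (x + X n) + g (x + X n)) - (f x + g x)\<bar>)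
        \<le> (LINT x|lebesgue. \<bar>f (x + X n) - f x\<bar>) + (LINT x|lebesgue. \<bar>g (x + X n) - g x\<bar>)" by simp
    qed simp
    then show ?case by (simp add: P_def)
  next
    case (lim f s)
    show ?case
    proof (rule approx[OF lim.hyps(4)])
      fix e :: real assume "e > 0"
      have "(\<lambda>i. LINT x|lebesgue. \<bar>f x - s i x\<bar>) \<longlonglongrightarrow> (LINT x|(lebesgue :: 'a measure). 0)"
      \<comment> \<open>The simple approximants are bounded by 2 |f|, hence the factor 3.\<close>
      proof (rule integral_dominated_convergence[where w = "\<lambda>x. 3 * \<bar>f x\<bar>"])
        show "AE x in lebesgue. (\<lambda>i. \<bar>f x - s i x\<bar>) \<longlonglongrightarrow> 0"
        proof (rule AE_I2)
          fix x
          have "(\<lambda>i. \<bar>f x - s i x\<bar>) \<longlonglongrightarrow> \<bar>f x - f x\<bar>"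
            by (intro tendsto_intros lim.hyps(2)) simp
          then show "(\<lambda>i. \<bar>f x - s i x\<bar>) \<longlonglongrightarrow> 0" by simp
        qed
        show "AE x in lebesgue. norm \<bar>f x - s i x\<bar> \<le> 3 * \<bar>f x\<bar>" for i
        proof (rule AE_I2)
          fix x :: 'a
          show "norm \<bar>f x - s i x\<bar> \<le> 3 * \<bar>f x\<bar>" using lim.hyps(3)[of x i] by simp
        qed
      qed (use lim.hyps in auto)
      then have "\<forall>\<^sub>F i in sequentially. (LINT x|lebesgue. \<bar>f x - s i x\<bar>) < e"
        using \<open>e > 0\<close> by (intro order_tendstoD) auto
      then obtain i where "(LINT x|lebesgue. \<bar>f x - s i x\<bar>) < e"
        using eventually_sequentially by auto
      then show "\<exists>g. integrable lebesgue g \<and> P g \<and> (LINT x|lebesgue. \<bar>f x - g x\<bar>) < e"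
        using lim.hyps(1) lim.IH by blast
    qed
  qed
  then show ?thesis by (simp add: P_def)
qed

section \<open>Weak partial derivatives\<close>

lemma test_function_bounded:
  assumes "test_function \<phi>"
  obtains B where "B > 0" "\<And>x. \<bar>\<phi> x\<bar> \<le> B"
proof -
  define K where "K = closure {x. \<phi> x \<noteq> 0}"
  have "compact (\<phi> ` K)"
    using assms smooth_continuous[OF test_function_smooth[OF assms]]
    by (intro compact_continuous_image) (auto simp: test_function_def K_def intro: continuous_on_subset)
  then obtain B where B: "B > 0" "\<And>y. y \<in> \<phi> ` K \<Longrightarrow> norm y \<le> B"
    using compact_imp_bounded bounded_pos by metis
  have "\<bar>\<phi> x\<bar> \<le> B" for x
    using B closure_subset[of "{x. \<phi> x \<noteq> 0}"] by (cases "\<phi> x = 0") (auto simp: K_def)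
  then show ?thesis using that B by blast
qed

text \<open>Cubes instead of balls: a shift along an axis changes one coordinate only, so supports
  can be tracked coordinate by coordinate.\<close>

abbreviation cube :: "real \<Rightarrow> (real^'n) set" where
  "cube r \<equiv> box (\<chi> i. - r) (\<chi> i. r)"

lemma mem_cube: "x \<in> cube r \<longleftrightarrow> (\<forall>i. \<bar>x $ i\<bar> < r)" for x :: "real^'n::finite"
  by (auto simp: mem_box_cart abs_less_iff) (use minus_less_iff in blast)+

lemma bounded_subset_cube:
  fixes K :: "(real^'n::finite) set"
  assumes "bounded K"
  obtains r where "r > 0" "K \<subseteq> cube r"
proof -
  obtain r where r: "r > 0" "\<And>x. x \<in> K \<Longrightarrow> norm x \<le> r" using assms bounded_pos by metis
  have "K \<subseteq> cube (r + 1)"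
  proof
    fix x assume "x \<in> K"
    then have "\<bar>x $ i\<bar> < r + 1" for i using r(2)[of x] component_le_norm_cart[of x i] by linarith
    then show "x \<in> cube (r + 1)" unfolding mem_cube by simp
  qed
  then show ?thesis using that[of "r + 1"] r by auto
qed

lemma test_function_support:
  assumes "test_function \<phi>"
  obtains r where "r > 0" "\<And>x. x \<notin> cube r \<Longrightarrow> \<phi> x = 0"
proof -
  have "bounded {x. \<phi> x \<noteq> 0}"
    using assms bounded_subset[OF compact_imp_bounded closure_subset] unfolding test_function_def by blast
  then obtain r where "r > 0" "{x. \<phi> x \<noteq> 0} \<subseteq> cube r" by (rule bounded_subset_cube)
  then show ?thesis using that by blast
qed

lemma test_functionI_cube:
  fixes \<phi> :: "real^'n::finite \<Rightarrow> real"
  assumes "smooth \<phi>" "\<And>x. x \<notin> cube r \<Longrightarrow> \<phi> x = 0"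
  shows "test_function \<phi>"
proof (rule test_functionI[OF assms(1) compact_cbox])
  fix x :: "real^'n" assume "x \<notin> cbox (\<chi> i. - r) (\<chi> i. r)"
  then show "\<phi> x = 0" using assms(2) box_subset_cbox[of "\<chi> i. - r" "\<chi> i. r"] by blast
qed

lemma partial_deriv_eq_0:
  assumes "open S" "x \<in> S" "\<And>y. y \<in> S \<Longrightarrow> \<phi> y = 0"
  shows "partial_deriv i \<phi> x = 0"
proof -
  have "(\<phi> has_derivative (\<lambda>_. 0)) (at x)"
    by (rule has_derivative_transform_within_open[of "\<lambda>_. 0" _ _ _ S]) (use assms in auto)
  from partial_deriv_eq[OF this] show ?thesis by simp
qed

lemma test_function_partial_deriv:
  assumes "test_function \<phi>" shows "test_function (partial_deriv i \<phi>)"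
proof -
  define K where "K = closure {x. \<phi> x \<noteq> 0}"
  have "partial_deriv i \<phi> x = 0" if "x \<notin> K" for x
  proof (rule partial_deriv_eq_0[of "- K"])
    show "open (- K)" by (simp add: K_def open_Compl)
    show "x \<in> - K" using that by simp
    show "\<phi> y = 0" if "y \<in> - K" for y
      using that closure_subset[of "{x. \<phi> x \<noteq> 0}"] unfolding K_def by blast
  qed
  moreover have "compact K" using assms by (simp add: K_def test_function_def)
  ultimately show ?thesis
    by (rule test_functionI[OF smooth_partial_deriv[OF test_function_smooth[OF assms]], rotated])
qed

lemma test_function_shift:
  assumes "test_function \<phi>" shows "test_function (\<lambda>x. \<phi> (x + a))"
proof -
  obtain r where r: "r > 0" "\<And>x. x \<notin> cube r \<Longrightarrow> \<phi> x = 0" using test_function_support[OF assms] by blast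
  have "\<phi> (x + a) = 0" if "x \<notin> (\<lambda>x. x - a) ` cbox (\<chi> i. - r) (\<chi> i. r)" for x
  proof (rule r(2))
    show "x + a \<notin> cube r"
    proof
      assume "x + a \<in> cube r"
      then have "x + a \<in> cbox (\<chi> i. - r) (\<chi> i. r)" using box_subset_cbox by blast
      then have "x + a - a \<in> (\<lambda>x. x - a) ` cbox (\<chi> i. - r) (\<chi> i. r)" by (rule imageI)
      then show False using that by simp
    qed
  qed
  then show ?thesis
    by (rule test_functionI[OF smooth_shift[OF test_function_smooth[OF assms]]
       compact_translation_subtract[OF compact_cbox]])
qed

section \<open>Local integrability\<close>

lemma cube_mono: "r \<le> s \<Longrightarrow> cube r \<subseteq> (cube s :: (real^'n::finite) set)"
  unfolding subset_iff mem_cube by (meson less_le_trans)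

lemma compact_lebesgue: "compact K \<Longrightarrow> K \<in> sets lebesgue"
  using borel_compact[of K] by simp

lemma locally_integrable_cube:
  assumes "locally_integrable f"
  shows "integrable lebesgue (\<lambda>x. indicator (cube r) x * f x)"
proof -
  have "set_integrable lebesgue (cube r) f"
  proof (rule set_integrable_subset)
    show "set_integrable lebesgue (cbox (\<chi> i. - r) (\<chi> i. r)) f"
      using assms by (auto simp: locally_integrable_def)
  qed (auto simp: box_subset_cbox)
  then show ?thesis by (simp add: set_integrable_def)
qed

lemma locally_integrable_measurable:
  fixes f :: "real^'n::finite \<Rightarrow> real"
  assumes "locally_integrable f" shows "f \<in> borel_measurable lebesgue"
proof (rule borel_measurable_LIMSEQ_real)
  fix n show "(\<lambda>x. indicator (cube (real n)) x * f x) \<in> borel_measurable lebesgue"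
    using locally_integrable_cube[OF assms] by (rule borel_measurable_integrable)
next
  fix x :: "real^'n"
  obtain r where r: "r > 0" "{x} \<subseteq> cube r" using bounded_subset_cube[of "{x}"] by auto
  have "\<forall>\<^sub>F n in sequentially. indicator (cube (real n)) x * f x = f x"
    using eventually_ge_at_top[of "nat \<lceil>r\<rceil>"]
  proof eventually_elim
    case (elim n)
    then have "r \<le> real n" by linarith
    then have "x \<in> cube (real n)" using r cube_mono by blast
    then show ?case by simp
  qed
  then show "(\<lambda>n. indicator (cube (real n)) x * f x) \<longlonglongrightarrow> f x" by (rule tendsto_eventually)
qed

lemma locally_integrable_bound:
  fixes f g :: "real^'n::finite \<Rightarrow> real"
  assumes "locally_integrable g" "f \<in> borel_measurable lebesgue" "AE x in lebesgue. \<bar>f x\<bar> \<le> \<bar>g x\<bar>"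
  shows "locally_integrable f"
  unfolding locally_integrable_def
proof (intro allI impI)
  fix K :: "(real^'n) set" assume K: "compact K"
  then have KL: "K \<in> sets lebesgue" by (rule compact_lebesgue)
  show "set_integrable lebesgue K f"
    unfolding set_integrable_def real_scaleR_def
  proof (rule Bochner_Integration.integrable_bound[of lebesgue "\<lambda>x. indicat_real K x * g x"])
    show "integrable lebesgue (\<lambda>x. indicat_real K x * g x)"
      using assms(1) K by (simp add: locally_integrable_def set_integrable_def)
    show "(\<lambda>x. indicat_real K x * f x) \<in> borel_measurable lebesgue"
      using KL assms(2) by (intro borel_measurable_times borel_measurable_indicator)
    show "AE x in lebesgue. norm (indicat_real K x * f x) \<le> norm (indicat_real K x * g x)"
      using assms(3) by eventually_elim (simp add: abs_mult mult_left_mono)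
  qed
qed

lemma locally_integrable_add:
  "locally_integrable f \<Longrightarrow> locally_integrable g \<Longrightarrow> locally_integrable (\<lambda>x. f x + g x)"
  by (auto simp: locally_integrable_def intro: set_integral_add)

lemma locally_integrable_continuous:
  fixes f :: "real^'n::finite \<Rightarrow> real"
  assumes "continuous_on UNIV f" shows "locally_integrable f"
  unfolding locally_integrable_def
proof (intro allI impI)
  fix K :: "(real^'n) set" assume K: "compact K"
  then show "set_integrable lebesgue K f"
    using borel_integrable_compact[OF K continuous_on_subset[OF assms subset_UNIV]]
    unfolding set_integrable_def by (subst integrable_completion) (auto intro: borel_measurable_integrable)
qed

lemma locally_integrable_mult_continuous:
  fixes f g :: "real^'n::finite \<Rightarrow> real"
  assumes "locally_integrable f" "continuous_on UNIV g" shows "locally_integrable (\<lambda>x. f x * g x)"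
  unfolding locally_integrable_def
proof (intro allI impI)
  fix K :: "(real^'n) set" assume K: "compact K"
  then have "bounded (g ` K)"
    using assms(2) by (intro compact_imp_bounded compact_continuous_image) (auto intro: continuous_on_subset)
  then obtain B where B: "\<And>x. x \<in> K \<Longrightarrow> \<bar>g x\<bar> \<le> B" by (auto simp: bounded_iff)
  have m: "(\<lambda>x. indicat_real K x * (f x * g x)) \<in> borel_measurable lebesgue"
    using compact_lebesgue[OF K] locally_integrable_measurable[OF assms(1)]
     locally_integrable_measurable[OF locally_integrable_continuous[OF assms(2)]]
    by (intro borel_measurable_times borel_measurable_indicator) auto
  have "integrable lebesgue (\<lambda>x. B * (indicat_real K x * f x))"
    using assms(1) K by (auto simp: locally_integrable_def set_integrable_def)
  then show "set_integrable lebesgue K (\<lambda>x. f x * g x)"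
    unfolding set_integrable_def real_scaleR_def
  proof (rule Bochner_Integration.integrable_bound[OF _ m], intro AE_I2)
    fix x
    have "\<bar>g x\<bar> * \<bar>f x\<bar> \<le> \<bar>B\<bar> * \<bar>f x\<bar>" if "x \<in> K"
      using B[OF that] by (intro mult_right_mono) auto
    then show "norm (indicat_real K x * (f x * g x)) \<le> norm (B * (indicat_real K x * f x))"
      by (auto simp: indicator_def abs_mult mult.commute)
  qed
qed

lemma locally_integrable_cmult: "locally_integrable f \<Longrightarrow> locally_integrable (\<lambda>x. c * f x)"
  using locally_integrable_mult_continuous[of f "\<lambda>_. c"] by (simp add: mult.commute continuous_on_const)

lemma locally_integrable_abs: "locally_integrable f \<Longrightarrow> locally_integrable (\<lambda>x. \<bar>f x\<bar>)"
  by (rule locally_integrable_bound[of f]) (auto intro: borel_measurable_abs locally_integrable_measurable)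

lemma locally_integrable_shift:
  fixes f :: "real^'n::finite \<Rightarrow> real"
  assumes "locally_integrable f" shows "locally_integrable (\<lambda>x. f (x + a))"
  unfolding locally_integrable_def
proof (intro allI impI)
  fix K :: "(real^'n) set" assume K: "compact K"
  then have "set_integrable lebesgue ((\<lambda>x. x + a) ` K) f"
    using assms compact_continuous_image[of K "\<lambda>x. x + a"]
    by (simp add: locally_integrable_def continuous_intros)
  from integrable_shift[OF this[unfolded set_integrable_def], of a]
  show "set_integrable lebesgue K (\<lambda>x. f (x + a))"
    unfolding set_integrable_def
  proof (rule back_subst[where P = "integrable lebesgue"])
    have "x + a \<in> (\<lambda>x. x + a) ` K \<longleftrightarrow> x \<in> K" for x by auto
    then show "(\<lambda>x. indicat_real ((\<lambda>x. x + a) ` K) (x + a) *\<^sub>R f (x + a)) = (\<lambda>x. indicat_real K x *\<^sub>R f (x + a))"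
      by (simp add: indicator_def)
  qed
qed

lemma measurable_test: "test_function \<phi> \<Longrightarrow> \<phi> \<in> borel_measurable lebesgue"
  by (simp add: measurable_smooth test_function_smooth)

lemma integrable_mult_test:
  fixes f :: "real^'n::finite \<Rightarrow> real"
  assumes "locally_integrable f" "test_function \<phi>"
  shows "integrable lebesgue (\<lambda>x. f x * \<phi> x)"
proof -
  obtain r where r: "r > 0" "\<And>x. x \<notin> cube r \<Longrightarrow> \<phi> x = 0" using test_function_support[OF assms(2)] by blast
  have "integrable lebesgue (\<lambda>x. indicator (cube r) x * (f x * \<phi> x))"
    by (intro locally_integrable_cube locally_integrable_mult_continuous assms smooth_continuous test_function_smooth)
  then show ?thesis
  proof (rule back_subst[where P = "integrable lebesgue"])
    show "(\<lambda>x. indicator (cube r) x * (f x * \<phi> x)) = (\<lambda>x. f x * \<phi> x)"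
    proof
      fix x show "indicator (cube r) x * (f x * \<phi> x) = f x * \<phi> x"
        using r(2)[of x] by (cases "x \<in> cube r") auto
    qed
  qed
qed

lemma AE_cubes:
  assumes "\<And>n::nat. AE x in lebesgue. x \<in> cube (real n) \<longrightarrow> P x"
  shows "AE x in lebesgue. P (x :: real^'n::finite)"
proof -
  have "AE x in lebesgue. \<forall>n. x \<in> cube (real n) \<longrightarrow> P x" using assms by (subst AE_all_countable) blast
  then show ?thesis
  proof eventually_elim
    case (elim x)
    obtain r where r: "r > 0" "{x} \<subseteq> cube r" using bounded_subset_cube[of "{x}"] by auto
    obtain n where "r \<le> real n" using real_arch_simple by blast
    then have "x \<in> cube (real n)" using r cube_mono by blast
    then show ?case using elim by blast
  qed
qed

lemma locally_integrable_AE_zero: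
  fixes f :: "real^'n::finite \<Rightarrow> real"
  assumes "locally_integrable f" "\<And>\<phi>. test_function \<phi> \<Longrightarrow> (LINT x|lebesgue. f x * \<phi> x) = 0"
  shows "AE x in lebesgue. f x = 0"
proof (rule AE_cubes)
  show "AE x in lebesgue. x \<in> cube (real n) \<longrightarrow> f x = 0" for n :: nat
    using locally_integrable_cube[OF assms(1)] assms(2)
    by (intro fundamental_lemma) (simp_all add: set_integrable_def)
qed

section \<open>Uniqueness and calculus of weak derivatives\<close>

lemma weak_partial_unique:
  fixes u :: "real^'n::finite \<Rightarrow> real"
  assumes "weak_partial i u g" "weak_partial i u h"
  shows "AE x in lebesgue. g x = h x"
proof -
  have "AE x in lebesgue. g x + (-1) * h x = 0"
  proof (rule locally_integrable_AE_zero)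
    show "locally_integrable (\<lambda>x. g x + - 1 * h x)"
      using assms by (intro locally_integrable_add locally_integrable_cmult) (auto simp: weak_partial_def)
    fix \<phi> :: "real^'n \<Rightarrow> real" assume \<phi>: "test_function \<phi>"
    have "(LINT x|lebesgue. (g x + - 1 * h x) * \<phi> x) = (LINT x|lebesgue. g x * \<phi> x - h x * \<phi> x)"
      by (simp add: algebra_simps)
    also have "\<dots> = (LINT x|lebesgue. g x * \<phi> x) - (LINT x|lebesgue. h x * \<phi> x)"
      using assms \<phi> by (intro Bochner_Integration.integral_diff integrable_mult_test) (auto simp: weak_partial_def)
    also have "\<dots> = 0"
      using assms \<phi> by (auto simp: weak_partial_def)
    finally show "(LINT x|lebesgue. (g x + - 1 * h x) * \<phi> x) = 0" .
  qed
  then show ?thesis by eventually_elim simp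
qed

lemma weak_partial_cong:
  fixes u :: "real^'n::finite \<Rightarrow> real"
  assumes w: "weak_partial i u g" and "v \<in> borel_measurable lebesgue" "h \<in> borel_measurable lebesgue"
    and e: "AE x in lebesgue. u x = v x" "AE x in lebesgue. g x = h x"
  shows "weak_partial i v h"
  unfolding weak_partial_def
proof (intro conjI allI impI)
  have l: "locally_integrable u" "locally_integrable g" using w by (auto simp: weak_partial_def)
  show v: "locally_integrable v"
    using assms(2) e(1) by (intro locally_integrable_bound[OF l(1)]) (auto elim: eventually_mono)
  show h: "locally_integrable h"
    using assms(3) e(2) by (intro locally_integrable_bound[OF l(2)]) (auto elim: eventually_mono)
  fix \<phi> :: "real^'n \<Rightarrow> real" assume \<phi>: "test_function \<phi>"
  have "(LINT x|lebesgue. v x * partial_deriv i \<phi> x) = (LINT x|lebesgue. u x * partial_deriv i \<phi> x)"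
    using e(1) by (intro integral_cong_AE borel_measurable_integrable integrable_mult_test v l test_function_partial_deriv \<phi>)
      (auto elim: eventually_mono)
  also have "\<dots> = - (LINT x|lebesgue. g x * \<phi> x)" using w \<phi> by (simp add: weak_partial_def)
  also have "(LINT x|lebesgue. g x * \<phi> x) = (LINT x|lebesgue. h x * \<phi> x)"
    using e(2) by (intro integral_cong_AE borel_measurable_integrable integrable_mult_test h l \<phi>)
      (auto elim: eventually_mono)
  finally show "(LINT x|lebesgue. v x * partial_deriv i \<phi> x) = - (LINT x|lebesgue. h x * \<phi> x)" .
qed

lemma weak_partial_cmult:
  assumes "weak_partial i u g" shows "weak_partial i (\<lambda>x. c * u x) (\<lambda>x. c * g x)"
  using assms by (simp add: weak_partial_def locally_integrable_cmult mult.assoc)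

lemma weak_partial_shift:
  fixes u :: "real^'n::finite \<Rightarrow> real"
  assumes w: "weak_partial i u g" shows "weak_partial i (\<lambda>x. u (x + a)) (\<lambda>x. g (x + a))"
  unfolding weak_partial_def
proof (intro conjI allI impI)
  have l: "locally_integrable u" "locally_integrable g" using w by (auto simp: weak_partial_def)
  then show "locally_integrable (\<lambda>x. u (x + a))" "locally_integrable (\<lambda>x. g (x + a))"
    by (auto intro: locally_integrable_shift)
  fix \<phi> :: "real^'n \<Rightarrow> real" assume \<phi>: "test_function \<phi>"
  define \<psi> where "\<psi> x = \<phi> (x + - a)" for x
  have \<psi>: "test_function \<psi>" unfolding \<psi>_def[abs_def] by (rule test_function_shift[OF \<phi>])
  have d: "partial_deriv i \<psi> (x + a) = partial_deriv i \<phi> x" for x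
    unfolding \<psi>_def[abs_def]
    by (subst partial_deriv_shift) (auto intro: smooth_differentiable test_function_smooth \<phi>)
  have "(LINT x|lebesgue. u (x + a) * partial_deriv i \<phi> x) = (LINT x|lebesgue. u (x + a) * partial_deriv i \<psi> (x + a))"
    by (simp add: d)
  also have "\<dots> = (LINT x|lebesgue. u x * partial_deriv i \<psi> x)"
    by (rule integral_shift[of "\<lambda>x. u x * partial_deriv i \<psi> x"])
      (intro borel_measurable_integrable integrable_mult_test l test_function_partial_deriv \<psi>)
  also have "\<dots> = - (LINT x|lebesgue. g x * \<psi> x)" using w \<psi> by (simp add: weak_partial_def)
  also have "(LINT x|lebesgue. g x * \<psi> x) = (LINT x|lebesgue. g (x + a) * \<psi> (x + a))"
    by (rule integral_shift[of "\<lambda>x. g x * \<psi> x", symmetric])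
      (intro borel_measurable_integrable integrable_mult_test l \<psi>)
  finally show "(LINT x|lebesgue. u (x + a) * partial_deriv i \<phi> x) = - (LINT x|lebesgue. g (x + a) * \<phi> x)"
    by (simp add: \<psi>_def)
qed

text \<open>The smooth factor is moved onto the test function: \<eta> \<phi> is again a test
  function, and the classical product rule for it produces the extra term.\<close>

lemma weak_partial_mult_smooth:
  fixes u :: "real^'n::finite \<Rightarrow> real"
  assumes w: "weak_partial i u g" and s: "smooth \<eta>"
  shows "weak_partial i (\<lambda>x. u x * \<eta> x) (\<lambda>x. g x * \<eta> x + u x * partial_deriv i \<eta> x)"
  unfolding weak_partial_def
proof (intro conjI allI impI)
  have l: "locally_integrable u" "locally_integrable g" using w by (auto simp: weak_partial_def)
  show "locally_integrable (\<lambda>x. u x * \<eta> x)"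
    by (intro locally_integrable_mult_continuous l smooth_continuous s)
  show "locally_integrable (\<lambda>x. g x * \<eta> x + u x * partial_deriv i \<eta> x)"
    by (intro locally_integrable_add locally_integrable_mult_continuous l smooth_continuous smooth_partial_deriv s)
  fix \<phi> :: "real^'n \<Rightarrow> real" assume \<phi>: "test_function \<phi>"
  obtain r where r: "r > 0" "\<And>x. x \<notin> cube r \<Longrightarrow> \<phi> x = 0" using test_function_support[OF \<phi>] by blast
  have \<psi>: "test_function (\<lambda>x. \<eta> x * \<phi> x)"
    by (rule test_functionI_cube[of _ r]) (auto intro: smooth_mult s test_function_smooth \<phi> simp: r)
  have \<psi>': "test_function (\<lambda>x. partial_deriv i \<eta> x * \<phi> x)"
    by (rule test_functionI_cube[of _ r]) (auto intro: smooth_mult smooth_partial_deriv s test_function_smooth \<phi> simp: r)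
  have d: "partial_deriv i (\<lambda>x. \<eta> x * \<phi> x) x = \<eta> x * partial_deriv i \<phi> x + partial_deriv i \<eta> x * \<phi> x" for x
    by (intro partial_deriv_mult smooth_differentiable test_function_smooth s \<phi>)
  have "(LINT x|lebesgue. u x * \<eta> x * partial_deriv i \<phi> x) =
      (LINT x|lebesgue. u x * partial_deriv i (\<lambda>x. \<eta> x * \<phi> x) x - u x * (partial_deriv i \<eta> x * \<phi> x))"
    by (simp add: d algebra_simps)
  also have "\<dots> = (LINT x|lebesgue. u x * partial_deriv i (\<lambda>x. \<eta> x * \<phi> x) x) - (LINT x|lebesgue. u x * (partial_deriv i \<eta> x * \<phi> x))"
    by (intro Bochner_Integration.integral_diff integrable_mult_test l \<psi>' test_function_partial_deriv \<psi>)
  also have "(LINT x|lebesgue. u x * partial_deriv i (\<lambda>x. \<eta> x * \<phi> x) x) = - (LINT x|lebesgue. g x * (\<eta> x * \<phi> x))"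
    using w \<psi> by (simp add: weak_partial_def)
  also have "- (LINT x|lebesgue. g x * (\<eta> x * \<phi> x)) - (LINT x|lebesgue. u x * (partial_deriv i \<eta> x * \<phi> x)) =
      - ((LINT x|lebesgue. g x * (\<eta> x * \<phi> x)) + (LINT x|lebesgue. u x * (partial_deriv i \<eta> x * \<phi> x)))"
    by simp
  also have "(LINT x|lebesgue. g x * (\<eta> x * \<phi> x)) + (LINT x|lebesgue. u x * (partial_deriv i \<eta> x * \<phi> x)) =
      (LINT x|lebesgue. g x * (\<eta> x * \<phi> x) + u x * (partial_deriv i \<eta> x * \<phi> x))"
    by (intro Bochner_Integration.integral_add[symmetric] integrable_mult_test l \<psi> \<psi>')
  finally show "(LINT x|lebesgue. u x * \<eta> x * partial_deriv i \<phi> x) =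
      - (LINT x|lebesgue. (g x * \<eta> x + u x * partial_deriv i \<eta> x) * \<phi> x)"
    by (simp add: algebra_simps)
qed

section \<open>Increments as integrals of the weak derivative\<close>

lemma partial_deriv_outside_cube:
  fixes \<phi> :: "real^'n::finite \<Rightarrow> real"
  assumes "\<And>x. x \<notin> cube r \<Longrightarrow> \<phi> x = 0" "x \<notin> cube (r + 1)"
  shows "partial_deriv i \<phi> x = 0"
proof (rule partial_deriv_eq_0[of "- cbox (\<chi> i. - r) (\<chi> i. r)"])
  show "open (- cbox (\<chi> i. - r) (\<chi> i. r))" by (simp add: open_Compl closed_cbox)
  show "x \<in> - cbox (\<chi> i. - r) (\<chi> i. r)"
  proof -
    obtain j where "\<not> \<bar>x $ j\<bar> < r + 1" using assms(2) unfolding mem_cube by blast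
    then have "\<not> (- r \<le> x $ j \<and> x $ j \<le> r)" by linarith
    then show ?thesis by (auto simp: mem_box_cart)
  qed
  show "\<phi> y = 0" if "y \<in> - cbox (\<chi> i. - r) (\<chi> i. r)" for y
    using that assms(1) box_subset_cbox[of "\<chi> i. - r" "\<chi> i. r"] by blast
qed

lemma lborel_shift: "distr lborel borel (\<lambda>x. x + a) = (lborel :: 'a::euclidean_space measure)"
proof -
  have "(+) a = (\<lambda>x. x + a)" by (auto simp: add.commute)
  then show ?thesis using lborel_distr_plus[of a] by simp
qed

lemma integrable_lborel_shift:
  fixes G :: "'a::euclidean_space \<Rightarrow> real"
  assumes "integrable lborel G" shows "integrable lborel (\<lambda>x. G (x + a))"
  using assms integrable_distr[of "\<lambda>x. x + a" lborel borel G] by (simp add: lborel_shift)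

lemma integral_lborel_shift:
  fixes G :: "'a::euclidean_space \<Rightarrow> real"
  assumes "G \<in> borel_measurable borel" shows "(LINT x|lborel. G (x + a)) = (LINT x|lborel. G x)"
  using assms integral_distr[of "\<lambda>x. x + a" lborel borel G] by (simp add: lborel_shift)

text \<open>By translation invariance the integral of |G| in x is the same for every \<tau>, so only
  the indicator of [0, 1] remains to be integrated. This bound justifies the exchanges of integrals
  along segments.\<close>

lemma integrable_moving_average:
  fixes G :: "'a::euclidean_space \<Rightarrow> real"
  assumes G: "integrable lborel G"
  shows "integrable (lborel \<Otimes>\<^sub>M lborel) (\<lambda>(\<tau>::real, x). indicator {0..1} \<tau> * G (x + (t * \<tau>) *\<^sub>R e))"
proof (rule lborel_pair.Fubini_integrable)
  have [measurable]: "G \<in> borel_measurable borel" using borel_measurable_integrable[OF G] by simp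
  show "(\<lambda>(\<tau>::real, x). indicator {0..1} \<tau> * G (x + (t * \<tau>) *\<^sub>R e)) \<in> borel_measurable (lborel \<Otimes>\<^sub>M lborel)"
    by measurable
  have "(LINT y|lborel. norm (case (x, y) of (\<tau>, x) \<Rightarrow> indicator {0..1} \<tau> * G (x + (t * \<tau>) *\<^sub>R e)))
      = indicator {0..1} x *\<^sub>R (LINT y|lborel. \<bar>G y\<bar>)" for x :: real
    using integral_lborel_shift[of "\<lambda>y. \<bar>G y\<bar>" "(t * x) *\<^sub>R e"]
    by (simp add: abs_mult)
  then show "integrable lborel (\<lambda>x::real. LINT y|lborel. norm (case (x, y) of (\<tau>, x) \<Rightarrow> indicator {0..1} \<tau> * G (x + (t * \<tau>) *\<^sub>R e)))"
    by (simp del: real_scaleR_def)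
  show "AE x in lborel. integrable lborel (\<lambda>y. case (x, y) of (\<tau>::real, x) \<Rightarrow> indicator {0..1} \<tau> * G (x + (t * \<tau>) *\<^sub>R e))"
    using integrable_lborel_shift[OF G] by simp
qed

lemma continuous_borel: "continuous_on UNIV f \<Longrightarrow> f \<in> borel_measurable borel"
  by (rule borel_measurable_continuous_onI)

lemma line_derivative:
  fixes \<phi> :: "real^'n::finite \<Rightarrow> real"
  assumes "smooth \<phi>"
  shows "((\<lambda>\<tau>. \<phi> (x + (t * \<tau>) *\<^sub>R axis i 1)) has_field_derivative
     t * partial_deriv i \<phi> (x + (t * s) *\<^sub>R axis i 1)) (at s)"
proof -
  let ?D = "frechet_derivative \<phi> (at (x + (t * s) *\<^sub>R axis i 1))"
  have D: "(\<phi> has_derivative ?D) (at (x + (t * s) *\<^sub>R axis i 1))"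
    by (intro has_derivative_frechet smooth_differentiable assms)
  have 1: "((\<lambda>\<tau>. x + (t * \<tau>) *\<^sub>R axis i 1) has_derivative (\<lambda>h. (t * h) *\<^sub>R axis i 1)) (at s)"
    by (auto intro!: derivative_eq_intros)
  have "((\<lambda>\<tau>. \<phi> (x + (t * \<tau>) *\<^sub>R axis i 1)) has_derivative (\<lambda>h. ?D ((t * h) *\<^sub>R axis i 1))) (at s)"
    by (rule has_derivative_compose[OF 1 D])
  moreover have "?D ((t * h) *\<^sub>R axis i 1) = t * partial_deriv i \<phi> (x + (t * s) *\<^sub>R axis i 1) * h" for h
    using linear_scale[OF has_derivative_linear[OF D]] by (simp add: partial_deriv_def)
  ultimately show ?thesis by (simp add: has_field_derivative_def)
qed

lemma line_FTC:
  fixes \<phi> :: "real^'n::finite \<Rightarrow> real"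
  assumes "smooth \<phi>"
  shows "(LINT \<tau>|lborel. indicator {0..1} \<tau> * (t * partial_deriv i \<phi> (x + (t * \<tau>) *\<^sub>R axis i 1)))
    = \<phi> (x + t *\<^sub>R axis i 1) - \<phi> x"
proof -
  have "isCont (\<lambda>\<tau>. t * partial_deriv i \<phi> (x + (t * \<tau>) *\<^sub>R axis i 1)) s" for s
  proof -
    have 1: "isCont (\<lambda>\<tau>. x + (t * \<tau>) *\<^sub>R axis i 1) s" by (intro continuous_intros)
    have 2: "isCont (partial_deriv i \<phi>) y" for y
      using smooth_continuous[OF smooth_partial_deriv[OF assms]] by (simp add: continuous_on_eq_continuous_at)
    show ?thesis by (rule isCont_mult[OF continuous_const isCont_o2[OF 1 2]])
  qed
  then have "has_bochner_integral lborel (\<lambda>\<tau>. t * partial_deriv i \<phi> (x + (t * \<tau>) *\<^sub>R axis i 1) * indicator {0..1} \<tau>)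
      (\<phi> (x + (t * 1) *\<^sub>R axis i 1) - \<phi> (x + (t * 0) *\<^sub>R axis i 1))"
    by (intro has_bochner_integral_FTC_Icc_real line_derivative assms) auto
  then show ?thesis by (simp add: has_bochner_integral_integral_eq mult.commute)
qed

text \<open>Fubini is used on a product of Borel measures, where a merely Lebesgue measurable g need
  not compose measurably with the map sending (\<tau>, x) to x + t \<tau> e. Hence g is replaced on
  a cube by an integrable Borel function.\<close>

lemma borel_representative_cube:
  fixes g :: "real^'n::finite \<Rightarrow> real"
  assumes "locally_integrable g"
  obtains G where "integrable lborel G" "AE x in lebesgue. G x = indicator (cube r) x * g x"
proof -
  note i = locally_integrable_cube[OF assms, of r]
  obtain G where G: "G \<in> borel_measurable borel" "AE x in lebesgue. indicator (cube r) x * g x = G x"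
    by (rule lebesgue_borel_representative[OF borel_measurable_integrable[OF i]])
  have "integrable lebesgue G"
    using integrable_cong_AE[OF borel_measurable_integrable[OF i] _ G(2)] G(1) i
    by (simp add: measurable_completion)
  then have "integrable lborel G" using G(1) by (simp add: integrable_completion)
  moreover have "AE x in lebesgue. G x = indicator (cube r) x * g x"
    using G(2) by eventually_elim simp
  ultimately show ?thesis by (rule that)
qed

text \<open>The fundamental theorem of calculus by duality: tested against \<phi> supported in the
  cube, the average of g along the segment is transferred to \<phi>, where the classical theorem
  applies, and the fundamental lemma then removes \<phi>. The margin 2 consists of one unit for the
  shift and one unit around the support of \<phi>, beyond which its derivative is known to
  vanish.\<close>

lemma weak_partial_increment:
  fixes u g :: "real^'n::finite \<Rightarrow> real"
  assumes w: "weak_partial i u g" and t: "0 \<le> t" "t \<le> 1"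
    and iG: "integrable lborel G" and G: "AE x in lebesgue. G x = indicator (cube (r + 2)) x * g x"
  shows "AE x in lebesgue. x \<in> cube r \<longrightarrow> u (x + t *\<^sub>R axis i 1) - u x =
     t * (LINT \<tau>|lborel. indicator {0..1} \<tau> * G (x + (t * \<tau>) *\<^sub>R axis i 1))"
proof -
  let ?e = "axis i 1 :: real^'n"
  have l: "locally_integrable u" "locally_integrable g" using w by (auto simp: weak_partial_def)
  obtain U where iU: "integrable lborel U" and U: "AE x in lebesgue. U x = indicator (cube (r + 2)) x * u x"
    using borel_representative_cube[OF l(1)] by blast
  have [measurable]: "U \<in> borel_measurable borel" "G \<in> borel_measurable borel"
    using iU iG by auto
  have mL: "f \<in> borel_measurable lebesgue" if "f \<in> borel_measurable borel" for f :: "real^'n \<Rightarrow> real"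
    using that by (simp add: measurable_completion)
  define H where "H x = (LINT \<tau>|lborel. indicator {0..1} \<tau> * G (x + (t * \<tau>) *\<^sub>R ?e))" for x
  have iH: "integrable lborel H"
    using lborel_pair.integrable_snd[of "\<lambda>\<tau> x. indicator {0..1} \<tau> * G (x + (t * \<tau>) *\<^sub>R ?e)"]
      integrable_moving_average[OF iG, of t ?e] unfolding H_def[abs_def] by blast
  let ?A = "\<lambda>\<tau> x. indicator {0..1} \<tau> * G (x + (t * \<tau>) *\<^sub>R ?e)"
  have [measurable]: "H \<in> borel_measurable borel" using iH by auto
  have iHL: "integrable lebesgue H" using iH by (simp add: integrable_completion)
  have *: "(LINT x|lebesgue. (u (x + t *\<^sub>R ?e) - u x - t * H x) * \<phi> x) = 0"
    if \<phi>: "test_function \<phi>" and r: "\<And>x. x \<notin> cube r \<Longrightarrow> \<phi> x = 0" for \<phi>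
  proof -
    have sm: "smooth \<phi>" by (rule test_function_smooth[OF \<phi>])
    let ?D = "partial_deriv i \<phi>"
    let ?B = "\<lambda>\<tau> x. indicator {0..1} \<tau> * U x * ?D (x + - ((t * \<tau>) *\<^sub>R ?e))"
    have \<phi>': "test_function ?D" by (rule test_function_partial_deriv[OF \<phi>])
    have [measurable]: "\<phi> \<in> borel_measurable borel" "?D \<in> borel_measurable borel"
      by (intro continuous_borel smooth_continuous sm smooth_partial_deriv)+
    obtain B where B: "B > 0" "\<And>x. \<bar>\<phi> x\<bar> \<le> B" using test_function_bounded[OF \<phi>] by blast
    obtain B' where B': "B' > 0" "\<And>x. \<bar>?D x\<bar> \<le> B'" using test_function_bounded[OF \<phi>'] by blast
    have sh: "\<bar>(s *\<^sub>R ?e) $ j\<bar> \<le> 1" if "0 \<le> s" "s \<le> 1" for s j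
      using that by (simp add: axis_def)
    have in2: "x + s *\<^sub>R ?e \<in> cube (r + 2)" if "x \<in> cube r" "0 \<le> s" "s \<le> 1" for x s
      unfolding mem_cube
    proof
      fix j
      have "\<bar>x $ j\<bar> < r" using that(1) unfolding mem_cube by blast
      then show "\<bar>(x + s *\<^sub>R ?e) $ j\<bar> < r + 2" using sh[OF that(2,3), of j] by simp
    qed
    have out1: "?D (x + - (s *\<^sub>R ?e)) = 0" if x: "x \<notin> cube (r + 2)" and s: "0 \<le> s" "s \<le> 1" for x s
    proof (rule partial_deriv_outside_cube[OF r])
      obtain j where "\<not> \<bar>x $ j\<bar> < r + 2" using x unfolding mem_cube by blast
      then have "\<not> \<bar>(x + - (s *\<^sub>R ?e)) $ j\<bar> < r + 1" using sh[OF s, of j] by simp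
      then show "x + - (s *\<^sub>R ?e) \<notin> cube (r + 1)" unfolding mem_cube by blast
    qed
    have out2: "\<phi> (x + - (s *\<^sub>R ?e)) = 0" if x: "x \<notin> cube (r + 2)" and s: "0 \<le> s" "s \<le> 1" for x s
    proof (rule r)
      obtain j where "\<not> \<bar>x $ j\<bar> < r + 2" using x unfolding mem_cube by blast
      then have "\<not> \<bar>(x + - (s *\<^sub>R ?e)) $ j\<bar> < r" using sh[OF s, of j] by simp
      then show "x + - (s *\<^sub>R ?e) \<notin> cube r" unfolding mem_cube by blast
    qed
    \<comment> \<open>For one fixed displacement this is the definition of the weak derivative of
      the translated function; the margins allow \<open>G\<close> and \<open>U\<close> to stand in
      for g and u.\<close>
    have slice: "(LINT x|lborel. G (x + s *\<^sub>R ?e) * \<phi> x) = - (LINT x|lborel. U x * ?D (x + - (s *\<^sub>R ?e)))"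
      if s: "0 \<le> s" "s \<le> 1" for s
    proof -
      have "(LINT x|lborel. G (x + s *\<^sub>R ?e) * \<phi> x) = (LINT x|lebesgue. G (x + s *\<^sub>R ?e) * \<phi> x)"
        by (rule integral_completion[symmetric]) simp
      also have "\<dots> = (LINT x|lebesgue. g (x + s *\<^sub>R ?e) * \<phi> x)"
      proof (rule integral_cong_AE)
        show "(\<lambda>x. G (x + s *\<^sub>R ?e) * \<phi> x) \<in> borel_measurable lebesgue" by (rule mL) simp
        show "(\<lambda>x. g (x + s *\<^sub>R ?e) * \<phi> x) \<in> borel_measurable lebesgue"
          by (intro borel_measurable_integrable integrable_mult_test locally_integrable_shift l \<phi>)
        show "AE x in lebesgue. G (x + s *\<^sub>R ?e) * \<phi> x = g (x + s *\<^sub>R ?e) * \<phi> x"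
          using AE_shift[OF G, of "s *\<^sub>R ?e"]
        proof eventually_elim
          case (elim x)
          then show ?case using r[of x] in2[of x s] s by (cases "x \<in> cube r") auto
        qed
      qed
      also have "\<dots> = - (LINT x|lebesgue. u (x + s *\<^sub>R ?e) * ?D x)"
        using weak_partial_shift[OF w, of "s *\<^sub>R ?e"] \<phi> by (simp add: weak_partial_def)
      also have "(LINT x|lebesgue. u (x + s *\<^sub>R ?e) * ?D x) =
         (LINT x|lebesgue. u (x + s *\<^sub>R ?e) * ?D ((x + s *\<^sub>R ?e) + - (s *\<^sub>R ?e)))" by simp
      also have "\<dots> = (LINT x|lebesgue. u x * ?D (x + - (s *\<^sub>R ?e)))"
        by (rule integral_shift[of "\<lambda>x. u x * ?D (x + - (s *\<^sub>R ?e))"])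
          (intro borel_measurable_integrable integrable_mult_test l test_function_shift \<phi>')
      also have "\<dots> = (LINT x|lebesgue. U x * ?D (x + - (s *\<^sub>R ?e)))"
      proof (rule integral_cong_AE)
        show "(\<lambda>x. U x * ?D (x + - (s *\<^sub>R ?e))) \<in> borel_measurable lebesgue" by (rule mL) simp
        show "(\<lambda>x. u x * ?D (x + - (s *\<^sub>R ?e))) \<in> borel_measurable lebesgue"
          by (intro borel_measurable_integrable integrable_mult_test l test_function_shift \<phi>')
        show "AE x in lebesgue. u x * ?D (x + - (s *\<^sub>R ?e)) = U x * ?D (x + - (s *\<^sub>R ?e))"
          using U
        proof eventually_elim
          case (elim x)
          then show ?case using out1[of x s] s by (cases "x \<in> cube (r + 2)") auto
        qed
      qed
      also have "\<dots> = (LINT x|lborel. U x * ?D (x + - (s *\<^sub>R ?e)))"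
        by (rule integral_completion) simp
      finally show ?thesis .
    qed
    have "(LINT x|lebesgue. H x * \<phi> x) = (LINT x|lborel. H x * \<phi> x)"
      by (rule integral_completion) simp
    also have "\<dots> = (LINT x|lborel. (LINT \<tau>|lborel. ?A \<tau> x * \<phi> x))"
      by (simp add: H_def)
    also have "\<dots> = (LINT \<tau>|lborel. (LINT x|lborel. ?A \<tau> x * \<phi> x))"
    proof (rule lborel_pair.Fubini_integral)
      have "integrable (lborel \<Otimes>\<^sub>M lborel) (\<lambda>p. B * (case p of (\<tau>::real, x) \<Rightarrow> ?A \<tau> x))"
        by (intro integrable_mult_right integrable_moving_average iG)
      then show "integrable (lborel \<Otimes>\<^sub>M lborel) (\<lambda>(\<tau>, x). ?A \<tau> x * \<phi> x)"
      proof (rule Bochner_Integration.integrable_bound)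
        show "(\<lambda>(\<tau>, x). ?A \<tau> x * \<phi> x) \<in> borel_measurable (lborel \<Otimes>\<^sub>M lborel)"
          by measurable
        have "norm (?A \<tau> x * \<phi> x) \<le> norm (B * (?A \<tau> x))" for \<tau> x
          using B mult_left_mono[OF B(2)[of x], of "\<bar>?A \<tau> x\<bar>"]
          by (simp add: abs_mult mult_ac)
        then show "AE p in lborel \<Otimes>\<^sub>M lborel. norm (case p of (\<tau>, x) \<Rightarrow> ?A \<tau> x * \<phi> x)
           \<le> norm (B * (case p of (\<tau>, x) \<Rightarrow> ?A \<tau> x))"
          by auto
      qed
    qed
    also have "\<dots> = (LINT \<tau>|lborel. (LINT x|lborel. - (?B \<tau> x)))"
    proof (rule Bochner_Integration.integral_cong[OF refl])
      fix \<tau> :: real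
      show "(LINT x|lborel. ?A \<tau> x * \<phi> x) =
         (LINT x|lborel. - (?B \<tau> x))"
      proof (cases "\<tau> \<in> {0..1}")
        case True
        then have "0 \<le> t * \<tau>" "t * \<tau> \<le> 1" using t by (auto simp: mult_le_one)
        then show ?thesis using slice[of "t * \<tau>"] True by simp
      qed simp
    qed
    also have "\<dots> = (LINT x|lborel. (LINT \<tau>|lborel. - (?B \<tau> x)))"
    proof (rule lborel_pair.Fubini_integral[symmetric])
      \<comment> \<open>The displacement 0 turns the moving average into the plain product of the
        indicator of [0, 1] and \<open>U\<close>.\<close>
      have "integrable (lborel \<Otimes>\<^sub>M lborel) (\<lambda>p. B' * (case p of (\<tau>::real, x) \<Rightarrow> indicator {0..1} \<tau> * U (x + (0 * \<tau>) *\<^sub>R ?e)))"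
        by (intro integrable_mult_right integrable_moving_average iU)
      then show "integrable (lborel \<Otimes>\<^sub>M lborel) (\<lambda>(\<tau>, x). - (?B \<tau> x))"
      proof (rule Bochner_Integration.integrable_bound)
        show "(\<lambda>(\<tau>, x). - (?B \<tau> x)) \<in> borel_measurable (lborel \<Otimes>\<^sub>M lborel)"
          by measurable
        have "norm (- (?B \<tau> x)) \<le> norm (B' * (indicator {0..1} \<tau> * U x))" for \<tau> x
          using B' mult_left_mono[OF B'(2)[of "x + - ((t * \<tau>) *\<^sub>R ?e)"], of "\<bar>indicator {0..1} \<tau> * U x\<bar>"]
          by (simp add: abs_mult mult_ac)
        then show "AE p in lborel \<Otimes>\<^sub>M lborel. norm (case p of (\<tau>, x) \<Rightarrow> - (?B \<tau> x))
           \<le> norm (B' * (case p of (\<tau>, x) \<Rightarrow> indicator {0..1} \<tau> * U (x + (0 * \<tau>) *\<^sub>R ?e)))"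
          by (intro AE_I2) (simp add: split_beta)
      qed
    qed
    finally have "t * (LINT x|lebesgue. H x * \<phi> x) =
        (LINT x|lborel. t * (LINT \<tau>|lborel. - (?B \<tau> x)))"
      by simp
    also have "\<dots> = (LINT x|lborel. U x * (\<phi> (x + - (t *\<^sub>R ?e)) - \<phi> x))"
    proof (rule Bochner_Integration.integral_cong[OF refl])
      fix x
      \<comment> \<open>The minus sign and the backward shift combine into the integral of the
        derivative of \<phi> along the segment with displacement -t.\<close>
      have "t * (LINT \<tau>|lborel. - (?B \<tau> x)) =
        (LINT \<tau>|lborel. U x * (indicator {0..1} \<tau> * (- t * ?D (x + (- t * \<tau>) *\<^sub>R ?e))))"
        by (subst integral_mult_right_zero[symmetric]) (simp add: mult_ac)
      also have "\<dots> = U x * (\<phi> (x + - t *\<^sub>R ?e) - \<phi> x)"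
        by (subst line_FTC[OF sm, symmetric]) (rule integral_mult_right_zero)
      finally show "t * (LINT \<tau>|lborel. - (?B \<tau> x)) =
         U x * (\<phi> (x + - (t *\<^sub>R ?e)) - \<phi> x)" by simp
    qed
    also have "\<dots> = (LINT x|lebesgue. U x * (\<phi> (x + - (t *\<^sub>R ?e)) - \<phi> x))"
      by (rule integral_completion[symmetric]) simp
    also have "\<dots> = (LINT x|lebesgue. u x * \<phi> (x + - (t *\<^sub>R ?e)) - u x * \<phi> x)"
    proof (rule integral_cong_AE)
      show "(\<lambda>x. U x * (\<phi> (x + - (t *\<^sub>R ?e)) - \<phi> x)) \<in> borel_measurable lebesgue" by (rule mL) simp
      show "(\<lambda>x. u x * \<phi> (x + - (t *\<^sub>R ?e)) - u x * \<phi> x) \<in> borel_measurable lebesgue"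
        by (intro borel_measurable_diff borel_measurable_integrable integrable_mult_test l test_function_shift \<phi>)
      show "AE x in lebesgue. U x * (\<phi> (x + - (t *\<^sub>R ?e)) - \<phi> x) = u x * \<phi> (x + - (t *\<^sub>R ?e)) - u x * \<phi> x"
        using U
      proof eventually_elim
        case (elim x)
        then show ?case using out2[of x t] out2[of x 0] t by (cases "x \<in> cube (r + 2)") (auto simp: algebra_simps)
      qed
    qed
    also have "\<dots> = (LINT x|lebesgue. u x * \<phi> (x + - (t *\<^sub>R ?e))) - (LINT x|lebesgue. u x * \<phi> x)"
      by (intro Bochner_Integration.integral_diff integrable_mult_test l test_function_shift \<phi>)
    also have "(LINT x|lebesgue. u x * \<phi> (x + - (t *\<^sub>R ?e))) = (LINT x|lebesgue. u (x + t *\<^sub>R ?e) * \<phi> x)"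
      using integral_shift[OF borel_measurable_integrable[OF integrable_mult_test[OF l(1)
        test_function_shift[OF \<phi>, of "- (t *\<^sub>R ?e)"]]], of "t *\<^sub>R ?e"] by simp
    finally have eq: "t * (LINT x|lebesgue. H x * \<phi> x) = (LINT x|lebesgue. u (x + t *\<^sub>R ?e) * \<phi> x) - (LINT x|lebesgue. u x * \<phi> x)" .
    have i1: "integrable lebesgue (\<lambda>x. u (x + t *\<^sub>R ?e) * \<phi> x)" "integrable lebesgue (\<lambda>x. u x * \<phi> x)"
      by (intro integrable_mult_test locally_integrable_shift l \<phi>)+
    have i2: "integrable lebesgue (\<lambda>x. H x * \<phi> x)"
    proof (rule Bochner_Integration.integrable_bound)
      show "integrable lebesgue (\<lambda>x. B * H x)" using iHL by simp
      show "(\<lambda>x. H x * \<phi> x) \<in> borel_measurable lebesgue" by (rule mL) simp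
      show "AE x in lebesgue. norm (H x * \<phi> x) \<le> norm (B * H x)"
        using B mult_left_mono[OF B(2), of "\<bar>H x\<bar>" for x] by (intro AE_I2) (simp add: abs_mult mult.commute)
    qed
    have "(LINT x|lebesgue. (u (x + t *\<^sub>R ?e) - u x - t * H x) * \<phi> x) =
       (LINT x|lebesgue. u (x + t *\<^sub>R ?e) * \<phi> x - u x * \<phi> x - t * (H x * \<phi> x))"
      by (simp add: algebra_simps)
    also have "\<dots> = (LINT x|lebesgue. u (x + t *\<^sub>R ?e) * \<phi> x) - (LINT x|lebesgue. u x * \<phi> x) - t * (LINT x|lebesgue. H x * \<phi> x)"
      using i1 i2 by simp
    also have "\<dots> = 0" using eq by simp
    finally show ?thesis .
  qed
  have "AE x in lebesgue. x \<in> cube r \<longrightarrow> u (x + t *\<^sub>R ?e) - u x - t * H x = 0"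
  proof (rule fundamental_lemma)
    have "integrable lebesgue (\<lambda>x. indicator (cube r) x * u (x + t *\<^sub>R ?e))"
      "integrable lebesgue (\<lambda>x. indicator (cube r) x * u x)"
      by (intro locally_integrable_cube locally_integrable_shift l)+
    moreover have "integrable lebesgue (\<lambda>x. indicator (cube r) x * (t * H x))"
      using integrable_mult_indicator[of "cube r" lebesgue "\<lambda>x. t * H x"] iHL by simp
    ultimately have "integrable lebesgue (\<lambda>x. indicator (cube r) x * u (x + t *\<^sub>R ?e) - indicator (cube r) x * u x - indicator (cube r) x * (t * H x))"
      by (intro Bochner_Integration.integrable_diff)
    then show "set_integrable lebesgue (cube r) (\<lambda>x. u (x + t *\<^sub>R ?e) - u x - t * H x)"
      by (simp add: set_integrable_def right_diff_distrib)
  qed (rule *)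
  then show ?thesis unfolding H_def by eventually_elim simp
qed

section \<open>The chain rule\<close>

text \<open>By the increment formula, the difference quotient minus g is on the cube the average
  over \<tau> in [0, 1] of G(x + t \<tau> e) - G(x). Its L1 norm is at most the average of the L1
  norms; each of these tends to 0 by continuity of translations and is at most twice the norm of
  G.\<close>

lemma difference_quotient_L1:
  fixes u g :: "real^'n::finite \<Rightarrow> real"
  assumes w: "weak_partial i u g" and t: "\<And>n. 0 < t n" "\<And>n. t n \<le> 1" "t \<longlonglongrightarrow> 0"
  shows "(\<lambda>n. LINT x|lebesgue. indicator (cube r) x * \<bar>(u (x + t n *\<^sub>R axis i 1) - u x) / t n - g x\<bar>) \<longlonglongrightarrow> 0"
proof -
  let ?e = "axis i 1 :: real^'n"
  have l: "locally_integrable u" "locally_integrable g" using w by (auto simp: weak_partial_def)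
  obtain G where iG: "integrable lborel G" and G: "AE x in lebesgue. G x = indicator (cube (r + 2)) x * g x"
    by (rule borel_representative_cube[OF l(2)])
  let ?W = "\<lambda>n \<tau> x. \<bar>G (x + (t n * \<tau>) *\<^sub>R ?e) - G x\<bar>"
  let ?Q = "\<lambda>n x. \<bar>(u (x + t n *\<^sub>R ?e) - u x) / t n - g x\<bar>"
  have [measurable]: "G \<in> borel_measurable borel" using iG by auto
  have iGL: "integrable lebesgue G" using iG by (simp add: integrable_completion)
  define N where "N n x = (LINT \<tau>|lborel. indicator {0..1} \<tau> * ?W n \<tau> x)" for n x
  have prod: "integrable (lborel \<Otimes>\<^sub>M lborel) (\<lambda>(\<tau>::real, x). indicator {0..1} \<tau> * ?W n \<tau> x)" for n
  proof -
    have "integrable (lborel \<Otimes>\<^sub>M lborel) (\<lambda>p. \<bar>(case p of (\<tau>::real, x) \<Rightarrow> indicator {0..1} \<tau> * G (x + (t n * \<tau>) *\<^sub>R ?e))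
       - (case p of (\<tau>::real, x) \<Rightarrow> indicator {0..1} \<tau> * G (x + (0 * \<tau>) *\<^sub>R ?e))\<bar>)"
      by (intro integrable_abs Bochner_Integration.integrable_diff integrable_moving_average iG)
    then show ?thesis
      by (rule back_subst[where P = "integrable _"]) (auto simp: fun_eq_iff abs_mult simp flip: right_diff_distrib)
  qed
  have iN: "integrable lborel (N n)" for n
    using lborel_pair.integrable_snd[OF prod] unfolding N_def[abs_def] .
  have iNL: "integrable lebesgue (N n)" for n
    using iN[of n] borel_measurable_integrable[OF iN[of n]] by (simp add: integrable_completion)
  have bound: "(LINT x|lebesgue. indicator (cube r) x * ?Q n x) \<le>
    (LINT \<tau>|lborel. indicator {0..1} \<tau> * (LINT x|lborel. ?W n \<tau> x))" for n
  proof -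
    have "(LINT x|lebesgue. indicator (cube r) x * ?Q n x) \<le> (LINT x|lebesgue. N n x)"
    proof (rule integral_mono_AE)
      have "locally_integrable (\<lambda>x. \<bar>1 / t n * (u (x + t n *\<^sub>R ?e) + - 1 * u x) + - 1 * g x\<bar>)"
        by (intro locally_integrable_abs locally_integrable_add locally_integrable_cmult locally_integrable_shift l)
      from locally_integrable_cube[OF this]
      show "integrable lebesgue (\<lambda>x. indicator (cube r) x * ?Q n x)"
        by simp
      have "AE x in lborel. integrable lborel (\<lambda>\<tau>. indicator {0..1} \<tau> * G (x + (t n * \<tau>) *\<^sub>R ?e))"
        using lborel_pair.AE_integrable_snd[OF integrable_moving_average[OF iG, of "t n" ?e]] by simp
      then have "AE x in lebesgue. integrable lborel (\<lambda>\<tau>. indicator {0..1} \<tau> * G (x + (t n * \<tau>) *\<^sub>R ?e))"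
        by (rule AE_completion)
      with weak_partial_increment[OF w less_imp_le[OF t(1)[of n]] t(2)[of n] iG G] G
      show "AE x in lebesgue. indicator (cube r) x * ?Q n x \<le> N n x"
      proof eventually_elim
        case (elim x)
        have "N n x \<ge> 0" unfolding N_def by (intro Bochner_Integration.integral_nonneg) auto
        show ?case
        proof (cases "x \<in> cube r")
          case True
          then have "x \<in> cube (r + 2)" using cube_mono[of r "r + 2"] by auto
          then have Gx: "G x = g x" using elim(2) by simp
          have "(u (x + t n *\<^sub>R ?e) - u x) / t n = (LINT \<tau>|lborel. indicator {0..1} \<tau> * G (x + (t n * \<tau>) *\<^sub>R ?e))"
            using elim(1) True t(1)[of n] by simp
          \<comment> \<open>The constant \<open>g x\<close> is written as an integral over [0, 1] so
            that the difference fits under one integral sign.\<close>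
          moreover have "g x = (LINT \<tau>|(lborel :: real measure). indicator {0..1} \<tau> * G x)"
            using Gx by (simp add: content_real)
          ultimately have eq: "(u (x + t n *\<^sub>R ?e) - u x) / t n - g x =
             (LINT \<tau>|lborel. indicator {0..1} \<tau> * G (x + (t n * \<tau>) *\<^sub>R ?e) - indicator {0..1} \<tau> * G x)"
            using elim(3) by (subst Bochner_Integration.integral_diff) auto
          have "?Q n x \<le> (LINT \<tau>|lborel. \<bar>indicator {0..1} \<tau> * G (x + (t n * \<tau>) *\<^sub>R ?e) - indicator {0..1} \<tau> * G x\<bar>)"
            unfolding eq by (rule integral_abs_bound)
          also have "\<dots> = N n x" unfolding N_def
            by (intro Bochner_Integration.integral_cong) (auto simp: indicator_def)
          finally show ?thesis using True by simp
        qed (use \<open>N n x \<ge> 0\<close> in simp)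
      qed
    qed (rule iNL)
    also have "\<dots> = (LINT x|lborel. N n x)"
      using borel_measurable_integrable[OF iN[of n]] by (intro integral_completion) simp
    also have "\<dots> = (LINT \<tau>|lborel. LINT x|lborel. indicator {0..1} \<tau> * ?W n \<tau> x)"
      unfolding N_def by (rule lborel_pair.Fubini_integral[OF prod])
    finally show ?thesis by simp
  qed
  have "(\<lambda>n. LINT \<tau>|lborel. indicator {0..1} \<tau> * (LINT x|lborel. ?W n \<tau> x)) \<longlonglongrightarrow> (LINT \<tau>|(lborel :: real measure). 0)"
  proof (rule integral_dominated_convergence[where w = "\<lambda>\<tau>. indicator {0..1} \<tau> * (2 * (LINT x|lborel. \<bar>G x\<bar>))"])
    show "(\<lambda>\<tau>::real. indicator {0..1} \<tau> * (LINT x|lborel. ?W n \<tau> x)) \<in> borel_measurable lborel" for n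
      by measurable
    show "AE \<tau> in lborel. (\<lambda>n. indicator {0..1} \<tau> * (LINT x|lborel. ?W n \<tau> x)) \<longlonglongrightarrow> 0"
    proof (rule AE_I2)
      fix \<tau> :: real
      have "(\<lambda>n. (t n * \<tau>) *\<^sub>R ?e) \<longlonglongrightarrow> (0 * \<tau>) *\<^sub>R ?e" by (intro tendsto_intros t)
      then have "(\<lambda>n. LINT x|lebesgue. ?W n \<tau> x) \<longlonglongrightarrow> 0"
        by (intro L1_shift_continuous iGL) simp
      moreover have "(LINT x|lebesgue. \<bar>G (x + a) - G x\<bar>) = (LINT x|lborel. \<bar>G (x + a) - G x\<bar>)" for a
        by (rule integral_completion) simp
      ultimately have "(\<lambda>n. LINT x|lborel. ?W n \<tau> x) \<longlonglongrightarrow> 0" by simp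
      from tendsto_mult[OF tendsto_const this]
      show "(\<lambda>n. indicator {0..1} \<tau> * (LINT x|lborel. ?W n \<tau> x)) \<longlonglongrightarrow> 0" by simp
    qed
    show "AE \<tau> in lborel. norm (indicator {0..1} \<tau> * (LINT x|lborel. ?W n \<tau> x))
       \<le> indicator {0..1} \<tau> * (2 * (LINT x|lborel. \<bar>G x\<bar>))" for n
    proof (rule AE_I2)
      fix \<tau> :: real
      have i: "integrable lborel (\<lambda>x. G (x + (t n * \<tau>) *\<^sub>R ?e))" by (rule integrable_lborel_shift[OF iG])
      have "(LINT x|lborel. ?W n \<tau> x) \<le> (LINT x|lborel. \<bar>G (x + (t n * \<tau>) *\<^sub>R ?e)\<bar> + \<bar>G x\<bar>)"
        using i iG by (intro integral_mono) auto
      also have "\<dots> = (LINT x|lborel. \<bar>G (x + (t n * \<tau>) *\<^sub>R ?e)\<bar>) + (LINT x|lborel. \<bar>G x\<bar>)"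
        using i iG by (intro Bochner_Integration.integral_add) auto
      also have "(LINT x|lborel. \<bar>G (x + (t n * \<tau>) *\<^sub>R ?e)\<bar>) = (LINT x|lborel. \<bar>G x\<bar>)"
        by (rule integral_lborel_shift) simp
      finally have "(LINT x|lborel. ?W n \<tau> x) \<le> 2 * (LINT x|lborel. \<bar>G x\<bar>)" by simp
      moreover have "(LINT x|lborel. ?W n \<tau> x) \<ge> 0" by simp
      ultimately show "norm (indicator {0..1} \<tau> * (LINT x|lborel. ?W n \<tau> x))
       \<le> indicator {0..1} \<tau> * (2 * (LINT x|lborel. \<bar>G x\<bar>))"
        by (auto simp: indicator_def)
    qed
  qed auto
  then have lim: "(\<lambda>n. LINT \<tau>|lborel. indicator {0..1} \<tau> * (LINT x|lborel. ?W n \<tau> x)) \<longlonglongrightarrow> 0"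
    by simp
  show ?thesis
  proof (rule tendsto_sandwich[OF _ _ tendsto_const lim])
    show "\<forall>\<^sub>F n in sequentially. 0 \<le> (LINT x|lebesgue. indicator (cube r) x * \<bar>(u (x + t n *\<^sub>R axis i 1) - u x) / t n - g x\<bar>)"
      by (intro always_eventually allI Bochner_Integration.integral_nonneg) auto
  qed (use bound in simp)
qed

text \<open>The chain rule relies on pointwise convergence of the translates, which continuity in L1
  provides along a subsequence.\<close>

lemma AE_shift_subseq:
  fixes u :: "real^'n::finite \<Rightarrow> real"
  assumes l: "locally_integrable u" and t: "\<And>n. 0 < t n" "\<And>n. t n \<le> 1" "t \<longlonglongrightarrow> 0"
  obtains q :: "nat \<Rightarrow> nat" where "strict_mono q"
    "AE x in lebesgue. x \<in> cube r \<longrightarrow> (\<lambda>n. u (x + t (q n) *\<^sub>R axis i 1)) \<longlonglongrightarrow> u x"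
proof -
  let ?e = "axis i 1 :: real^'n"
  define f where "f x = indicator (cube (r + 2)) x * u x" for x
  have f: "integrable lebesgue f" unfolding f_def[abs_def] by (rule locally_integrable_cube[OF l])
  have "(\<lambda>n. t n *\<^sub>R ?e) \<longlonglongrightarrow> 0 *\<^sub>R ?e" by (intro tendsto_intros t)
  then have "(\<lambda>n. LINT x|lebesgue. norm (f (x + t n *\<^sub>R ?e) - f x)) \<longlonglongrightarrow> 0"
    using L1_shift_continuous[OF f] by simp
  then obtain q where q: "strict_mono q" "AE x in lebesgue. (\<lambda>n. f (x + t (q n) *\<^sub>R ?e) - f x) \<longlonglongrightarrow> 0"
    using tendsto_L1_AE_subseq[of lebesgue "\<lambda>n x. f (x + t n *\<^sub>R ?e) - f x"] f integrable_shift[OF f] by auto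
  have "x + t n *\<^sub>R ?e \<in> cube (r + 2)" if x: "x \<in> cube r" for x n
    unfolding mem_cube
  proof
    fix j
    have "\<bar>x $ j\<bar> < r" using x unfolding mem_cube by blast
    moreover have "\<bar>(t n *\<^sub>R ?e) $ j\<bar> \<le> 1" using t(1,2)[of n] by (simp add: axis_def)
    ultimately show "\<bar>(x + t n *\<^sub>R ?e) $ j\<bar> < r + 2" by simp
  qed
  moreover have "x \<in> cube (r + 2)" if "x \<in> cube r" for x :: "real^'n"
    using that cube_mono[of r "r + 2"] by auto
  ultimately have eq: "f (x + t n *\<^sub>R ?e) - f x = u (x + t n *\<^sub>R ?e) - u x" if "x \<in> cube r" for x n
    using that by (simp add: f_def)
  have "AE x in lebesgue. x \<in> cube r \<longrightarrow> (\<lambda>n. u (x + t (q n) *\<^sub>R ?e)) \<longlonglongrightarrow> u x"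
    using q(2)
  proof eventually_elim
    case (elim x)
    show ?case
    proof
      assume "x \<in> cube r"
      then have "(\<lambda>n. u (x + t (q n) *\<^sub>R ?e) - u x) \<longlonglongrightarrow> 0" using elim eq by simp
      then show "(\<lambda>n. u (x + t (q n) *\<^sub>R ?e)) \<longlonglongrightarrow> u x" by (simp add: LIM_zero_iff)
    qed
  qed
  with q(1) show ?thesis by (rule that)
qed

lemma Lipschitz_from_derivative:
  fixes F F' :: "real \<Rightarrow> real"
  assumes F: "\<And>s. (F has_field_derivative F' s) (at s)" and L: "\<And>s. \<bar>F' s\<bar> \<le> L"
  shows "\<bar>F a - F b\<bar> \<le> L * \<bar>a - b\<bar>"
  using field_differentiable_bound[of UNIV F F' L a b] assms by auto

text \<open>No mollification: both sides are limits of the integral of \<open>\<phi>\<close> against the difference quotients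
  of \<open>F(u)\<close>, which are bounded multiples of the \<open>L\<^sup>1\<close>-convergent difference quotients of \<open>u\<close>.\<close>

lemma weak_partial_chain:
  fixes u g :: "real^'n::finite \<Rightarrow> real"
  assumes w: "weak_partial i u g"
    and F: "\<And>s. (F has_field_derivative F' s) (at s)"
    and L: "\<And>s. \<bar>F' s\<bar> \<le> L" and mF': "F' \<in> borel_measurable borel"
  shows "weak_partial i (\<lambda>x. F (u x)) (\<lambda>x. F' (u x) * g x)"
  unfolding weak_partial_def
proof (intro conjI allI impI)
  let ?e = "axis i 1 :: real^'n"
  have l: "locally_integrable u" "locally_integrable g" using w by (auto simp: weak_partial_def)
  have mu: "u \<in> borel_measurable lebesgue" "g \<in> borel_measurable lebesgue" using l locally_integrable_measurable by auto
  have mF: "F \<in> borel_measurable borel"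
    using F by (intro borel_measurable_continuous_onI DERIV_continuous_on) (auto intro: has_field_derivative_at_within)
  have L0: "L \<ge> 0" using L[of 0] by linarith
  note Lip = Lipschitz_from_derivative[OF F L]
  show lF: "locally_integrable (\<lambda>x. F (u x))"
  proof (rule locally_integrable_bound)
    show "locally_integrable (\<lambda>x. \<bar>F 0\<bar> + L * \<bar>u x\<bar>)"
      using locally_integrable_add[OF locally_integrable_continuous[OF continuous_on_const]
       locally_integrable_cmult[OF locally_integrable_abs[OF l(1)]]] by blast
    show "(\<lambda>x. F (u x)) \<in> borel_measurable lebesgue" by (rule measurable_compose[OF mu(1) mF])
    have "\<bar>F s\<bar> \<le> \<bar>\<bar>F 0\<bar> + L * \<bar>s\<bar>\<bar>" for s using Lip[of s 0] by auto
    then show "AE x in lebesgue. \<bar>F (u x)\<bar> \<le> \<bar>\<bar>F 0\<bar> + L * \<bar>u x\<bar>\<bar>" by simp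
  qed
  show lg: "locally_integrable (\<lambda>x. F' (u x) * g x)"
  proof (rule locally_integrable_bound[OF locally_integrable_cmult[OF l(2), of L]])
    show "(\<lambda>x. F' (u x) * g x) \<in> borel_measurable lebesgue"
      by (intro borel_measurable_times measurable_compose[OF mu(1) mF'] mu)
    show "AE x in lebesgue. \<bar>F' (u x) * g x\<bar> \<le> \<bar>L * g x\<bar>"
      using L L0 by (auto simp: abs_mult intro!: mult_right_mono)
  qed
  fix \<phi> :: "real^'n \<Rightarrow> real" assume \<phi>: "test_function \<phi>"
  obtain r where r: "r > 0" "\<And>x. x \<notin> cube r \<Longrightarrow> \<phi> x = 0" using test_function_support[OF \<phi>] by blast
  obtain B where B: "B > 0" "\<And>x. \<bar>\<phi> x\<bar> \<le> B" using test_function_bounded[OF \<phi>] by blast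
  note \<phi>' = test_function_partial_deriv[OF \<phi>]
  obtain B' where B': "B' > 0" "\<And>x. \<bar>partial_deriv i \<phi> x\<bar> \<le> B'" using test_function_bounded[OF \<phi>'] by blast
  define t0 where "t0 n = 1 / real (Suc n)" for n
  have t0: "0 < t0 n" "t0 n \<le> 1" for n by (auto simp: t0_def)
  have t0l: "t0 \<longlonglongrightarrow> 0" unfolding t0_def[abs_def] by (rule LIMSEQ_Suc[OF lim_1_over_n])
  obtain q where q: "strict_mono q"
    "AE x in lebesgue. x \<in> cube r \<longrightarrow> (\<lambda>n. u (x + t0 (q n) *\<^sub>R ?e)) \<longlonglongrightarrow> u x"
    by (rule AE_shift_subseq[OF l(1) t0 t0l])
  define t where "t n = t0 (q n)" for n
  have t: "0 < t n" "t n \<le> 1" for n using t0 by (auto simp: t_def)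
  have tl: "t \<longlonglongrightarrow> 0" unfolding t_def[abs_def] using LIMSEQ_subseq_LIMSEQ[OF t0l q(1)] by (simp add: o_def)
  have ae: "AE x in lebesgue. x \<in> cube r \<longrightarrow> (\<lambda>n. u (x + t n *\<^sub>R ?e)) \<longlonglongrightarrow> u x" using q(2) by (simp add: t_def)
  define D where "D n x = (u (x + t n *\<^sub>R ?e) - u x) / t n" for n x
  \<comment> \<open>The difference quotient of F between u x and the translated value, completed by
    F' (u x) where the increment of u vanishes. Then the difference quotient of F(u) is exactly m *
    D, |m| is at most L, and m tends to F' (u x) by differentiability of F at that single
    point.\<close>
  define m where "m n x = (if u (x + t n *\<^sub>R ?e) = u x then F' (u x) else (F (u (x + t n *\<^sub>R ?e)) - F (u x)) / (u (x + t n *\<^sub>R ?e) - u x))" for n x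
  let ?R = "\<lambda>n x. \<bar>m n x - F' (u x)\<bar> * (\<bar>g x\<bar> * \<bar>\<phi> x\<bar>)"
  have mD: "(F (u (x + t n *\<^sub>R ?e)) - F (u x)) / t n = m n x * D n x" for n x
    by (simp add: m_def D_def)
  have mL: "\<bar>m n x\<bar> \<le> L" for n x
    using L[of "u x"] Lip[of "u (x + t n *\<^sub>R ?e)" "u x"] by (auto simp: m_def divide_le_eq)
  have ml: "(\<lambda>n. m n x) \<longlonglongrightarrow> F' (u x)" if "(\<lambda>n. u (x + t n *\<^sub>R ?e)) \<longlonglongrightarrow> u x" for x
  proof -
    have "isCont (\<lambda>s. if s = u x then F' (u x) else (F s - F (u x)) / (s - u x)) (u x)"
    proof -
      have "((\<lambda>s. (F s - F (u x)) / (s - u x)) \<longlongrightarrow> F' (u x)) (at (u x))"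
        using F[of "u x"] by (simp add: has_field_derivative_iff)
      then have "((\<lambda>s. if s = u x then F' (u x) else (F s - F (u x)) / (s - u x)) \<longlongrightarrow> F' (u x)) (at (u x))"
        by (rule Lim_transform_eventually) (auto simp: eventually_at_filter)
      then show ?thesis by (simp add: isCont_def)
    qed
    from isCont_tendsto_compose[OF this that] show ?thesis by (simp add: m_def)
  qed
  have mmeas: "m n \<in> borel_measurable lebesgue" for n
  proof -
    note 1 = mu(1) measurable_shift[OF mu(1), of "t n *\<^sub>R ?e"]
    have [measurable]: "u \<in> borel_measurable lebesgue" "(\<lambda>x. u (x + t n *\<^sub>R ?e)) \<in> borel_measurable lebesgue"
       "(\<lambda>x. F (u (x + t n *\<^sub>R ?e))) \<in> borel_measurable lebesgue" "(\<lambda>x. F (u x)) \<in> borel_measurable lebesgue"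
       "(\<lambda>x. F' (u x)) \<in> borel_measurable lebesgue"
      using 1 measurable_compose[OF 1(1) mF] measurable_compose[OF 1(2) mF] measurable_compose[OF 1(1) mF'] by auto
    show ?thesis unfolding m_def[abs_def] by measurable
  qed
  have lD: "locally_integrable (D n)" for n
  proof -
    have "locally_integrable (\<lambda>x. 1 / t n * (u (x + t n *\<^sub>R ?e) + - 1 * u x))"
      by (intro locally_integrable_add locally_integrable_cmult locally_integrable_shift l)
    then show ?thesis by (simp add: D_def[abs_def])
  qed
  have lmD: "locally_integrable (\<lambda>x. m n x * D n x)" for n
    using mmeas[of n] locally_integrable_measurable[OF lD[of n]] mL L0
    by (intro locally_integrable_bound[OF locally_integrable_cmult[OF lD[of n], of L]])
      (auto simp: abs_mult intro!: mult_right_mono borel_measurable_times)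

  define A where "A n = (LINT x|lebesgue. m n x * D n x * \<phi> x)" for n
  have A1: "A \<longlonglongrightarrow> (LINT x|lebesgue. F' (u x) * g x * \<phi> x)"
  proof -
    \<comment> \<open>Two error terms: m \<phi> (D - g), small because D tends to g in L1 on the
      support of \<phi>, and (m - F'(u)) g \<phi>, small by dominated convergence.\<close>
    have E: "(\<lambda>n. L * B * (LINT x|lebesgue. indicator (cube r) x * \<bar>D n x - g x\<bar>) +
        (LINT x|lebesgue. ?R n x)) \<longlonglongrightarrow> L * B * 0 + (LINT x|(lebesgue::(real^'n) measure). 0)"
    proof (intro tendsto_intros)
      show "(\<lambda>n. LINT x|lebesgue. indicator (cube r) x * \<bar>D n x - g x\<bar>) \<longlonglongrightarrow> 0"
        unfolding D_def by (rule difference_quotient_L1[OF w t tl])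
      have ig: "integrable lebesgue (\<lambda>x. \<bar>g x\<bar> * \<bar>\<phi> x\<bar>)"
        using integrable_abs[OF integrable_mult_test[OF l(2) \<phi>]] by (simp add: abs_mult)
      show "(\<lambda>n. LINT x|lebesgue. ?R n x) \<longlonglongrightarrow> (LINT x|(lebesgue::(real^'n) measure). 0)"
      proof (rule integral_dominated_convergence[where w = "\<lambda>x. 2 * L * (\<bar>g x\<bar> * \<bar>\<phi> x\<bar>)"])
        show "integrable lebesgue (\<lambda>x. 2 * L * (\<bar>g x\<bar> * \<bar>\<phi> x\<bar>))" using ig by simp
        show "(\<lambda>x. ?R n x) \<in> borel_measurable lebesgue" for n
          using ig mmeas[of n] measurable_compose[OF mu(1) mF']
          by (intro borel_measurable_times borel_measurable_abs borel_measurable_diff borel_measurable_integrable[OF ig]) auto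
        show "AE x in lebesgue. (\<lambda>n. ?R n x) \<longlonglongrightarrow> 0"
          using ae
        proof eventually_elim
          case (elim x)
          show ?case
          proof (cases "x \<in> cube r")
            case True
            then have "(\<lambda>n. ?R n x) \<longlonglongrightarrow> \<bar>F' (u x) - F' (u x)\<bar> * (\<bar>g x\<bar> * \<bar>\<phi> x\<bar>)"
              using elim by (intro tendsto_intros ml) auto
            then show ?thesis by simp
          qed (simp add: r)
        qed
        show "AE x in lebesgue. norm (?R n x) \<le> 2 * L * (\<bar>g x\<bar> * \<bar>\<phi> x\<bar>)" for n
        proof (rule AE_I2)
          fix x
          have "\<bar>m n x - F' (u x)\<bar> \<le> 2 * L" using mL[of n x] L[of "u x"] by linarith
          then show "norm (?R n x) \<le> 2 * L * (\<bar>g x\<bar> * \<bar>\<phi> x\<bar>)"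
            by (auto simp: abs_mult intro: mult_right_mono)
        qed
      qed auto
    qed
    have "\<bar>A n - (LINT x|lebesgue. F' (u x) * g x * \<phi> x)\<bar> \<le> L * B * (LINT x|lebesgue. indicator (cube r) x * \<bar>D n x - g x\<bar>) +
        (LINT x|lebesgue. ?R n x)" for n
    proof -
      have i1: "integrable lebesgue (\<lambda>x. m n x * D n x * \<phi> x)" "integrable lebesgue (\<lambda>x. F' (u x) * g x * \<phi> x)"
        by (intro integrable_mult_test lmD lg \<phi>)+
      have "locally_integrable (\<lambda>x. \<bar>D n x + - 1 * g x\<bar>)"
        by (intro locally_integrable_abs locally_integrable_add locally_integrable_cmult lD l)
      then have i2: "integrable lebesgue (\<lambda>x. indicator (cube r) x * \<bar>D n x - g x\<bar>)"
        using locally_integrable_cube by fastforce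
      have i3: "integrable lebesgue (\<lambda>x. ?R n x)"
      proof (rule Bochner_Integration.integrable_bound)
        show "integrable lebesgue (\<lambda>x. 2 * L * \<bar>g x * \<phi> x\<bar>)"
          by (intro integrable_mult_right integrable_abs integrable_mult_test l \<phi>)
        show "(\<lambda>x. ?R n x) \<in> borel_measurable lebesgue"
          by (intro borel_measurable_times borel_measurable_abs borel_measurable_diff mmeas measurable_compose[OF mu(1) mF'] mu measurable_test \<phi>)
        show "AE x in lebesgue. norm (?R n x) \<le> norm (2 * L * \<bar>g x * \<phi> x\<bar>)"
        proof (rule AE_I2)
          fix x
          have "\<bar>m n x - F' (u x)\<bar> \<le> 2 * L" using mL[of n x] L[of "u x"] by linarith
          then have "?R n x \<le> 2 * L * (\<bar>g x\<bar> * \<bar>\<phi> x\<bar>)"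
            by (rule mult_right_mono) auto
          then show "norm (?R n x) \<le> norm (2 * L * \<bar>g x * \<phi> x\<bar>)"
            using L0 by (simp add: abs_mult)
        qed
      qed
      have "\<bar>A n - (LINT x|lebesgue. F' (u x) * g x * \<phi> x)\<bar> = \<bar>LINT x|lebesgue. m n x * D n x * \<phi> x - F' (u x) * g x * \<phi> x\<bar>"
        unfolding A_def by (subst Bochner_Integration.integral_diff[OF i1]) simp
      also have "\<dots> \<le> (LINT x|lebesgue. \<bar>m n x * D n x * \<phi> x - F' (u x) * g x * \<phi> x\<bar>)" by (rule integral_abs_bound)
      also have "\<dots> \<le> (LINT x|lebesgue. L * B * (indicator (cube r) x * \<bar>D n x - g x\<bar>) + ?R n x)"
      proof (rule integral_mono)
        fix x
        have "\<bar>m n x\<bar> * \<bar>\<phi> x\<bar> * \<bar>D n x - g x\<bar> \<le> L * B * (indicator (cube r) x * \<bar>D n x - g x\<bar>)"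
        proof (cases "x \<in> cube r")
          case True
          then show ?thesis using mult_mono[OF mL[of n x] B(2)[of x] L0] by (simp add: mult_right_mono)
        qed (simp add: r)
        moreover have "\<bar>m n x * D n x * \<phi> x - F' (u x) * g x * \<phi> x\<bar> \<le> \<bar>m n x\<bar> * \<bar>\<phi> x\<bar> * \<bar>D n x - g x\<bar> + ?R n x"
        proof -
          have "m n x * D n x * \<phi> x - F' (u x) * g x * \<phi> x = m n x * \<phi> x * (D n x - g x) + (m n x - F' (u x)) * (g x * \<phi> x)"
            by (simp add: algebra_simps)
          then show ?thesis by (metis abs_mult abs_triangle_ineq)
        qed
        ultimately show "\<bar>m n x * D n x * \<phi> x - F' (u x) * g x * \<phi> x\<bar> \<le> L * B * (indicator (cube r) x * \<bar>D n x - g x\<bar>) + ?R n x"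
          by linarith
      qed (use i1 i2 i3 in \<open>auto intro!: Bochner_Integration.integrable_add Bochner_Integration.integrable_diff integrable_abs\<close>)
      also have "\<dots> = L * B * (LINT x|lebesgue. indicator (cube r) x * \<bar>D n x - g x\<bar>) +
        (LINT x|lebesgue. ?R n x)"
        using i2 i3 by (subst Bochner_Integration.integral_add) auto
      finally show ?thesis .
    qed
    then have "(\<lambda>n. A n - (LINT x|lebesgue. F' (u x) * g x * \<phi> x)) \<longlonglongrightarrow> 0"
      using E by (intro Lim_null_comparison[OF _ E[simplified]] always_eventually) simp
    then show ?thesis by (simp add: LIM_zero_iff)
  qed

  \<comment> \<open>Discrete integration by parts: the translation is moved to \<phi>, whose
    backward differences divided by t tend to minus its classical derivative.\<close>
  have A2: "A \<longlonglongrightarrow> (LINT x|lebesgue. F (u x) * - partial_deriv i \<phi> x)"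
  proof -
    let ?q = "\<lambda>n x. (\<phi> (x + - (t n *\<^sub>R ?e)) - \<phi> x) / t n"
    have Aeq: "A n = (LINT x|lebesgue. F (u x) * (?q n x))" for n
    proof -
      have i1: "integrable lebesgue (\<lambda>x. F (u x) * \<phi> (x + - (t n *\<^sub>R ?e)))"
        by (intro integrable_mult_test lF test_function_shift \<phi>)
      have i2: "integrable lebesgue (\<lambda>x. F (u (x + t n *\<^sub>R ?e)) * \<phi> x)"
        by (intro integrable_mult_test locally_integrable_shift[of "\<lambda>x. F (u x)"] lF \<phi>)
      have i3: "integrable lebesgue (\<lambda>x. F (u x) * \<phi> x)"
        by (intro integrable_mult_test lF \<phi>)
      have "A n = (LINT x|lebesgue. (F (u (x + t n *\<^sub>R ?e)) * \<phi> x - F (u x) * \<phi> x) / t n)"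
        unfolding A_def by (intro Bochner_Integration.integral_cong refl, subst mD[symmetric]) (simp add: diff_divide_distrib algebra_simps)
      also have "\<dots> = ((LINT x|lebesgue. F (u (x + t n *\<^sub>R ?e)) * \<phi> x) - (LINT x|lebesgue. F (u x) * \<phi> x)) / t n"
        using i2 i3 by simp
      also have "(LINT x|lebesgue. F (u (x + t n *\<^sub>R ?e)) * \<phi> x) = (LINT x|lebesgue. F (u x) * \<phi> (x + - (t n *\<^sub>R ?e)))"
        using integral_shift[OF borel_measurable_integrable[OF i1], of "t n *\<^sub>R ?e"] by simp
      also have "((LINT x|lebesgue. F (u x) * \<phi> (x + - (t n *\<^sub>R ?e))) - (LINT x|lebesgue. F (u x) * \<phi> x)) / t n
         = (LINT x|lebesgue. (F (u x) * \<phi> (x + - (t n *\<^sub>R ?e)) - F (u x) * \<phi> x) / t n)"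
        using i1 i3 by simp
      also have "\<dots> = (LINT x|lebesgue. F (u x) * (?q n x))"
        by (intro Bochner_Integration.integral_cong refl) (simp add: diff_divide_distrib algebra_simps)
      finally show ?thesis .
    qed
    have "(\<lambda>n. LINT x|lebesgue. F (u x) * (?q n x)) \<longlonglongrightarrow> (LINT x|lebesgue. F (u x) * - partial_deriv i \<phi> x)"
    proof (rule integral_dominated_convergence[where w = "\<lambda>x. B' * (indicator (cube (r + 2)) x * \<bar>F (u x)\<bar>)"])
      show "integrable lebesgue (\<lambda>x. B' * (indicator (cube (r + 2)) x * \<bar>F (u x)\<bar>))"
        by (intro integrable_mult_right locally_integrable_cube locally_integrable_abs lF)
      show "(\<lambda>x. F (u x) * - partial_deriv i \<phi> x) \<in> borel_measurable lebesgue"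
        using borel_measurable_integrable[OF integrable_mult_test[OF lF \<phi>']] by simp
      show "(\<lambda>x. F (u x) * (?q n x)) \<in> borel_measurable lebesgue" for n
        using measurable_test[OF \<phi>] measurable_test[OF test_function_shift[OF \<phi>, of "- (t n *\<^sub>R ?e)"]] measurable_compose[OF mu(1) mF]
        by (intro borel_measurable_times borel_measurable_divide borel_measurable_diff) auto
      show "AE x in lebesgue. (\<lambda>n. F (u x) * (?q n x)) \<longlonglongrightarrow> F (u x) * - partial_deriv i \<phi> x"
      proof (intro AE_I2 tendsto_mult tendsto_const)
        fix x
        have "((\<lambda>\<tau>. \<phi> (x + (- 1 * \<tau>) *\<^sub>R ?e)) has_field_derivative - 1 * partial_deriv i \<phi> (x + (- 1 * 0) *\<^sub>R ?e)) (at 0)"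
          by (rule line_derivative[OF test_function_smooth[OF \<phi>]])
        then have "((\<lambda>h. (\<phi> (x + - (h *\<^sub>R ?e)) - \<phi> x) / h) \<longlongrightarrow> - partial_deriv i \<phi> x) (at 0)"
          by (simp add: DERIV_def)
        moreover have "filterlim t (at 0) sequentially"
          using tl t(1) by (auto simp: filterlim_at intro!: always_eventually) (metis less_irrefl)
        ultimately show "(\<lambda>n. ?q n x) \<longlonglongrightarrow> - partial_deriv i \<phi> x"
          by (rule filterlim_compose)
      qed
      show "AE x in lebesgue. norm (F (u x) * (?q n x)) \<le> B' * (indicator (cube (r + 2)) x * \<bar>F (u x)\<bar>)" for n
      proof (rule AE_I2)
        fix x
        have "\<bar>?q n x\<bar> \<le> B' * indicator (cube (r + 2)) x"
        proof (cases "x \<in> cube (r + 2)")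
          case True
          have "\<bar>\<phi> (x + (t n * -1) *\<^sub>R ?e) - \<phi> (x + (t n * 0) *\<^sub>R ?e)\<bar> \<le> (t n * B') * \<bar>-1 - 0\<bar>"
          proof (rule Lipschitz_from_derivative[OF line_derivative[OF test_function_smooth[OF \<phi>]]])
            show "\<bar>t n * partial_deriv i \<phi> (x + (t n * s) *\<^sub>R ?e)\<bar> \<le> t n * B'" for s
              using B'(2) t(1)[of n] by (simp add: abs_mult)
          qed
          then show ?thesis using True t(1)[of n] by (simp add: divide_le_eq mult.commute)
        next
          case False
          then obtain j where j: "\<not> \<bar>x $ j\<bar> < r + 2" unfolding mem_cube by blast
          moreover have "\<bar>(t n *\<^sub>R ?e) $ j\<bar> \<le> 1" using t[of n] by (simp add: axis_def)
          ultimately have "\<not> \<bar>(x + - (t n *\<^sub>R ?e)) $ j\<bar> < r" by simp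
          then have "x + - (t n *\<^sub>R ?e) \<notin> cube r" unfolding mem_cube by blast
          moreover have "x \<notin> cube r" using False cube_mono[of r "r + 2"] by auto
          ultimately show ?thesis using False by (simp add: r(2) del: add_uminus_conv_diff)
        qed
        from mult_left_mono[OF this, of "\<bar>F (u x)\<bar>"]
        show "norm (F (u x) * (?q n x)) \<le> B' * (indicator (cube (r + 2)) x * \<bar>F (u x)\<bar>)"
          by (simp add: abs_mult mult_ac)
      qed
    qed
    then show ?thesis by (subst ext[of A, OF Aeq])
  qed
  have "(LINT x|lebesgue. F (u x) * - partial_deriv i \<phi> x) = (LINT x|lebesgue. F' (u x) * g x * \<phi> x)"
    by (rule LIMSEQ_unique[OF A2 A1])
  then show "(LINT x|lebesgue. F (u x) * partial_deriv i \<phi> x) = - (LINT x|lebesgue. F' (u x) * g x * \<phi> x)"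
    by simp
qed

section \<open>The space D1p\<close>

text \<open>The increment formula makes every short axis vector an almost-everywhere period. Periods
  are closed under addition and negation, so every vector is one. Fubini then exchanges the
  quantifiers: some single x satisfies U(x + h) = U(x) for almost every h.\<close>

lemma zero_weak_gradient_const:
  fixes u :: "real^'n::finite \<Rightarrow> real"
  assumes w: "\<And>i. weak_partial i u (\<lambda>_. 0)"
  obtains c where "AE x in lebesgue. u x = c"
proof -
  define S where "S = {h. AE x in lebesgue. u (x + h) = u x}"
  have add: "h + k \<in> S" if "h \<in> S" "k \<in> S" for h k
  proof -
    have "AE x in lebesgue. u (x + h) = u x" "AE x in lebesgue. u ((x + h) + k) = u (x + h)"
      using that AE_shift[of "\<lambda>x. u (x + k) = u x" h] by (auto simp: S_def)
    then have "AE x in lebesgue. u (x + (h + k)) = u x"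
      by eventually_elim (simp add: add.assoc)
    then show ?thesis by (simp add: S_def)
  qed
  have minus: "- h \<in> S" if "h \<in> S" for h
    using AE_shift[of "\<lambda>x. u (x + h) = u x" "- h"] that by (auto simp: S_def elim!: eventually_mono)
  have zero: "0 \<in> S" by (simp add: S_def)
  have small: "t *\<^sub>R axis i 1 \<in> S" if "0 \<le> t" "t \<le> 1" for t i
  proof -
    have "AE x in lebesgue. u (x + t *\<^sub>R axis i 1) = u x"
    proof (rule AE_cubes)
      fix n :: nat
      have "AE x in lebesgue. x \<in> cube (real n) \<longrightarrow> u (x + t *\<^sub>R axis i 1) - u x =
         t * (LINT \<tau>|(lborel :: real measure). indicator {0..1} \<tau> * 0)"
        by (rule weak_partial_increment[OF w that, where G = "\<lambda>_. 0"]) auto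
      then show "AE x in lebesgue. x \<in> cube (real n) \<longrightarrow> u (x + t *\<^sub>R axis i 1) = u x" by simp
    qed
    then show ?thesis by (simp add: S_def)
  qed
  have pos: "t *\<^sub>R axis i 1 \<in> S" if "0 \<le> t" for t i
  proof -
    \<comment> \<open>The increment formula covers displacements up to 1 only, so a longer one is
      cut into m equal pieces.\<close>
    obtain m :: nat where m: "t \<le> real m" "m > 0"
      using real_arch_simple[of "max 1 t"] by (metis gr0I max.bounded_iff not_one_le_zero of_nat_0)
    define v :: "real^'n" where "v = (t / real m) *\<^sub>R axis i 1"
    have "v \<in> S" unfolding v_def using m that by (intro small) auto
    have "real k *\<^sub>R v \<in> S" for k :: nat
    proof (induction k)
      case (Suc k)
      from add[OF \<open>v \<in> S\<close> Suc] show ?case by (simp add: scaleR_add_left)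
    qed (simp add: zero)
    from this[of m] m(2) show ?thesis by (simp add: v_def)
  qed
  have all: "t *\<^sub>R axis i 1 \<in> S" for t i
    using pos[of t i] minus[OF pos[of "- t" i]] by (cases "t \<ge> 0") auto
  have "(\<Sum>i\<in>I. h $ i *\<^sub>R axis i 1) \<in> S" for h and I :: "'n set"
    by (induction I rule: infinite_finite_induct) (auto intro: zero add all)
  note sums = this
  have S: "h \<in> S" for h
  proof -
    have "(\<Sum>i\<in>UNIV. h $ i *\<^sub>R axis i 1) = h"
      by (simp add: vec_eq_iff axis_def if_distrib sum.delta cong: if_cong)
    then show ?thesis using sums[of h UNIV] by simp
  qed
  have lu: "u \<in> borel_measurable lebesgue"
    using w locally_integrable_measurable by (auto simp: weak_partial_def)
  \<comment> \<open>The exchange of null sets requires joint measurability in x and h, hence a Borel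
    representative.\<close>
  obtain U where [measurable]: "U \<in> borel_measurable borel" and U: "AE x in lebesgue. u x = U x"
    by (rule lebesgue_borel_representative[OF lu])
  have "AE x in lborel. U (x + h) = U x" for h
  proof -
    have "AE x in lebesgue. u (x + h) = u x" using S[of h] by (simp add: S_def)
    with U AE_shift[OF U, of h] have "AE x in lebesgue. U (x + h) = U x" by eventually_elim simp
    then show ?thesis by (simp add: AE_completion_iff)
  qed
  then have "AE h in (lborel::(real^'n) measure). AE x in lborel. U (x + h) = U x" by simp
  then have "AE x in lborel. AE h in lborel. U (x + h) = U x"
  proof (subst (asm) lborel_pair.AE_commute)
    have "Measurable.pred (lborel \<Otimes>\<^sub>M lborel) (\<lambda>p. U (snd p + fst p) = U (snd p))" by measurable
    then show "{p \<in> space (lborel \<Otimes>\<^sub>M lborel). U (snd p + fst p) = U (snd p)} \<in> sets (lborel \<Otimes>\<^sub>M lborel)"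
      by (simp only: pred_def)
  qed
  moreover have "\<not> (AE x in lborel :: (real^'n) measure. False)"
  proof
    assume "AE x in lborel :: (real^'n) measure. False"
    then have "emeasure lborel (UNIV :: (real^'n) set) = 0"
      using AE_iff_measurable[of UNIV "lborel :: (real^'n) measure" "\<lambda>_. False"] by simp
    then show False by simp
  qed
  ultimately obtain x where "AE h in lborel. U (x + h) = U x"
    by (metis (mono_tags, lifting) eventually_mono)
  then have "AE h in lebesgue. U (x + h) = U x" by (rule AE_completion)
  from AE_shift[OF this, of "- x"] have "AE h in lebesgue. U h = U x" by simp
  with U have "AE h in lebesgue. u h = U x" by eventually_elim simp
  then show ?thesis by (rule that)
qed

section \<open>Lebesgue spaces and the p-th power of the gradient norm\<close>

lemma Lp_measurable: "f \<in> Lp q \<Longrightarrow> f \<in> borel_measurable lebesgue"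
  by (simp add: Lp_def)

lemma Lp_bound:
  assumes "g \<in> Lp q" "f \<in> borel_measurable lebesgue" "AE x in lebesgue. \<bar>f x\<bar> \<le> \<bar>g x\<bar>" "q \<ge> 0"
  shows "f \<in> Lp q"
proof -
  have "integrable lebesgue (\<lambda>x. \<bar>f x\<bar> powr q)"
  proof (rule Bochner_Integration.integrable_bound)
    show "integrable lebesgue (\<lambda>x. \<bar>g x\<bar> powr q)" using assms by (simp add: Lp_def)
    show "(\<lambda>x. \<bar>f x\<bar> powr q) \<in> borel_measurable lebesgue" using assms(2) by measurable
    show "AE x in lebesgue. norm (\<bar>f x\<bar> powr q) \<le> norm (\<bar>g x\<bar> powr q)"
      using assms(3) by eventually_elim (simp add: powr_mono2 assms(4))
  qed
  then show ?thesis using assms by (simp add: Lp_def)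
qed

lemma powr_add_le:
  fixes a b q :: real assumes "0 \<le> a" "0 \<le> b" "0 \<le> q"
  shows "(a + b) powr q \<le> 2 powr q * (a powr q + b powr q)"
proof -
  have "(a + b) powr q \<le> (2 * max a b) powr q" using assms by (intro powr_mono2) auto
  also have "\<dots> = 2 powr q * max a b powr q" by (rule powr_mult)
  also have "max a b powr q \<le> a powr q + b powr q" by (auto simp: max_def)
  finally show ?thesis by simp
qed

lemma Lp_add:
  assumes "f \<in> Lp q" "g \<in> Lp q" "q \<ge> 0" shows "(\<lambda>x. f x + g x) \<in> Lp q"
proof -
  have [measurable]: "f \<in> borel_measurable lebesgue" "g \<in> borel_measurable lebesgue" using assms by (auto simp: Lp_def)
  have "integrable lebesgue (\<lambda>x. \<bar>f x + g x\<bar> powr q)"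
  proof (rule Bochner_Integration.integrable_bound)
    show "integrable lebesgue (\<lambda>x. 2 powr q * (\<bar>f x\<bar> powr q + \<bar>g x\<bar> powr q))" using assms by (simp add: Lp_def)
    have "\<bar>f x + g x\<bar> powr q \<le> 2 powr q * (\<bar>f x\<bar> powr q + \<bar>g x\<bar> powr q)" for x
      using powr_mono2[OF assms(3) abs_ge_zero abs_triangle_ineq[of "f x" "g x"]] powr_add_le[OF abs_ge_zero abs_ge_zero assms(3), of "f x" "g x"]
      by linarith
    then show "AE x in lebesgue. norm (\<bar>f x + g x\<bar> powr q) \<le> norm (2 powr q * (\<bar>f x\<bar> powr q + \<bar>g x\<bar> powr q))"
      by (intro AE_I2) (simp add: abs_mult)
  qed measurable
  then show ?thesis by (simp add: Lp_def)
qed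

lemma Lp_cmult: "f \<in> Lp q \<Longrightarrow> (\<lambda>x. c * f x) \<in> Lp q"
  by (auto simp: Lp_def abs_mult powr_mult)

lemma Lp_shift: "f \<in> Lp q \<Longrightarrow> (\<lambda>x. f (x + a)) \<in> Lp q"
  using integrable_shift[of "\<lambda>x. \<bar>f x\<bar> powr q" a] by (auto simp: Lp_def intro: measurable_shift)

text \<open>The Euclidean norm is at most the l1 norm, hence at most N times the largest coordinate,
  whose power is one summand of the sum.\<close>

lemma norm_powr_le_sum:
  fixes x :: "real^'n::finite" assumes "p \<ge> 0"
  shows "norm x powr p \<le> real CARD('n) powr p * (\<Sum>i\<in>UNIV. \<bar>x $ i\<bar> powr p)"
proof -
  define m where "m = Max (range (\<lambda>i. \<bar>x $ i\<bar>))"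
  have "m \<in> range (\<lambda>i. \<bar>x $ i\<bar>)" unfolding m_def by (rule Max_in) auto
  then obtain j where j: "m = \<bar>x $ j\<bar>" by auto
  have le: "\<bar>x $ i\<bar> \<le> m" for i unfolding m_def by (rule Max_ge) auto
  have "norm x \<le> (\<Sum>i\<in>UNIV. \<bar>x $ i\<bar>)" by (rule norm_le_l1_cart)
  also have "\<dots> \<le> real CARD('n) * m" using sum_bounded_above[of UNIV "\<lambda>i. \<bar>x $ i\<bar>" m] le by simp
  finally have "norm x powr p \<le> (real CARD('n) * m) powr p" using assms by (intro powr_mono2) auto
  also have "\<dots> = real CARD('n) powr p * \<bar>x $ j\<bar> powr p" using j by (simp add: powr_mult)
  also have "\<bar>x $ j\<bar> powr p \<le> (\<Sum>i\<in>UNIV. \<bar>x $ i\<bar> powr p)"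
    by (rule member_le_sum) auto
  finally show ?thesis by (simp add: mult_left_mono)
qed

lemma measurable_norm_vec:
  fixes g :: "'a \<Rightarrow> real^'n::finite"
  assumes "\<And>i. (\<lambda>x. g x $ i) \<in> borel_measurable M"
  shows "(\<lambda>x. norm (g x)) \<in> borel_measurable M"
  unfolding norm_vec_def L2_set_def using assms by measurable

lemma integrable_norm_powr:
  fixes g :: "real^'n::finite \<Rightarrow> real^'n"
  assumes "\<And>i. (\<lambda>x. g x $ i) \<in> Lp p" "p \<ge> 0"
  shows "integrable lebesgue (\<lambda>x. norm (g x) powr p)"
proof (rule Bochner_Integration.integrable_bound)
  show "integrable lebesgue (\<lambda>x. real CARD('n) powr p * (\<Sum>i\<in>UNIV. \<bar>g x $ i\<bar> powr p))"
    using assms by (intro integrable_mult_right Bochner_Integration.integrable_sum) (simp add: Lp_def)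
  have [measurable]: "(\<lambda>x. norm (g x)) \<in> borel_measurable lebesgue"
    using assms by (intro measurable_norm_vec) (simp add: Lp_def)
  show "(\<lambda>x. norm (g x) powr p) \<in> borel_measurable lebesgue" by measurable
  show "AE x in lebesgue. norm (norm (g x) powr p) \<le> norm (real CARD('n) powr p * (\<Sum>i\<in>UNIV. \<bar>g x $ i\<bar> powr p))"
    using norm_powr_le_sum[OF assms(2)] by (intro AE_I2) (simp add: abs_mult sum_nonneg)
qed

text \<open>The gradient inside \<open>D1p_norm\<close> is selected by Hilbert choice. Uniqueness
  makes it agree almost everywhere with any given weak gradient, so the norm may be computed from a
  convenient representative.\<close>

lemma D1p_norm_powr:
  fixes u :: "real^'n::finite \<Rightarrow> real"
  assumes w: "\<And>i. weak_partial i u (\<lambda>x. g x $ i)" and p: "p > 0"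
  shows "D1p_norm p u powr p = (LINT x|lebesgue. norm (g x) powr p)"
proof -
  have w': "weak_partial i u (\<lambda>x. weak_gradient u x $ i)" for i
    using someI[of "\<lambda>g. \<forall>i. weak_partial i u (\<lambda>x. g x $ i)" g] w unfolding weak_gradient_def by blast
  have m: "(\<lambda>x. norm (g x)) \<in> borel_measurable lebesgue" "(\<lambda>x. norm (weak_gradient u x)) \<in> borel_measurable lebesgue"
    using w w' by (intro measurable_norm_vec locally_integrable_measurable; simp add: weak_partial_def)+
  have "AE x in lebesgue. \<forall>i. weak_gradient u x $ i = g x $ i"
    using weak_partial_unique[OF w' w] by (intro AE_finite_allI[where S=UNIV, simplified]) auto
  then have "AE x in lebesgue. weak_gradient u x = g x" by (simp add: vec_eq_iff)
  then have "(LINT x|lebesgue. norm (weak_gradient u x) powr p) = (LINT x|lebesgue. norm (g x) powr p)"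
    using m by (intro integral_cong_AE) (auto elim: eventually_mono)
  moreover have "(LINT x|lebesgue. norm (g x) powr p) \<ge> 0" by simp
  ultimately show ?thesis using p by (simp add: D1p_norm_def powr_powr)
qed

lemma D1pI:
  fixes u :: "real^'n::finite \<Rightarrow> real"
  assumes "u \<in> Lp (critical_exponent CARD('n) p)" "\<And>i. weak_partial i u (\<lambda>x. g x $ i)" "\<And>i. (\<lambda>x. g x $ i) \<in> Lp p"
  shows "u \<in> D1p p"
  using assms unfolding D1p_def by blast

lemma D1pE:
  fixes u :: "real^'n::finite \<Rightarrow> real"
  assumes "u \<in> D1p p"
  obtains g where "u \<in> Lp (critical_exponent CARD('n) p)" "\<And>i. weak_partial i u (\<lambda>x. g x $ i)" "\<And>i. (\<lambda>x. g x $ i) \<in> Lp p"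
proof -
  have "\<forall>i. \<exists>h \<in> Lp p. weak_partial i u h" using assms by (simp add: D1p_def)
  then obtain h where h: "\<And>i. h i \<in> Lp p" "\<And>i. weak_partial i u (h i)" by metis
  show ?thesis
    by (rule that[of "\<lambda>x. \<chi> i. h i x"]) (use assms h in \<open>auto simp: D1p_def\<close>)
qed

lemma D1p_scale_shift:
  fixes u :: "real^'n::finite \<Rightarrow> real"
  assumes u: "u \<in> D1p p" and p: "p > 0" and t: "t \<ge> 0"
  shows "(\<lambda>x. t * u (x + a)) \<in> D1p p"
    and "D1p_norm p (\<lambda>x. t * u (x + a)) powr p = t powr p * D1p_norm p u powr p"
proof -
  obtain g where g: "u \<in> Lp (critical_exponent CARD('n) p)" "\<And>i. weak_partial i u (\<lambda>x. g x $ i)" "\<And>i. (\<lambda>x. g x $ i) \<in> Lp p"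
    by (rule D1pE[OF u]) blast
  have w: "weak_partial i (\<lambda>x. t * u (x + a)) (\<lambda>x. (t *\<^sub>R g (x + a)) $ i)" for i
    using weak_partial_cmult[OF weak_partial_shift[OF g(2)], where c = t] by simp
  show "(\<lambda>x. t * u (x + a)) \<in> D1p p"
  proof (rule D1pI[OF _ w])
    show "(\<lambda>x. t * u (x + a)) \<in> Lp (critical_exponent CARD('n) p)"
      by (intro Lp_cmult Lp_shift g)
    show "(\<lambda>x. (t *\<^sub>R g (x + a)) $ i) \<in> Lp p" for i
      using Lp_cmult[OF Lp_shift[OF g(3)], where c = t] by simp
  qed
  have "(\<lambda>x. norm (g x)) \<in> borel_measurable lebesgue"
    using g(3) by (intro measurable_norm_vec) (simp add: Lp_def)
  then have m: "(\<lambda>x. norm (g x) powr p) \<in> borel_measurable lebesgue" by measurable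
  have "D1p_norm p (\<lambda>x. t * u (x + a)) powr p = (LINT x|lebesgue. t powr p * norm (g (x + a)) powr p)"
    using D1p_norm_powr[OF w p] t by (simp add: powr_mult)
  also have "\<dots> = t powr p * (LINT x|lebesgue. norm (g x) powr p)"
    using integral_shift[OF m, of a] by simp
  finally show "D1p_norm p (\<lambda>x. t * u (x + a)) powr p = t powr p * D1p_norm p u powr p"
    using D1p_norm_powr[OF g(2) p] by simp
qed

lemma Lp_const_zero:
  fixes u :: "real^'n::finite \<Rightarrow> real"
  assumes "u \<in> Lp q" "AE x in lebesgue. u x = c"
  shows "c = 0"
proof (rule ccontr)
  assume c: "c \<noteq> 0"
  have "integrable lebesgue (\<lambda>x::real^'n. \<bar>c\<bar> powr q)"
  proof (subst integrable_cong_AE)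
    show "integrable lebesgue (\<lambda>x. \<bar>u x\<bar> powr q)" using assms by (simp add: Lp_def)
    then show "(\<lambda>x. \<bar>u x\<bar> powr q) \<in> borel_measurable lebesgue" by auto
    show "AE x in lebesgue. \<bar>c\<bar> powr q = \<bar>u x\<bar> powr q" using assms(2) by eventually_elim simp
  qed simp
  from integrable_mult_right[OF this, of "1 / \<bar>c\<bar> powr q"]
  have "integrable lebesgue (indicat_real (UNIV :: (real^'n) set))" using c by simp
  then show False by (subst (asm) integrable_indicator_iff) simp
qed

text \<open>A zero norm forces the gradient to vanish, so u is constant, and integrability of its
  critical power over a space of infinite measure excludes nonzero constants.\<close>

lemma D1p_norm_pos:
  fixes u :: "real^'n::finite \<Rightarrow> real"
  assumes u: "u \<in> D1p p" and p: "p > 0" and nz: "\<not> (AE x in lebesgue. u x = 0)"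
  shows "D1p_norm p u powr p > 0"
proof (rule ccontr)
  obtain g where g: "u \<in> Lp (critical_exponent CARD('n) p)" "\<And>i. weak_partial i u (\<lambda>x. g x $ i)" "\<And>i. (\<lambda>x. g x $ i) \<in> Lp p"
    by (rule D1pE[OF u]) blast
  assume "\<not> D1p_norm p u powr p > 0"
  moreover have "(LINT x|lebesgue. norm (g x) powr p) \<ge> 0" by simp
  ultimately have "(LINT x|lebesgue. norm (g x) powr p) = 0" by (simp add: D1p_norm_powr[OF g(2) p])
  then have ae: "AE x in lebesgue. norm (g x) powr p = 0"
    using integral_nonneg_eq_0_iff_AE[OF integrable_norm_powr[OF g(3)]] p by simp
  have "weak_partial i u (\<lambda>_. 0)" for i
  proof (rule weak_partial_cong[OF g(2)])
    show "AE x in lebesgue. g x $ i = 0" using ae by eventually_elim auto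
  qed (use Lp_measurable[OF g(1)] in auto)
  then obtain c where c: "AE x in lebesgue. u x = c" using zero_weak_gradient_const by blast
  then show False using Lp_const_zero[OF g(1) c] nz by simp
qed

section \<open>Products of functions translated far apart\<close>

lemma tail_tendsto_0:
  fixes f :: "real^'n::finite \<Rightarrow> real"
  assumes "integrable lebesgue f"
  shows "(\<lambda>n::nat. LINT x|lebesgue. indicator (- cube (real n)) x * f x) \<longlonglongrightarrow> 0"
proof -
  have "(\<lambda>n::nat. LINT x|lebesgue. indicator (- cube (real n)) x * f x) \<longlonglongrightarrow> (LINT x|(lebesgue :: (real^'n) measure). 0)"
  proof (rule integral_dominated_convergence[where w = "\<lambda>x. \<bar>f x\<bar>"])
    show "AE x in lebesgue. (\<lambda>n. indicator (- cube (real n)) x * f x) \<longlonglongrightarrow> 0"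
    proof (rule AE_I2)
      fix x :: "real^'n"
      obtain r where r: "r > 0" "{x} \<subseteq> cube r" using bounded_subset_cube[of "{x}"] by auto
      have "\<forall>\<^sub>F n in sequentially. indicator (- cube (real n)) x * f x = 0"
        using eventually_ge_at_top[of "nat \<lceil>r\<rceil>"]
      proof eventually_elim
        case (elim n)
        then have "r \<le> real n" by linarith
        then have "x \<in> cube (real n)" using r cube_mono by blast
        then show ?case by simp
      qed
      then show "(\<lambda>n. indicator (- cube (real n)) x * f x) \<longlonglongrightarrow> 0" by (rule tendsto_eventually)
    qed
    show "(\<lambda>x. indicator (- cube (real n)) x * f x) \<in> borel_measurable lebesgue" for n
      using borel_measurable_integrable[OF assms] by (intro borel_measurable_times borel_measurable_indicator) auto
    show "AE x in lebesgue. norm (indicator (- cube (real n)) x * f x) \<le> \<bar>f x\<bar>" for n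
      by (intro AE_I2) (simp add: indicator_def)
  qed (use assms in auto)
  then show ?thesis by simp
qed

lemma integral_lin4:
  fixes a b c d :: "'a \<Rightarrow> real"
  assumes "integrable M a" "integrable M b" "integrable M c" "integrable M d"
  shows "(LINT x|M. k1 * a x + k2 * b x + (k3 * c x + k4 * d x)) =
     k1 * (LINT x|M. a x) + k2 * (LINT x|M. b x) + (k3 * (LINT x|M. c x) + k4 * (LINT x|M. d x))"
  using assms by simp

text \<open>Once the shift is at least 2R long, a point and its translate are never both in the cube
  of half-side R, so at every point one factor is a tail. A weighted Young inequality puts the large
  weight on the tail and the small weight on the other factor.\<close>

lemma shifted_product_tendsto_0:
  fixes f g :: "real^'n::finite \<Rightarrow> real"
  assumes f: "f \<in> borel_measurable lebesgue" "integrable lebesgue (\<lambda>x. (f x)\<^sup>2)" "\<And>x. f x \<ge> 0"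
    and g: "g \<in> borel_measurable lebesgue" "integrable lebesgue (\<lambda>x. (g x)\<^sup>2)" "\<And>x. g x \<ge> 0"
    and c: "c \<noteq> 0"
  shows "(\<lambda>n::nat. LINT x|lebesgue. f (x + (real n * c) *\<^sub>R axis i 1) * g x) \<longlonglongrightarrow> 0"
proof (rule LIMSEQ_I)
  fix e :: real assume e: "e > 0"
  let ?T = "\<lambda>n. (real n * c) *\<^sub>R axis i 1 :: real^'n"
  define M where "M = (LINT x|lebesgue. (f x)\<^sup>2) + (LINT x|lebesgue. (g x)\<^sup>2) + 1"
  have M: "M > 0" unfolding M_def by (simp add: add_nonneg_pos)
  \<comment> \<open>With this weight the two main terms stay below d M / 2 = e/4; with tails below e
    d / 4, the two terms of weight 1 / (2 d) together add less than e/4.\<close>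
  define d where "d = e / (2 * M)"
  have d: "d > 0" using e M by (simp add: d_def)
  have "\<forall>\<^sub>F R in sequentially. (LINT x|lebesgue. indicator (- cube (real R)) x * (f x)\<^sup>2) < e * d / 4 \<and>
     (LINT x|lebesgue. indicator (- cube (real R)) x * (g x)\<^sup>2) < e * d / 4"
    using order_tendstoD(2)[OF tail_tendsto_0[OF f(2)], of "e * d / 4"]
      order_tendstoD(2)[OF tail_tendsto_0[OF g(2)], of "e * d / 4"] e d
    by (intro eventually_conj) auto
  then obtain R where R: "(LINT x|lebesgue. indicator (- cube (real R)) x * (f x)\<^sup>2) < e * d / 4"
     "(LINT x|lebesgue. indicator (- cube (real R)) x * (g x)\<^sup>2) < e * d / 4"
    by (auto simp: eventually_sequentially)
  let ?g = "\<lambda>x. indicator (- cube (real R)) x * (g x)\<^sup>2"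
  let ?f = "\<lambda>x. indicator (- cube (real R)) x * (f x)\<^sup>2"
  obtain n0 :: nat where n0: "2 * real R / \<bar>c\<bar> \<le> real n0" using real_arch_simple by blast
  have "(LINT x|lebesgue. f (x + ?T n) * g x) < e" if n: "n \<ge> n0" for n
  proof -
    have big: "2 * real R \<le> \<bar>real n * c\<bar>"
    proof -
      have "2 * real R \<le> real n0 * \<bar>c\<bar>" using n0 c by (simp add: divide_le_eq)
      also have "\<dots> \<le> real n * \<bar>c\<bar>" using n by (intro mult_right_mono) auto
      finally show ?thesis by (simp add: abs_mult)
    qed
    have out: "x + ?T n \<notin> cube (real R)" if x: "x \<in> cube (real R)" for x
    proof
      assume "x + ?T n \<in> cube (real R)"
      then have "\<bar>(x + ?T n) $ i\<bar> < real R" unfolding mem_cube by blast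
      moreover have "\<bar>x $ i\<bar> < real R" using x unfolding mem_cube by blast
      ultimately show False using big by (simp add: axis_def)
    qed
    define h where "h x = d / 2 * (f (x + ?T n))\<^sup>2 + d / 2 * (g x)\<^sup>2 +
       (1 / (2 * d) * (indicator (- cube (real R)) (x + ?T n) * (f (x + ?T n))\<^sup>2)
        + 1 / (2 * d) * (?g x))" for x
    have if': "integrable lebesgue (\<lambda>x. ?f x)"
      using integrable_mult_indicator[of "- cube (real R)" lebesgue, OF _ f(2)] by auto
    have ig': "integrable lebesgue (\<lambda>x. ?g x)"
      using integrable_mult_indicator[of "- cube (real R)" lebesgue, OF _ g(2)] by auto
    have ih: "integrable lebesgue h" unfolding h_def[abs_def]
      by (intro Bochner_Integration.integrable_add integrable_mult_right g(2) ig'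
        integrable_shift[OF f(2)] integrable_shift[OF if'])
    have young: "a * b \<le> d / 2 * a\<^sup>2 + 1 / (2 * d) * b\<^sup>2" for a b :: real
    proof -
      have "0 \<le> (d * a - b)\<^sup>2 / (2 * d)" using d by simp
      also have "\<dots> = d / 2 * a\<^sup>2 + 1 / (2 * d) * b\<^sup>2 - a * b"
        using d by (simp add: power2_diff field_simps power2_eq_square)
      finally show ?thesis by simp
    qed
    have "(LINT x|lebesgue. f (x + ?T n) * g x) \<le> (LINT x|lebesgue. h x)"
    proof (rule integral_mono_AE'[OF ih])
      show "AE x in lebesgue. f (x + ?T n) * g x \<le> h x"
      proof (rule AE_I2)
        fix x
        show "f (x + ?T n) * g x \<le> h x"
        proof (cases "x \<in> cube (real R)")
          case True
          have "g x * f (x + ?T n) \<le> d / 2 * (g x)\<^sup>2 + 1 / (2 * d) * (f (x + ?T n))\<^sup>2" by (rule young)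
          moreover have "0 \<le> d / 2 * (f (x + ?T n))\<^sup>2" using d by simp
          ultimately show ?thesis using out[OF True] True unfolding h_def by (simp add: mult.commute)
        next
          case False
          have "f (x + ?T n) * g x \<le> d / 2 * (f (x + ?T n))\<^sup>2 + 1 / (2 * d) * (g x)\<^sup>2" by (rule young)
          moreover have "0 \<le> d / 2 * (g x)\<^sup>2"
            "0 \<le> 1 / (2 * d) * (indicator (- cube (real R)) (x + ?T n) * (f (x + ?T n))\<^sup>2)" using d by simp_all
          ultimately show ?thesis using False unfolding h_def by simp
        qed
      qed
      show "AE x in lebesgue. 0 \<le> h x" unfolding h_def using d by (intro AE_I2) simp
    qed
    also have "\<dots> = d / 2 * (LINT x|lebesgue. (f (x + ?T n))\<^sup>2) + d / 2 * (LINT x|lebesgue. (g x)\<^sup>2) +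
       (1 / (2 * d) * (LINT x|lebesgue. indicator (- cube (real R)) (x + ?T n) * (f (x + ?T n))\<^sup>2)
        + 1 / (2 * d) * (LINT x|lebesgue. ?g x))"
      unfolding h_def using integrable_shift[OF f(2), of "?T n"] integrable_shift[OF if', of "?T n"] g(2) ig'
      by (intro integral_lin4)
    also have "(LINT x|lebesgue. (f (x + ?T n))\<^sup>2) = (LINT x|lebesgue. (f x)\<^sup>2)"
      by (rule integral_shift[OF borel_measurable_integrable[OF f(2)]])
    also have "(LINT x|lebesgue. indicator (- cube (real R)) (x + ?T n) * (f (x + ?T n))\<^sup>2) = (LINT x|lebesgue. ?f x)"
      by (rule integral_shift[OF borel_measurable_integrable[OF if']])
    also have "d / 2 * (LINT x|lebesgue. (f x)\<^sup>2) + d / 2 * (LINT x|lebesgue. (g x)\<^sup>2) +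
       (1 / (2 * d) * (LINT x|lebesgue. ?f x)
        + 1 / (2 * d) * (LINT x|lebesgue. ?g x)) <
       d / 2 * M + (1 / (2 * d) * (e * d / 4) + 1 / (2 * d) * (e * d / 4))"
    proof -
      have "d / 2 * (LINT x|lebesgue. (f x)\<^sup>2) + d / 2 * (LINT x|lebesgue. (g x)\<^sup>2) < d / 2 * M"
        using d by (simp add: M_def field_simps)
      moreover have "1 / (2 * d) * (LINT x|lebesgue. ?f x) < 1 / (2 * d) * (e * d / 4)"
        "1 / (2 * d) * (LINT x|lebesgue. ?g x) < 1 / (2 * d) * (e * d / 4)"
        using R d by (intro mult_strict_left_mono; simp)+
      ultimately show ?thesis by linarith
    qed
    also have "\<dots> = e / 2" using d M by (simp add: d_def field_simps)
    finally show ?thesis using e by linarith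
  qed
  moreover have "(LINT x|lebesgue. f (x + ?T n) * g x) \<ge> 0" for n
    using f(3) g(3) by (intro Bochner_Integration.integral_nonneg) auto
  ultimately show "\<exists>n0. \<forall>n\<ge>n0. norm ((LINT x|lebesgue. f (x + ?T n) * g x) - 0) < e"
    by (intro exI[of _ n0]) simp
qed

section \<open>Decoupling by translations\<close>

text \<open>The map whose fixed point is sought is \<open>s\<^sub>i \<mapsto> ((a\<^sub>i + s\<^sub>i\<^sup>-\<^sup>\<alpha> \<Sum>j C\<^sub>i\<^sub>j s\<^sub>j) / D\<^sub>i)\<close> raised to \<open>1 / (1 - \<alpha>)\<close>:
  in this form it preserves a box above the unperturbed solution \<open>s0\<close> whatever the sign of \<open>\<alpha>\<close>.\<close>

lemma perturbed_system:
  fixes a D :: "'l::finite \<Rightarrow> real" and C :: "nat \<Rightarrow> 'l \<Rightarrow> 'l \<Rightarrow> real"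
  assumes a: "\<And>i. a i > 0" and D: "\<And>i. D i > 0" and \<alpha>: "\<alpha> < 1" and d: "d > 0"
    and C0: "\<And>n i j. C n i j \<ge> 0" and C: "\<And>i j. (\<lambda>n. C n i j) \<longlonglongrightarrow> 0"
  defines "s0 \<equiv> \<lambda>i. (a i / D i) powr (1 / (1 - \<alpha>))"
  shows "\<forall>\<^sub>F n in sequentially. \<exists>s. \<forall>i. s0 i \<le> s i \<and> s i \<le> s0 i + d \<and>
     D i * s i = a i * s i powr \<alpha> + (\<Sum>j\<in>UNIV. C n i j * s j)"
proof -
  define \<gamma> where "\<gamma> = 1 / (1 - \<alpha>)"
  have \<gamma>: "\<gamma> > 0" "(1 - \<alpha>) * \<gamma> = 1" using \<alpha> by (auto simp: \<gamma>_def)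
  have s0: "s0 i > 0" for i using a[of i] D[of i] by (simp add: s0_def)
  \<comment> \<open>A bound for x powr (- \<alpha>) between \<open>s0 i\<close> and
    \<open>s0 i + d\<close> for either sign of \<alpha>: the power is monotone, so the sum of its
    values at the endpoints dominates it.\<close>
  define K where "K i = s0 i powr (- \<alpha>) + (s0 i + d) powr (- \<alpha>)" for i
  have K: "x powr (- \<alpha>) \<le> K i" if "s0 i \<le> x" "x \<le> s0 i + d" for x i
  proof (cases "\<alpha> \<le> 0")
    case True
    then have "x powr (- \<alpha>) \<le> (s0 i + d) powr (- \<alpha>)" using that s0[of i] by (intro powr_mono2) auto
    then show ?thesis by (simp add: K_def add_increasing)
  next
    case False
    then have "x powr (- \<alpha>) \<le> s0 i powr (- \<alpha>)" using that s0[of i] by (intro powr_mono2') auto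
    then show ?thesis by (simp add: K_def add_increasing2)
  qed
  have "\<forall>\<^sub>F n in sequentially. ((a i + K i * (\<Sum>j\<in>UNIV. C n i j * (s0 j + d))) / D i) powr \<gamma> < s0 i + d" for i
  proof -
    \<comment> \<open>The perturbation disappears as n grows, so the upper estimate of the map tends
      to \<open>s0 i\<close> and drops below the upper face of the box.\<close>
    have "(\<lambda>n. ((a i + K i * (\<Sum>j\<in>UNIV. C n i j * (s0 j + d))) / D i) powr \<gamma>) \<longlonglongrightarrow>
       ((a i + K i * (\<Sum>j\<in>UNIV. 0 * (s0 j + d))) / D i) powr \<gamma>"
      using a[of i] D[of i] by (intro tendsto_powr tendsto_const tendsto_divide tendsto_add tendsto_mult tendsto_sum C) auto
    then have "(\<lambda>n. ((a i + K i * (\<Sum>j\<in>UNIV. C n i j * (s0 j + d))) / D i) powr \<gamma>) \<longlonglongrightarrow> s0 i"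
      by (simp add: s0_def \<gamma>_def)
    then show ?thesis using d by (intro order_tendstoD) auto
  qed
  then have "\<forall>\<^sub>F n in sequentially. \<forall>i. ((a i + K i * (\<Sum>j\<in>UNIV. C n i j * (s0 j + d))) / D i) powr \<gamma> < s0 i + d"
    by (intro eventually_all_finite)
  then show ?thesis
  proof eventually_elim
    case (elim n)
    let ?\<Sigma> = "\<lambda>s::real^'l. \<lambda>i. \<Sum>j\<in>UNIV. C n i j * s $ j"
    define f where "f s = (\<chi> i. ((a i + s $ i powr (- \<alpha>) * ?\<Sigma> s i) / D i) powr \<gamma>)" for s :: "real^'l"
    define S :: "(real^'l) set" where "S = cbox (\<chi> i. s0 i) (\<chi> i. s0 i + d)"
    have S: "s \<in> S \<longleftrightarrow> (\<forall>i. s0 i \<le> s $ i \<and> s $ i \<le> s0 i + d)" for s by (simp add: S_def mem_box_cart)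
    have pos: "?\<Sigma> s i \<ge> 0" "s $ i > 0" if "s \<in> S" for s i
      using that s0 C0 unfolding S by (auto intro!: sum_nonneg mult_nonneg_nonneg intro: order_trans less_imp_le less_le_trans)
    have base: "a i + s $ i powr (- \<alpha>) * ?\<Sigma> s i > 0" if "s \<in> S" for s i
      using pos[OF that] a[of i] by (intro add_pos_nonneg) auto
    obtain s where s: "s \<in> S" "f s = s"
    proof (rule brouwer[of S f])
      show "compact S" "convex S" unfolding S_def by (rule compact_cbox, rule convex_box)
      have "(\<chi> i. s0 i) \<in> S" using d by (simp add: S)
      then show "S \<noteq> {}" by blast
      show "continuous_on S f" unfolding f_def
      proof (intro continuous_on_vec_lambda continuous_on_powr continuous_on_divide continuous_on_add
          continuous_on_mult continuous_on_const continuous_on_sum continuous_on_component ballI)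
        fix s i assume "s \<in> S"
        then show "s $ i \<noteq> 0" using pos(2)[of s i] by simp
        show "(a i + s $ i powr (- \<alpha>) * ?\<Sigma> s i) / D i \<noteq> 0" using base[OF \<open>s \<in> S\<close>, of i] D[of i] by simp
      qed (use D in \<open>auto simp: less_imp_neq[symmetric]\<close>)
      show "f \<in> S \<rightarrow> S"
      proof
        fix s assume sS: "s \<in> S"
        \<comment> \<open>The perturbation is nonnegative and the outer exponent positive, so the
          map never falls below the unperturbed solution.\<close>
        have "s0 i \<le> f s $ i" for i
          using a[of i] D[of i] \<gamma> pos[OF sS, of i] unfolding f_def s0_def \<gamma>_def[symmetric]
          by (auto intro!: powr_mono2 divide_right_mono)
        moreover have "f s $ i \<le> s0 i + d" for i
        proof -
          have "s $ i powr (- \<alpha>) * ?\<Sigma> s i \<le> K i * (\<Sum>j\<in>UNIV. C n i j * (s0 j + d))"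
          proof (rule mult_mono)
            show "s $ i powr (- \<alpha>) \<le> K i" using sS by (intro K) (auto simp: S)
            show "?\<Sigma> s i \<le> (\<Sum>j\<in>UNIV. C n i j * (s0 j + d))"
              using sS C0 by (intro sum_mono mult_left_mono) (auto simp: S)
            show "0 \<le> K i" by (simp add: K_def)
            show "0 \<le> ?\<Sigma> s i" by (rule pos[OF sS])
          qed
          then have "f s $ i \<le> ((a i + K i * (\<Sum>j\<in>UNIV. C n i j * (s0 j + d))) / D i) powr \<gamma>"
            using \<gamma> D[of i] base[OF sS, of i] unfolding f_def by (auto intro!: powr_mono2 divide_right_mono)
          then show ?thesis using elim less_imp_le order_trans by blast
        qed
        ultimately show "f s \<in> S" by (simp add: S)
      qed
    qed
    have "D i * s $ i = a i * s $ i powr \<alpha> + ?\<Sigma> s i" for i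
    proof -
      have sp: "s $ i > 0" by (rule pos[OF s(1)])
      have "s $ i = ((a i + s $ i powr (- \<alpha>) * ?\<Sigma> s i) / D i) powr \<gamma>"
        using arg_cong[OF s(2), of "\<lambda>s. s $ i"] by (simp add: f_def)
      then have "s $ i powr (1 - \<alpha>) = ((a i + s $ i powr (- \<alpha>) * ?\<Sigma> s i) / D i) powr (\<gamma> * (1 - \<alpha>))"
        by (metis powr_powr)
      then have "s $ i powr (1 - \<alpha>) = (a i + s $ i powr (- \<alpha>) * ?\<Sigma> s i) / D i"
        using \<gamma>(2) base[OF s(1), of i] D[of i] by (simp add: mult.commute)
      then have "D i * s $ i powr (1 - \<alpha>) * s $ i powr \<alpha> = (a i + s $ i powr (- \<alpha>) * ?\<Sigma> s i) * s $ i powr \<alpha>"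
        using D[of i] by (simp add: field_simps)
      moreover have "s $ i powr (1 - \<alpha>) * s $ i powr \<alpha> = s $ i" "s $ i powr (- \<alpha>) * s $ i powr \<alpha> = 1"
        using sp by (simp_all flip: powr_add)
      ultimately show ?thesis by (simp add: algebra_simps)
    qed
    then show ?case using s(1) by (intro exI[of _ "\<lambda>i. s $ i"]) (auto simp: S)
  qed
qed

section \<open>The coupling integrals\<close>

lemma coupling_measurable:
  assumes "u \<in> Lp q"
  shows "(\<lambda>x. \<bar>u x\<bar> powr (q / 2)) \<in> borel_measurable lebesgue"
    and "integrable lebesgue (\<lambda>x. (\<bar>u x\<bar> powr (q / 2))\<^sup>2)"
proof -
  have [measurable]: "u \<in> borel_measurable lebesgue" by (rule Lp_measurable[OF assms])
  show "(\<lambda>x. \<bar>u x\<bar> powr (q / 2)) \<in> borel_measurable lebesgue" by measurable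
  have "(\<bar>y\<bar> powr (q / 2))\<^sup>2 = \<bar>y\<bar> powr q" for y :: real
    by (simp add: power2_eq_square flip: powr_add)
  then show "integrable lebesgue (\<lambda>x. (\<bar>u x\<bar> powr (q / 2))\<^sup>2)" using assms by (simp add: Lp_def)
qed

text \<open>For u in L^q the function |u|^(q/2) is square integrable, so a coupling is an L2
  product, dominated by the sum of the squares.\<close>

lemma coupling_integrable:
  fixes u v :: "real^'n::finite \<Rightarrow> real"
  assumes "u \<in> Lp q" "v \<in> Lp q"
  shows "integrable lebesgue (\<lambda>x. \<bar>u x\<bar> powr (q / 2) * \<bar>v x\<bar> powr (q / 2))"
proof (rule Bochner_Integration.integrable_bound)
  show "integrable lebesgue (\<lambda>x. (\<bar>u x\<bar> powr (q / 2))\<^sup>2 + (\<bar>v x\<bar> powr (q / 2))\<^sup>2)"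
    by (intro Bochner_Integration.integrable_add coupling_measurable assms)
  show "(\<lambda>x. \<bar>u x\<bar> powr (q / 2) * \<bar>v x\<bar> powr (q / 2)) \<in> borel_measurable lebesgue"
    by (intro borel_measurable_times coupling_measurable assms)
  have "a * b \<le> a\<^sup>2 + b\<^sup>2" if "0 \<le> a" "0 \<le> b" for a b :: real
  proof -
    have "2 * a * b \<le> a\<^sup>2 + b\<^sup>2" by (rule sum_squares_bound)
    moreover have "0 \<le> a * b" using that by simp
    ultimately show ?thesis by linarith
  qed
  then show "AE x in lebesgue. norm (\<bar>u x\<bar> powr (q / 2) * \<bar>v x\<bar> powr (q / 2)) \<le> norm ((\<bar>u x\<bar> powr (q / 2))\<^sup>2 + (\<bar>v x\<bar> powr (q / 2))\<^sup>2)"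
    by (intro AE_I2) simp
qed

lemma coupling_nonneg: "coupling p u v \<ge> 0"
  unfolding coupling_def by (intro Bochner_Integration.integral_nonneg) simp

text \<open>A change of variables leaves only the relative translation a - b; its growth is what
  drives the couplings of the competitors to zero.\<close>

lemma coupling_scale_shift:
  fixes v w :: "real^'n::finite \<Rightarrow> real"
  assumes v: "v \<in> Lp (critical_exponent CARD('n) p)" and w: "w \<in> Lp (critical_exponent CARD('n) p)"
    and t: "0 \<le> s" "0 \<le> t"
  defines "q \<equiv> critical_exponent CARD('n) p"
  shows "coupling p (\<lambda>x. s * v (x + a)) (\<lambda>x. t * w (x + b)) =
     s powr (q / 2) * t powr (q / 2) * (LINT x|lebesgue. \<bar>v (x + (a - b))\<bar> powr (q / 2) * \<bar>w x\<bar> powr (q / 2))"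
proof -
  have m: "(\<lambda>x. \<bar>v (x + (a - b))\<bar> powr (q / 2) * \<bar>w x\<bar> powr (q / 2)) \<in> borel_measurable lebesgue"
    using coupling_measurable(1)[OF Lp_shift[OF v]] coupling_measurable(1)[OF w] unfolding q_def
    by (intro borel_measurable_times)
  have "coupling p (\<lambda>x. s * v (x + a)) (\<lambda>x. t * w (x + b)) =
    (LINT x|lebesgue. s powr (q / 2) * t powr (q / 2) * (\<bar>v ((x + b) + (a - b))\<bar> powr (q / 2) * \<bar>w (x + b)\<bar> powr (q / 2)))"
    unfolding coupling_def q_def using t by (simp add: abs_mult powr_mult mult_ac)
  also have "\<dots> = s powr (q / 2) * t powr (q / 2) * (LINT x|lebesgue. \<bar>v ((x + b) + (a - b))\<bar> powr (q / 2) * \<bar>w (x + b)\<bar> powr (q / 2))"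
    by (rule integral_mult_right_zero)
  also have "(LINT x|lebesgue. \<bar>v ((x + b) + (a - b))\<bar> powr (q / 2) * \<bar>w (x + b)\<bar> powr (q / 2)) =
     (LINT x|lebesgue. \<bar>v (x + (a - b))\<bar> powr (q / 2) * \<bar>w x\<bar> powr (q / 2))"
    by (rule integral_shift[OF m, of b])
  finally show ?thesis .
qed

lemma coupling_self_pos:
  fixes u :: "real^'n::finite \<Rightarrow> real"
  assumes u: "u \<in> Lp (critical_exponent CARD('n) p)" and nz: "\<not> (AE x in lebesgue. u x = 0)"
  shows "coupling p u u > 0"
proof (rule ccontr)
  assume "\<not> coupling p u u > 0"
  then have "coupling p u u = 0" using coupling_nonneg[of p u u] by simp
  then have "AE x in lebesgue. \<bar>u x\<bar> powr (critical_exponent CARD('n) p / 2) * \<bar>u x\<bar> powr (critical_exponent CARD('n) p / 2) = 0"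
    unfolding coupling_def using integral_nonneg_eq_0_iff_AE[OF coupling_integrable[OF u u]] by simp
  then have "AE x in lebesgue. u x = 0" by eventually_elim simp
  then show False using nz by simp
qed

lemma nehari_energy:
  assumes "u \<in> nehari p \<beta>"
  shows "energy p \<beta> (u :: 'l::finite \<Rightarrow> real^'n::finite \<Rightarrow> real) =
    (1 / p - 1 / critical_exponent CARD('n) p) * (\<Sum>i\<in>UNIV. D1p_norm p (u i) powr p)"
proof -
  have "(\<Sum>i\<in>UNIV. \<Sum>j\<in>UNIV. \<beta> i j * coupling p (u j) (u i)) = (\<Sum>i\<in>UNIV. D1p_norm p (u i) powr p)"
    using assms by (simp add: nehari_def)
  then show ?thesis by (simp add: energy_def left_diff_distrib)
qed

lemma critical_exponent_gt:
  assumes "0 < p" "p < real N" shows "p < critical_exponent N p"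
proof -
  have "p * (real N - p) < real N * p" using assms by (simp add: algebra_simps)
  then show ?thesis using assms by (simp add: critical_exponent_def less_divide_eq)
qed

text \<open>Each summand, times the prefactor, is the energy of the multiple t w i with t^p a =
  \<beta> i i t^q b, where a and b are the p-th power of the norm and the self-coupling of w i.
  Hence t^(q - p) = a / (\<beta> i i b), and t^p carries the exponent p / (q - p). With the
  components far apart, the factors that solve the full system exceed these by an arbitrarily small
  amount.\<close>

lemma nehari_INF_le:
  fixes w :: "'l::finite \<Rightarrow> real^'n::finite \<Rightarrow> real" and \<beta> :: "'l \<Rightarrow> 'l \<Rightarrow> real"
  assumes p: "0 < p" "p < real CARD('n)"
    and \<beta>: "\<And>i. \<beta> i i > 0" "\<And>i j. i \<noteq> j \<Longrightarrow> \<beta> i j < 0"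
    and w: "\<And>i. w i \<in> D1p p" "\<And>i. \<not> (AE x in lebesgue. w i x = 0)"
  defines "q \<equiv> critical_exponent CARD('n) p"
  shows "(INF v\<in>(nehari p \<beta> :: ('l \<Rightarrow> real^'n \<Rightarrow> real) set). energy p \<beta> v) \<le>
    (1 / p - 1 / q) * (\<Sum>i\<in>UNIV. (D1p_norm p (w i) powr p / (\<beta> i i * coupling p (w i) (w i))) powr (p / (q - p))
       * D1p_norm p (w i) powr p)"
proof -
  let ?I = "INF v\<in>(nehari p \<beta> :: ('l \<Rightarrow> real^'n \<Rightarrow> real) set). energy p \<beta> v"
  have pq: "p < q" unfolding q_def by (rule critical_exponent_gt[OF p])
  then have q: "q > 0" using p by simp
  define \<kappa> where "\<kappa> = 1 / p - 1 / q"
  have \<kappa>: "\<kappa> > 0" using p pq by (simp add: \<kappa>_def frac_less2)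
  \<comment> \<open>The substitution s = t powr (q / 2) makes the couplings bilinear. After division
    by s i, the Nehari equation reads D i * s i = a i * s i powr \<alpha> plus the sum of the C i j
    * s j, and 2 p / q - 1 is the resulting exponent.\<close>
  define \<alpha> where "\<alpha> = 2 * p / q - 1"
  have \<alpha>: "\<alpha> < 1" using pq q by (simp add: \<alpha>_def divide_less_eq)
  define a where "a i = D1p_norm p (w i) powr p" for i
  define b where "b i = coupling p (w i) (w i)" for i
  have wq: "w i \<in> Lp q" for i using w(1)[of i] by (simp add: D1p_def q_def)
  have a: "a i > 0" for i unfolding a_def by (rule D1p_norm_pos[OF w(1) p(1) w(2)])
  have b: "b i > 0" for i unfolding b_def by (rule coupling_self_pos[OF wq[unfolded q_def] w(2)])
  define D where "D i = \<beta> i i * b i" for i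
  have D: "D i > 0" for i unfolding D_def using \<beta>(1) b by simp
  define s0 where "s0 i = (a i / D i) powr (1 / (1 - \<alpha>))" for i
  have s0: "s0 i > 0" for i using a[of i] D[of i] by (simp add: s0_def)
  have bdd: "bdd_below (energy p \<beta> ` (nehari p \<beta> :: ('l \<Rightarrow> real^'n \<Rightarrow> real) set))"
  proof (rule bdd_belowI2)
    fix v :: "'l \<Rightarrow> real^'n \<Rightarrow> real" assume "v \<in> nehari p \<beta>"
    then show "0 \<le> energy p \<beta> v" using \<kappa> unfolding nehari_energy[OF \<open>v \<in> nehari p \<beta>\<close>]
      by (auto simp: \<kappa>_def q_def intro!: mult_nonneg_nonneg sum_nonneg)
  qed
  \<comment> \<open>Distinct integers on one common axis, multiplied by n: all mutual distances grow
    linearly in n.\<close>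
  obtain idx :: "'l \<Rightarrow> nat" where idx: "inj idx" using finite_imp_inj_to_nat_seg[of "UNIV :: 'l set"] by auto
  obtain i0 :: 'n where True by simp
  define k where "k n i = (real n * real (idx i)) *\<^sub>R (axis i0 1 :: real^'n)" for n :: nat and i :: 'l
  have kdiff: "k n j - k n i = (real n * (real (idx j) - real (idx i))) *\<^sub>R axis i0 1" for n i j
    by (simp add: k_def algebra_simps)
  define c where "c n i j = (LINT x|lebesgue. \<bar>w j (x + (k n j - k n i))\<bar> powr (q / 2) * \<bar>w i x\<bar> powr (q / 2))" for n i j
  have c0: "c n i j \<ge> 0" for n i j unfolding c_def by (intro Bochner_Integration.integral_nonneg) simp
  have cii: "c n i i = b i" for n i by (simp add: c_def b_def coupling_def q_def)
  have clim: "(\<lambda>n. c n i j) \<longlonglongrightarrow> 0" if "i \<noteq> j" for i j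
    unfolding c_def kdiff
  proof (rule shifted_product_tendsto_0)
    show "real (idx j) - real (idx i) \<noteq> 0" using that idx by (auto simp: inj_eq)
  qed (use coupling_measurable[OF wq] in auto)
  \<comment> \<open>The repulsive couplings are moved to the other side of the equation. Their
    negative sign becomes the nonnegativity of the coefficients on which the fixed point argument
    depends.\<close>
  define C where "C n i j = (if i = j then 0 else - \<beta> i j * c n i j)" for n i j
  have C0: "C n i j \<ge> 0" for n i j
    using c0[of n i j] \<beta>(2)[of i j] by (auto simp: C_def mult_nonpos_nonneg)
  have Clim: "(\<lambda>n. C n i j) \<longlonglongrightarrow> 0" for i j
  proof (cases "i = j")
    case False
    then show ?thesis using tendsto_mult[OF tendsto_const[of "- \<beta> i j"] clim[OF False]] by (simp add: C_def)
  qed (simp add: C_def)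
  have step: "?I \<le> \<kappa> * (\<Sum>i\<in>UNIV. (s0 i + d) powr (1 + \<alpha>) * a i)"
    if d: "d > 0" for d
  proof -
    have "\<forall>\<^sub>F n in sequentially. \<exists>s. \<forall>i. s0 i \<le> s i \<and> s i \<le> s0 i + d \<and>
       D i * s i = a i * s i powr \<alpha> + (\<Sum>j\<in>UNIV. C n i j * s j)"
      unfolding s0_def by (rule perturbed_system[OF a D \<alpha> d C0 Clim])
    then obtain n where "\<exists>s. \<forall>i. s0 i \<le> s i \<and> s i \<le> s0 i + d \<and>
       D i * s i = a i * s i powr \<alpha> + (\<Sum>j\<in>UNIV. C n i j * s j)"
      unfolding eventually_sequentially by blast
    then obtain s where s: "\<And>i. s0 i \<le> s i" "\<And>i. s i \<le> s0 i + d"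
      "\<And>i. D i * s i = a i * s i powr \<alpha> + (\<Sum>j\<in>UNIV. C n i j * s j)"
      by blast
    have sp: "s i > 0" for i using s0[of i] s(1)[of i] by linarith
    define t where "t i = s i powr (2 / q)" for i
    have t: "t i > 0" for i using sp[of i] by (simp add: t_def)
    have tq: "t i powr (q / 2) = s i" for i using sp[of i] q by (simp add: t_def powr_powr)
    have tp: "t i powr p = s i powr (1 + \<alpha>)" for i using sp[of i] by (simp add: t_def powr_powr \<alpha>_def)
    define v where "v i x = t i * w i (x + k n i)" for i x
    have vD: "v i \<in> D1p p" "D1p_norm p (v i) powr p = s i powr (1 + \<alpha>) * a i" for i
      unfolding v_def using D1p_scale_shift[OF w(1)[of i] p(1) less_imp_le[OF t[of i]]] by (auto simp: tp a_def)
    have vc: "coupling p (v j) (v i) = s j * s i * c n i j" for i j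
      unfolding v_def c_def q_def
      using coupling_scale_shift[OF wq[unfolded q_def] wq[unfolded q_def] less_imp_le[OF t] less_imp_le[OF t]]
      by (simp add: tq[unfolded q_def])
    have "v \<in> nehari p \<beta>"
      unfolding nehari_def
    proof (intro CollectI allI conjI)
      fix i
      show "v i \<in> D1p p" by (rule vD)
      show "\<not> (AE x in lebesgue. v i x = 0)"
      proof
        assume "AE x in lebesgue. v i x = 0"
        then have "AE x in lebesgue. w i (x + k n i) = 0"
          using t[of i] by (auto simp: v_def)
        from AE_shift[OF this, of "- k n i"] show False using w(2)[of i] by simp
      qed
      have "(\<Sum>j\<in>UNIV. \<beta> i j * coupling p (v j) (v i)) = (\<Sum>j\<in>UNIV. s i * ((if i = j then D i * s i else 0) - C n i j * s j))"
        by (intro sum.cong refl) (auto simp: vc C_def cii D_def)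
      also have "\<dots> = s i * (D i * s i - (\<Sum>j\<in>UNIV. C n i j * s j))"
        by (simp add: sum_distrib_left[symmetric] sum_subtractf)
      also have "\<dots> = s i * (a i * s i powr \<alpha>)" using s(3)[of i] by simp
      also have "\<dots> = s i powr (1 + \<alpha>) * a i" using sp[of i] by (simp add: powr_add)
      finally show "D1p_norm p (v i) powr p = (\<Sum>j\<in>UNIV. \<beta> i j * coupling p (v j) (v i))"
        by (simp add: vD)
    qed
    then have "?I \<le> energy p \<beta> v"
      by (rule cINF_lower[OF bdd])
    also have "\<dots> = \<kappa> * (\<Sum>i\<in>UNIV. s i powr (1 + \<alpha>) * a i)"
      unfolding nehari_energy[OF \<open>v \<in> nehari p \<beta>\<close>] vD by (simp add: \<kappa>_def q_def)
    also have "\<dots> \<le> \<kappa> * (\<Sum>i\<in>UNIV. (s0 i + d) powr (1 + \<alpha>) * a i)"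
    proof (intro mult_left_mono sum_mono mult_right_mono powr_mono2)
      show "0 \<le> 1 + \<alpha>" using p q by (simp add: \<alpha>_def)
    qed (use \<kappa> a s sp in \<open>auto intro: less_imp_le\<close>)
    finally show ?thesis .
  qed
  have "(\<lambda>n. \<kappa> * (\<Sum>i\<in>UNIV. (s0 i + 1 / real (Suc n)) powr (1 + \<alpha>) * a i)) \<longlonglongrightarrow> \<kappa> * (\<Sum>i\<in>UNIV. (s0 i + 0) powr (1 + \<alpha>) * a i)"
    using s0 by (intro tendsto_intros LIMSEQ_Suc[OF lim_1_over_n]) (auto simp: less_imp_neq[symmetric])
  then have le: "?I \<le> \<kappa> * (\<Sum>i\<in>UNIV. (s0 i + 0) powr (1 + \<alpha>) * a i)"
    by (rule LIMSEQ_le_const) (use step in auto)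
  have "(s0 i + 0) powr (1 + \<alpha>) = (a i / (\<beta> i i * coupling p (w i) (w i))) powr (p / (q - p))" for i
  proof -
    \<comment> \<open>Here 1 - \<alpha> = 2 (q - p) / q and 1 + \<alpha> = 2 p / q.\<close>
    have "1 / (1 - \<alpha>) * (1 + \<alpha>) = p / (q - p)" using p pq q by (simp add: \<alpha>_def field_simps)
    then show ?thesis using a[of i] D[of i] by (simp add: s0_def powr_powr D_def b_def)
  qed
  with le show ?thesis by (simp only: \<kappa>_def) (simp add: a_def)
qed

text \<open>Repulsion gives A i <= \<beta> i i * B i, so rescaling a component on its own never
  raises its energy. Minimality forces equality for every i, and then no coupling is left. In the
  second part a dominating w has self-coupling at least B i, so a smaller norm would yield a smaller
  rescaled energy.\<close>

lemma least_energy_consequences: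
  fixes u :: "'l::finite \<Rightarrow> real^'n::finite \<Rightarrow> real" and \<beta> :: "'l \<Rightarrow> 'l \<Rightarrow> real"
  assumes p: "0 < p" "p < real CARD('n)"
    and \<beta>: "\<And>i. \<beta> i i > 0" "\<And>i j. i \<noteq> j \<Longrightarrow> \<beta> i j < 0"
    and u: "least_energy_fully_nontrivial_solution p \<beta> u"
  shows "i \<noteq> j \<Longrightarrow> coupling p (u j) (u i) = 0"
    and "w \<in> D1p p \<Longrightarrow> (\<And>x. \<bar>u i x\<bar> \<le> \<bar>w x\<bar>) \<Longrightarrow> D1p_norm p (u i) powr p \<le> D1p_norm p w powr p"
proof -
  define q where "q = critical_exponent CARD('n) p"
  have pq: "p < q" unfolding q_def by (rule critical_exponent_gt[OF p])
  then have q: "q > 0" using p by simp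
  define \<theta> where "\<theta> = p / (q - p)"
  have \<theta>: "\<theta> > 0" using p pq by (simp add: \<theta>_def)
  define \<kappa> where "\<kappa> = 1 / p - 1 / q"
  have \<kappa>: "\<kappa> > 0" using p pq by (simp add: \<kappa>_def frac_less2)
  have uN: "u \<in> nehari p \<beta>" and uI: "energy p \<beta> u = (INF v\<in>(nehari p \<beta> :: ('l \<Rightarrow> real^'n \<Rightarrow> real) set). energy p \<beta> v)"
    using u by (auto simp: least_energy_fully_nontrivial_solution_def)
  have uD: "u i \<in> D1p p" "\<not> (AE x in lebesgue. u i x = 0)"
    "D1p_norm p (u i) powr p = (\<Sum>j\<in>UNIV. \<beta> i j * coupling p (u j) (u i))" for i
    using uN by (auto simp: nehari_def)
  define A where "A i = D1p_norm p (u i) powr p" for i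
  define B where "B i = coupling p (u i) (u i)" for i
  have uq: "u i \<in> Lp q" for i using uD(1)[of i] by (simp add: D1p_def q_def)
  have A: "A i > 0" for i unfolding A_def by (rule D1p_norm_pos[OF uD(1) p(1) uD(2)])
  have B: "B i > 0" for i unfolding B_def by (rule coupling_self_pos[OF uq[unfolded q_def] uD(2)])
  \<comment> \<open>Up to the factor \<kappa> this is the energy of w after rescaling to the
    decoupled Nehari equation for index i; for nontrivial w it does not change when w is replaced by
    a nonzero multiple.\<close>
  define m where "m i w = (D1p_norm p w powr p / (\<beta> i i * coupling p w w)) powr \<theta> * D1p_norm p w powr p" for i and w :: "real^'n \<Rightarrow> real"
  have least: "(\<Sum>i\<in>UNIV. A i) \<le> (\<Sum>i\<in>UNIV. m i (w i))"
    if w: "\<And>i. w i \<in> D1p p" "\<And>i. \<not> (AE x in lebesgue. w i x = 0)" for w :: "'l \<Rightarrow> real^'n \<Rightarrow> real"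
  proof -
    have "\<kappa> * (\<Sum>i\<in>UNIV. A i) \<le> \<kappa> * (\<Sum>i\<in>UNIV. m i (w i))"
      using nehari_INF_le[where \<beta> = \<beta> and w = w, OF p \<beta> w] unfolding uI[symmetric] nehari_energy[OF uN]
      by (simp add: \<kappa>_def m_def \<theta>_def A_def q_def)
    then show ?thesis using \<kappa> by simp
  qed
  have split: "A i = \<beta> i i * B i + (\<Sum>j\<in>UNIV - {i}. \<beta> i j * coupling p (u j) (u i))" for i
    unfolding A_def uD(3) B_def by (subst sum.remove[of UNIV i]) auto
  have np: "\<beta> i j * coupling p (u j) (u i) \<le> 0" if "j \<in> UNIV - {i}" for i j
    using that \<beta>(2)[of i j] coupling_nonneg[of p "u j" "u i"] by (intro mult_nonpos_nonneg) (auto intro: less_imp_le)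
  then have AB: "A i \<le> \<beta> i i * B i" for i
    unfolding split[of i] using sum_nonpos[of "UNIV - {i}" "\<lambda>j. \<beta> i j * coupling p (u j) (u i)"] by fastforce
  have \<beta>B: "\<beta> i i * B i > 0" for i using \<beta>(1)[of i] B[of i] by simp
  have mu: "m i (u i) = (A i / (\<beta> i i * B i)) powr \<theta> * A i" for i by (simp add: m_def A_def B_def)
  have mle: "m i (u i) \<le> A i" for i
  proof -
    have "(A i / (\<beta> i i * B i)) powr \<theta> \<le> 1 powr \<theta>" using AB[of i] A[of i] \<beta>B[of i] \<theta> by (intro powr_mono2) auto
    then show ?thesis using A[of i] unfolding mu by (simp add: mult_left_le_one_le)
  qed
  have meq: "m i (u i) = A i" for i
  proof (rule ccontr)
    assume "m i (u i) \<noteq> A i"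
    then have "(\<Sum>i\<in>UNIV. m i (u i)) < (\<Sum>i\<in>UNIV. A i)"
      using mle by (intro sum_strict_mono_ex1) (auto intro!: bexI[of _ i] simp: order.strict_iff_order)
    then show False using least[of u, OF uD(1,2)] by simp
  qed
  have ABeq: "A i = \<beta> i i * B i" for i
  proof (rule ccontr)
    assume "A i \<noteq> \<beta> i i * B i"
    then have "A i / (\<beta> i i * B i) < 1" using AB[of i] \<beta>B[of i] by simp
    then have "(A i / (\<beta> i i * B i)) powr \<theta> < 1 powr \<theta>" using A[of i] \<beta>B[of i] \<theta> by (intro powr_less_mono2) auto
    then have "m i (u i) < A i" using A[of i] unfolding mu by simp
    then show False using meq[of i] by simp
  qed
  show "coupling p (u j) (u i) = 0" if ij: "i \<noteq> j" for i j
  proof -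
    have "(\<Sum>j\<in>UNIV - {i}. - (\<beta> i j * coupling p (u j) (u i))) = 0" using split[of i] ABeq[of i] by (simp add: sum_negf)
    then have "- (\<beta> i j * coupling p (u j) (u i)) = 0"
      using np ij by (subst (asm) sum_nonneg_eq_0_iff) auto
    then show ?thesis using \<beta>(2)[OF ij] by simp
  qed
  show "D1p_norm p (u i) powr p \<le> D1p_norm p w powr p" if w: "w \<in> D1p p" "\<And>x. \<bar>u i x\<bar> \<le> \<bar>w x\<bar>" for i w
  proof (rule ccontr)
    assume "\<not> ?thesis"
    then have lt: "D1p_norm p w powr p < A i" by (simp add: A_def)
    have wz: "\<not> (AE x in lebesgue. w x = 0)"
    proof
      assume "AE x in lebesgue. w x = 0"
      then have "AE x in lebesgue. u i x = 0"
      proof eventually_elim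
        case (elim x)
        then show ?case using w(2)[of x] by simp
      qed
      then show False using uD(2) by simp
    qed
    have wq: "w \<in> Lp q" using w(1) by (simp add: D1p_def q_def)
    have "B i \<le> coupling p w w"
      unfolding B_def coupling_def q_def[symmetric]
      using w(2) q by (intro integral_mono coupling_integrable uq wq mult_mono powr_mono2) auto
    define a where "a = D1p_norm p w powr p"
    have a: "a > 0" unfolding a_def by (rule D1p_norm_pos[OF w(1) p(1) wz])
    have "a / (\<beta> i i * coupling p w w) \<le> a / (\<beta> i i * B i)"
      using \<open>B i \<le> coupling p w w\<close> a B[of i] \<beta>(1)[of i] by (intro divide_left_mono mult_left_mono mult_pos_pos) auto
    also have "\<dots> \<le> 1" using lt ABeq[of i] \<beta>B[of i] by (simp add: a_def)
    finally have "(a / (\<beta> i i * coupling p w w)) powr \<theta> \<le> 1 powr \<theta>"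
      using a \<theta> \<beta>(1)[of i] coupling_nonneg[of p w w] by (intro powr_mono2) (auto intro!: divide_nonneg_nonneg mult_nonneg_nonneg intro: less_imp_le)
    then have "m i w \<le> a" using a unfolding m_def a_def[symmetric] by (simp add: mult_left_le_one_le)
    then have mw: "m i w < A i" using lt by (simp add: a_def)
    \<comment> \<open>The other components contribute exactly A k, so the strict gain at index i
      survives in the sum.\<close>
    have "(\<Sum>k\<in>UNIV. m k ((u(i := w)) k)) < (\<Sum>k\<in>UNIV. A k)"
      using mw meq by (intro sum_strict_mono_ex1) (auto intro!: bexI[of _ i] intro: less_imp_le)
    moreover have "(\<Sum>k\<in>UNIV. A k) \<le> (\<Sum>k\<in>UNIV. m k ((u(i := w)) k))"
      using uD w(1) wz by (intro least) (auto simp: fun_upd_def)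
    ultimately show False by simp
  qed
qed

section \<open>Positivity of minimizers\<close>

lemma integrable_gaussian_1d:
  assumes "c > 0" shows "integrable lborel (\<lambda>t::real. exp (- c * t\<^sup>2))"
proof -
  define F where "F t = indicator {0..} t * exp (- c * t)" for t :: real
  have "(\<lambda>t. exp (- c * t)) absolutely_integrable_on {0..}"
    using has_integral_exp_minus_to_infinity[OF assms, of 0]
    by (intro nonnegative_absolutely_integrable_1) auto
  then have "integrable lebesgue F" by (simp add: set_integrable_def F_def[abs_def])
  moreover have [measurable]: "F \<in> borel_measurable borel" unfolding F_def by measurable
  ultimately have iF: "integrable lborel F" by (simp add: integrable_completion)
  have "integrable lborel (\<lambda>t. exp c * (F t + F (0 + (-1) * t)))"
    using iF lborel_integrable_real_affine[OF iF, of "-1" 0] by (intro integrable_mult_right Bochner_Integration.integrable_add) auto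
  then show ?thesis
  proof (rule Bochner_Integration.integrable_bound)
    show "AE t in lborel. norm (exp (- c * t\<^sup>2)) \<le> norm (exp c * (F t + F (0 + - 1 * t)))"
    proof (rule AE_I2)
      fix t :: real
      \<comment> \<open>This yields exp(-c t^2) <= exp(c) exp(-c |t|); \<open>F\<close> and its
        reflection cover the two half-lines.\<close>
      have "\<bar>t\<bar> \<le> 1 + t\<^sup>2"
        using sum_squares_bound[of 1 "\<bar>t\<bar>"] by (simp add: power2_abs)
      then have "c * \<bar>t\<bar> \<le> c * (1 + t\<^sup>2)" using assms by (intro mult_left_mono) auto
      then have "exp (- c * t\<^sup>2) \<le> exp (c + - c * \<bar>t\<bar>)" by (simp add: algebra_simps)
      also have "\<dots> = exp c * exp (- c * \<bar>t\<bar>)" by (rule exp_add)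
      also have "\<dots> \<le> exp c * (F t + F (0 + - 1 * t))" by (auto simp: F_def indicator_def abs_if)
      finally show "norm (exp (- c * t\<^sup>2)) \<le> norm (exp c * (F t + F (0 + - 1 * t)))"
        by (auto simp: F_def)
    qed
  qed measurable
qed

lemma integrable_gaussian:
  assumes "c > 0" shows "integrable lebesgue (\<lambda>x::'a::euclidean_space. exp (- c * (x \<bullet> x)))"
proof -
  have m: "(\<lambda>x::'a. exp (- c * (x \<bullet> x))) \<in> borel_measurable borel" by measurable
  have "integrable lborel (\<lambda>x::'a. exp (- c * (x \<bullet> x)))"
  proof (rule integrableI_nonneg)
    have eq: "ennreal (exp (- c * (x \<bullet> x))) = (\<Prod>b\<in>Basis. ennreal (exp (- c * (x \<bullet> b)\<^sup>2)))" for x :: 'a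
    proof -
      have "- c * (x \<bullet> x) = (\<Sum>b\<in>Basis. - c * (x \<bullet> b)\<^sup>2)"
        by (simp add: euclidean_inner[of x x] sum_distrib_left sum_negf power2_eq_square)
      then show ?thesis by (simp only: exp_sum[OF finite_Basis]) (simp add: prod_ennreal)
    qed
    have fin: "(\<integral>\<^sup>+t. ennreal (exp (- c * t\<^sup>2)) \<partial>(lborel::real measure)) < \<infinity>"
      using integrable_gaussian_1d[OF assms] by (simp add: integrable_iff_bounded)
    have "(\<integral>\<^sup>+x. ennreal (exp (- c * (x \<bullet> x))) \<partial>(lborel::'a measure)) =
       (\<Prod>b\<in>(Basis::'a set). \<integral>\<^sup>+t. ennreal (exp (- c * t\<^sup>2)) \<partial>(lborel::real measure))"
      unfolding eq by (rule nn_integral_lborel_prod) auto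
    also have "\<dots> < \<infinity>" using fin by (simp add: power_less_top_ennreal)
    finally show "(\<integral>\<^sup>+x. ennreal (exp (- c * (x \<bullet> x))) \<partial>(lborel::'a measure)) < \<infinity>" .
  qed (use m in auto)
  then show ?thesis using m by (simp add: integrable_completion)
qed

text \<open>The weight \<eta> of the competitor: positive, together with its gradient in every L^q
  with q > 0, and with a smooth reciprocal. The product rule for smooth factors therefore covers
  both the division u / \<eta> and the multiplication back by \<eta>.\<close>

definition gauss :: "real^'n::finite \<Rightarrow> real" where "gauss x = exp (- (x \<bullet> x))"

lemma gauss_pos: "gauss x > 0" by (simp add: gauss_def)

lemma smooth_inner_self: "smooth (\<lambda>x::real^'n::finite. x \<bullet> x)"
  unfolding inner_vec_def inner_real_def by (intro smooth_sum smooth_mult smooth_component)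

lemma partial_deriv_inner_self: "partial_deriv i (\<lambda>x::real^'n::finite. x \<bullet> x) x = 2 * x $ i"
proof -
  have "((\<lambda>x::real^'n. x \<bullet> x) has_derivative (\<lambda>h. x \<bullet> h + h \<bullet> x)) (at x)"
    by (auto intro!: derivative_eq_intros)
  from partial_deriv_eq[OF this] show ?thesis
    by (simp add: inner_axis inner_axis' inner_commute)
qed

lemma smooth_gauss: "smooth gauss"
proof -
  have "smooth (\<lambda>x::real^'n. exp ((- 1) * (x \<bullet> x)))"
    by (intro smooth_exp smooth_mult smooth_const smooth_inner_self)
  then show ?thesis by (simp add: gauss_def[abs_def])
qed

lemma partial_deriv_gauss:
  fixes x :: "real^'n::finite"
  shows "partial_deriv i gauss x = - 2 * x $ i * gauss x"
proof -
  have d: "(\<lambda>x::real^'n. x \<bullet> x) differentiable (at x)" by (rule smooth_differentiable[OF smooth_inner_self])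
  have "partial_deriv i (\<lambda>x. (- 1) * (x \<bullet> x)) x = - 1 * partial_deriv i (\<lambda>x. x \<bullet> x) x + partial_deriv i (\<lambda>x::real^'n. - 1) x * (x \<bullet> x)"
    by (rule partial_deriv_mult) (simp_all add: d)
  then have e: "partial_deriv i (\<lambda>x. - (x \<bullet> x)) x = - 2 * x $ i"
    by (simp add: partial_deriv_inner_self partial_deriv_const)
  have "(\<lambda>x::real^'n. - (x \<bullet> x)) differentiable (at x)" using d by simp
  from partial_deriv_exp[OF this, of i] show ?thesis by (simp add: gauss_def[abs_def] e)
qed

lemma smooth_inverse_gauss: "smooth (\<lambda>x::real^'n::finite. 1 / gauss x)"
  using smooth_exp[OF smooth_inner_self] by (simp add: gauss_def exp_minus divide_inverse)

lemma partial_deriv_inverse_gauss: "partial_deriv i (\<lambda>x. 1 / gauss x) x = 2 * x $ i / gauss x"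
  using partial_deriv_exp[OF smooth_differentiable[OF smooth_inner_self], of i x]
  by (simp add: gauss_def exp_minus divide_inverse partial_deriv_inner_self mult_ac)

lemma gauss_Lp:
  assumes "q > 0" shows "(gauss :: real^'n::finite \<Rightarrow> real) \<in> Lp q"
proof -
  have "\<bar>gauss x\<bar> powr q = exp (- q * (x \<bullet> x))" for x :: "real^'n"
    by (simp add: gauss_def powr_def)
  then show ?thesis
    using integrable_gaussian[OF assms, where 'a = "real^'n"] measurable_smooth[OF smooth_gauss] by (simp add: Lp_def)
qed

lemma partial_deriv_gauss_Lp:
  assumes "q > 0" shows "(\<lambda>x::real^'n::finite. - 2 * x $ i * gauss x) \<in> Lp q"
proof -
  have m: "(\<lambda>x::real^'n. - 2 * x $ i * gauss x) \<in> borel_measurable lebesgue"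
    using measurable_smooth[OF smooth_partial_deriv[OF smooth_gauss]]
    by (simp add: partial_deriv_gauss[abs_def])
  define h where "h x = 2 * exp (- (1/2) * (x \<bullet> x))" for x :: "real^'n"
  have "\<bar>h x\<bar> powr q = 2 powr q * exp (- (q / 2) * (x \<bullet> x))" for x
    by (simp add: h_def powr_mult abs_mult) (simp add: powr_def)
  moreover have "h \<in> borel_measurable lebesgue"
    unfolding h_def[abs_def] by (intro measurable_completion) measurable
  ultimately have h: "h \<in> Lp q" using integrable_gaussian[of "q / 2"] assms by (simp add: Lp_def)
  \<comment> \<open>Half of the Gaussian decay pays for the linear factor: |x_i| <= 1 + |x|^2 / 2 <=
    exp(|x|^2 / 2).\<close>
  have "\<bar>- 2 * x $ i * gauss x\<bar> \<le> \<bar>h x\<bar>" for x :: "real^'n"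
  proof -
    have "\<bar>x $ i\<bar> \<le> norm x" by (rule component_le_norm_cart)
    also have "norm x \<le> 1 + 1/2 * (x \<bullet> x)"
      using sum_squares_bound[of 1 "norm x"] by (simp add: power2_norm_eq_inner)
    also have "\<dots> \<le> exp (1/2 * (x \<bullet> x))" by (rule exp_ge_add_one_self)
    finally have "\<bar>x $ i\<bar> * gauss x \<le> exp (1/2 * (x \<bullet> x)) * gauss x"
      using gauss_pos[of x] by (intro mult_right_mono) auto
    also have "\<dots> = exp (- (1/2) * (x \<bullet> x))" by (simp add: gauss_def flip: exp_add)
    finally show ?thesis using gauss_pos[of x] by (simp add: h_def abs_mult)
  qed
  then show ?thesis using assms by (intro Lp_bound[OF h m]) auto
qed

section \<open>The competitor and the logarithmic estimate\<close>

lemma powr_convex_combination: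
  fixes x y p c :: real
  assumes "p \<ge> 1" "0 \<le> x" "0 \<le> y" "0 \<le> c" "c \<le> 1"
  shows "((1 - c) * x + c * y) powr p \<le> (1 - c) * x powr p + c * y powr p"
proof -
  \<comment> \<open>At a vanishing endpoint the claim reduces to this inequality; for positive
    endpoints it is the convexity of the power.\<close>
  have le: "l powr p \<le> l" if "0 \<le> l" "l \<le> 1" for l :: real
    using powr_mono'[of 1 p l] that assms(1) by simp
  consider "x = 0" | "y = 0" | "x > 0" "y > 0" using assms by linarith
  then show ?thesis
  proof cases
    case 1
    then show ?thesis using assms le[of c] by (simp add: powr_mult mult_right_mono)
  next
    case 2
    then show ?thesis using assms le[of "1 - c"] by (simp add: powr_mult mult_right_mono)
  next
    case 3
    then show ?thesis
      using convex_onD[OF powr_convex[OF assms(1)], of c x y] assms by simp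
  qed
qed

text \<open>The coefficient \<open>\<epsilon> / (p - 1)\<close> is the one for which the corner of \<open>\<bar>s\<bar>\<close> at \<open>0\<close> disappears, so that
  the chain rule applies without passing to \<open>\<bar>u\<bar>\<close> first.\<close>

definition lifted_abs :: "real \<Rightarrow> real \<Rightarrow> real \<Rightarrow> real" where
  "lifted_abs p \<epsilon> s = \<bar>s\<bar> + \<epsilon> / (p - 1) * (\<epsilon> / (\<bar>s\<bar> + \<epsilon>)) powr (p - 1)"

definition lifted_abs' :: "real \<Rightarrow> real \<Rightarrow> real \<Rightarrow> real" where
  "lifted_abs' p \<epsilon> s = sgn s * (1 - (\<epsilon> / (\<bar>s\<bar> + \<epsilon>)) powr p)"

lemma lifted_abs_deriv:
  assumes p: "p > 1" and e: "\<epsilon> > 0"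
  shows "(lifted_abs p \<epsilon> has_field_derivative lifted_abs' p \<epsilon> s) (at s)"
proof -
  define R where "R s = s + \<epsilon> / (p - 1) * (\<epsilon> / (s + \<epsilon>)) powr (p - 1)" for s
  have R: "(R has_field_derivative (1 - (\<epsilon> / (s + \<epsilon>)) powr p)) (at s)" if "s \<ge> 0" for s
  proof -
    have s: "s + \<epsilon> > 0" using that e by simp
    have "((\<lambda>s. \<epsilon> / (s + \<epsilon>)) has_field_derivative - (\<epsilon> / (s + \<epsilon>)\<^sup>2)) (at s)"
      using s by (auto intro!: derivative_eq_intros simp: power2_eq_square)
    then have "((\<lambda>s. (\<epsilon> / (s + \<epsilon>)) powr (p - 1)) has_field_derivative
       (p - 1) * (\<epsilon> / (s + \<epsilon>)) powr (p - 1 - 1) * - (\<epsilon> / (s + \<epsilon>)\<^sup>2)) (at s)"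
      using DERIV_fun_powr[of "\<lambda>s. \<epsilon> / (s + \<epsilon>)" "- (\<epsilon> / (s + \<epsilon>)\<^sup>2)" s "p - 1"] s e by simp
    then have "(R has_field_derivative 1 + \<epsilon> / (p - 1) * ((p - 1) * (\<epsilon> / (s + \<epsilon>)) powr (p - 1 - 1) * - (\<epsilon> / (s + \<epsilon>)\<^sup>2))) (at s)"
      unfolding R_def[abs_def] by (intro DERIV_add DERIV_ident DERIV_cmult)
    moreover have "1 + \<epsilon> / (p - 1) * ((p - 1) * (\<epsilon> / (s + \<epsilon>)) powr (p - 1 - 1) * - (\<epsilon> / (s + \<epsilon>)\<^sup>2)) =
       1 - (\<epsilon> / (s + \<epsilon>)) powr (p - 2) * (\<epsilon> / (s + \<epsilon>)) powr 2"
      using p e s by (simp add: powr_numeral power_divide power2_eq_square)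
    moreover have "(\<epsilon> / (s + \<epsilon>)) powr (p - 2) * (\<epsilon> / (s + \<epsilon>)) powr 2 = (\<epsilon> / (s + \<epsilon>)) powr p"
      by (simp flip: powr_add)
    ultimately show ?thesis by simp
  qed
  have L: "lifted_abs p \<epsilon> = (\<lambda>s. R \<bar>s\<bar>)" by (simp add: lifted_abs_def R_def fun_eq_iff)
  consider "s > 0" | "s < 0" | "s = 0" by linarith
  then show ?thesis
  proof cases
    case 1
    have "\<forall>\<^sub>F x in nhds s. lifted_abs p \<epsilon> x = R x"
      using 1 by (auto simp: L eventually_nhds intro!: exI[of _ "{0<..}"])
    then show ?thesis using R[of s] 1 by (subst DERIV_cong_ev[OF refl _ refl]) (auto simp: lifted_abs'_def)
  next
    case 2
    have "\<forall>\<^sub>F x in nhds s. lifted_abs p \<epsilon> x = R (- x)"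
      using 2 by (auto simp: L eventually_nhds intro!: exI[of _ "{..<0}"])
    moreover have "((\<lambda>x. R (- x)) has_field_derivative (1 - (\<epsilon> / (- s + \<epsilon>)) powr p) * - 1) (at s)"
      using R[of "- s"] 2 by (intro DERIV_chain2[of R]) (auto intro!: derivative_eq_intros)
    ultimately show ?thesis using 2 by (subst DERIV_cong_ev[OF refl _ refl]) (auto simp: lifted_abs'_def)
  next
    case 3
    \<comment> \<open>\<open>R\<close> has slope 0 at 0, so replacing h by |h| changes at most the
      sign of difference quotients that tend to 0 anyway.\<close>
    have "((\<lambda>h. (R (0 + h) - R 0) / h) \<longlongrightarrow> 0) (at 0)" using R[of 0] e by (simp add: DERIV_def)
    moreover have "filterlim (\<lambda>h::real. \<bar>h\<bar>) (at 0) (at 0)"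
      by (auto simp: filterlim_at eventually_at_filter intro!: tendsto_eq_intros)
    ultimately have "((\<lambda>h. (R (0 + \<bar>h\<bar>) - R 0) / \<bar>h\<bar>) \<longlongrightarrow> 0) (at 0)" by (rule filterlim_compose)
    then have "((\<lambda>h. (lifted_abs p \<epsilon> (0 + h) - lifted_abs p \<epsilon> 0) / h) \<longlongrightarrow> 0) (at 0)"
      by (subst tendsto_rabs_zero_iff[symmetric]) (simp add: L abs_divide tendsto_rabs_zero_iff[where f = "\<lambda>h. (R \<bar>h\<bar> - R 0) / \<bar>h\<bar>", symmetric])
    then show ?thesis using 3 by (simp add: DERIV_def lifted_abs'_def)
  qed
qed

text \<open>With v = u / \<eta>, the gradient of \<eta> \<Psi>(v) is \<Psi>'(v) grad u + (\<Psi>(v)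
  - v \<Psi>'(v)) grad \<eta>. The bounds by 1 - \<rho>^p and by \<rho>^p times a remainder make its
  norm at most a convex combination. The upper bounds for \<Psi> and for \<Psi>(s) - s \<Psi>'(s) in
  terms of \<epsilon> alone serve to place the competitor in \<open>D1p\<close>.\<close>

lemma lifted_abs_properties:
  fixes p \<epsilon> s :: real
  assumes p: "p > 1" and e: "\<epsilon> > 0"
  defines "\<rho> \<equiv> \<epsilon> / (\<bar>s\<bar> + \<epsilon>)"
  shows "0 < \<rho>" "\<rho> \<le> 1" "\<bar>lifted_abs' p \<epsilon> s\<bar> \<le> 1 - \<rho> powr p" "\<bar>s\<bar> \<le> lifted_abs p \<epsilon> s" "lifted_abs p \<epsilon> s \<le> \<bar>s\<bar> + \<epsilon> / (p - 1)"
    and "0 \<le> lifted_abs p \<epsilon> s - s * lifted_abs' p \<epsilon> s" "lifted_abs p \<epsilon> s - s * lifted_abs' p \<epsilon> s \<le> \<rho> powr p * (p / (p - 1) * (\<epsilon> / \<rho>))"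
    and "lifted_abs p \<epsilon> s - s * lifted_abs' p \<epsilon> s \<le> p / (p - 1) * \<epsilon>"
proof -
  show \<rho>: "0 < \<rho>" "\<rho> \<le> 1" using e by (auto simp: \<rho>_def divide_le_eq)
  have l1: "\<rho> powr p \<le> 1" "\<rho> powr (p - 1) \<le> 1" using \<rho> p by (auto intro!: powr_le1)
  show "\<bar>lifted_abs' p \<epsilon> s\<bar> \<le> 1 - \<rho> powr p"
    using l1 by (simp add: lifted_abs'_def abs_mult \<rho>_def[symmetric] abs_sgn_eq)
  show "\<bar>s\<bar> \<le> lifted_abs p \<epsilon> s" using p e by (simp add: lifted_abs_def)
  have "\<epsilon> / (p - 1) * \<rho> powr (p - 1) \<le> \<epsilon> / (p - 1)" using l1 p e by (intro mult_left_le) auto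
  then show "lifted_abs p \<epsilon> s \<le> \<bar>s\<bar> + \<epsilon> / (p - 1)" by (simp add: lifted_abs_def \<rho>_def)
  have eq: "lifted_abs p \<epsilon> s - s * lifted_abs' p \<epsilon> s = \<bar>s\<bar> * \<rho> powr p + \<epsilon> / (p - 1) * \<rho> powr (p - 1)"
  proof -
    have "s * sgn s = \<bar>s\<bar>" by (simp add: sgn_if abs_if)
    then show ?thesis by (simp add: lifted_abs_def lifted_abs'_def \<rho>_def[symmetric] right_diff_distrib mult.assoc[symmetric])
  qed
  show "0 \<le> lifted_abs p \<epsilon> s - s * lifted_abs' p \<epsilon> s" unfolding eq using p e by simp
  have pm: "\<rho> powr (p - 1) = \<rho> powr p / \<rho>" using \<rho> by (simp add: powr_diff)
  have "\<bar>s\<bar> \<le> \<epsilon> / \<rho>" using e by (simp add: \<rho>_def)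
  then have "\<bar>s\<bar> * \<rho> powr p \<le> \<epsilon> / \<rho> * \<rho> powr p" by (intro mult_right_mono) auto
  then have "lifted_abs p \<epsilon> s - s * lifted_abs' p \<epsilon> s \<le> \<epsilon> / \<rho> * \<rho> powr p + \<epsilon> / (p - 1) * (\<rho> powr p / \<rho>)"
    unfolding eq pm by simp
  also have "\<dots> = \<rho> powr p * (p / (p - 1) * (\<epsilon> / \<rho>))" using p \<rho> by (simp add: field_simps)
  finally show le: "lifted_abs p \<epsilon> s - s * lifted_abs' p \<epsilon> s \<le> \<rho> powr p * (p / (p - 1) * (\<epsilon> / \<rho>))" .
  also have "\<dots> = p / (p - 1) * \<epsilon> * \<rho> powr (p - 1)" unfolding pm by simp
  also have "\<dots> \<le> p / (p - 1) * \<epsilon>" using l1 p e by (intro mult_left_le) auto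
  finally show "lifted_abs p \<epsilon> s - s * lifted_abs' p \<epsilon> s \<le> p / (p - 1) * \<epsilon>" .
qed

lemma lifted_abs'_measurable: "lifted_abs' p \<epsilon> \<in> borel_measurable borel"
  unfolding lifted_abs'_def[abs_def] sgn_if by measurable

text \<open>An estimate of Caccioppoli type. The gradient of the competitor has norm at most (1 - l)
  |g| + l Y with l = \<rho>^p, and convexity bounds its p-th power by (1 - l) |g|^p + l Y^p.
  Comparison with the norm of u leaves the integral of l |g|^p below that of l Y^p, which is a
  constant times \<epsilon>^p |grad \<eta>|^p. Division by \<epsilon>^p then controls |g|^p / (|u /
  \<eta>| + \<epsilon>)^p independently of \<epsilon>.\<close>

lemma log_estimate:
  fixes u :: "real^'n::finite \<Rightarrow> real" and g :: "real^'n \<Rightarrow> real^'n"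
  assumes p: "1 < p" "p < real CARD('n)" and e: "\<epsilon> > 0"
    and u: "u \<in> Lp (critical_exponent CARD('n) p)" and g: "\<And>i. weak_partial i u (\<lambda>x. g x $ i)" "\<And>i. (\<lambda>x. g x $ i) \<in> Lp p"
    and min: "\<And>w. w \<in> D1p p \<Longrightarrow> (\<And>x. \<bar>u x\<bar> \<le> \<bar>w x\<bar>) \<Longrightarrow> D1p_norm p u powr p \<le> D1p_norm p w powr p"
  defines "\<rho> \<equiv> \<lambda>x. \<epsilon> / (\<bar>u x / gauss x\<bar> + \<epsilon>)"
  shows "integrable lebesgue (\<lambda>x. \<rho> x powr p * norm (g x) powr p)"
    and "(LINT x|lebesgue. \<rho> x powr p * norm (g x) powr p) \<le> (p / (p - 1)) powr p * \<epsilon> powr p *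
      (LINT x|lebesgue. norm (\<chi> i. - 2 * x $ i * gauss x :: real^'n) powr p)"
proof -
  define h :: "real^'n \<Rightarrow> real^'n" where "h x = (\<chi> i. - 2 * x $ i * gauss x)" for x
  define v where "v x = u x * (1 / gauss x)" for x
  define d where "d x = lifted_abs p \<epsilon> (v x) - v x * lifted_abs' p \<epsilon> (v x)" for x
  define w where "w x = lifted_abs p \<epsilon> (v x) * gauss x" for x
  define gw where "gw x = lifted_abs' p \<epsilon> (v x) *\<^sub>R g x + d x *\<^sub>R h x" for x
  note lp = lifted_abs_properties[OF p(1) e]
  have \<rho>: "\<rho> x = \<epsilon> / (\<bar>v x\<bar> + \<epsilon>)" for x by (simp add: \<rho>_def v_def)
  have l0: "\<bar>lifted_abs' p \<epsilon> s\<bar> \<le> 1" for s using lp(3)[of s] by (smt (verit) powr_ge_zero)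
  have wv: "weak_partial i v (\<lambda>x. g x $ i * (1 / gauss x) + u x * (2 * x $ i / gauss x))" for i
    using weak_partial_mult_smooth[OF g(1) smooth_inverse_gauss, of i]
    by (simp add: v_def[abs_def] partial_deriv_inverse_gauss)
  have ww: "weak_partial i w (\<lambda>x. gw x $ i)" for i
  proof -
    have "weak_partial i w (\<lambda>x. lifted_abs' p \<epsilon> (v x) * (g x $ i * (1 / gauss x) + u x * (2 * x $ i / gauss x)) * gauss x
       + lifted_abs p \<epsilon> (v x) * (- 2 * x $ i * gauss x))"
      using weak_partial_mult_smooth[OF weak_partial_chain[OF wv lifted_abs_deriv[OF p(1) e] l0 lifted_abs'_measurable] smooth_gauss, of i]
      by (simp add: w_def[abs_def] partial_deriv_gauss)
    \<comment> \<open>The term in which the derivative falls on 1 / gauss becomes - v * lifted_abs'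
      times the derivative of gauss, and completes the factor \<open>d x\<close>.\<close>
    moreover have "lifted_abs' p \<epsilon> (v x) * (g x $ i * (1 / gauss x) + u x * (2 * x $ i / gauss x)) * gauss x
       + lifted_abs p \<epsilon> (v x) * (- 2 * x $ i * gauss x) = gw x $ i" for x
    proof -
      have ux: "u x = v x * gauss x" using gauss_pos[of x] by (simp add: v_def)
      have "g x $ i * (1 / gauss x) + u x * (2 * x $ i / gauss x) = (g x $ i + 2 * x $ i * u x) / gauss x"
        by (simp add: add_divide_distrib mult_ac)
      then have "lifted_abs' p \<epsilon> (v x) * (g x $ i * (1 / gauss x) + u x * (2 * x $ i / gauss x)) * gauss x = lifted_abs' p \<epsilon> (v x) * (g x $ i + 2 * x $ i * (v x * gauss x))"
        using gauss_pos[of x] by (simp add: ux[symmetric])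
      then show ?thesis by (simp add: gw_def d_def h_def algebra_simps)
    qed
    ultimately show ?thesis by simp
  qed
  have hL: "(\<lambda>x. h x $ i) \<in> Lp p" for i using partial_deriv_gauss_Lp[of p i] p by (simp add: h_def)
  have d: "0 \<le> d x" "d x \<le> p / (p - 1) * \<epsilon>" for x using lp(6,8)[of "v x"] by (auto simp: d_def)
  have gwL: "(\<lambda>x. gw x $ i) \<in> Lp p" for i
  proof (rule Lp_bound)
    show "(\<lambda>x. \<bar>g x $ i\<bar> + p / (p - 1) * \<epsilon> * \<bar>h x $ i\<bar>) \<in> Lp p"
    proof (intro Lp_add Lp_cmult)
      show "(\<lambda>x. \<bar>g x $ i\<bar>) \<in> Lp p" "(\<lambda>x. \<bar>h x $ i\<bar>) \<in> Lp p"
        using g(2)[of i] hL[of i] by (auto simp: Lp_def)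
    qed (use p in auto)
    show "(\<lambda>x. gw x $ i) \<in> borel_measurable lebesgue"
      using ww by (auto intro: locally_integrable_measurable simp: weak_partial_def)
    show "AE x in lebesgue. \<bar>gw x $ i\<bar> \<le> \<bar>\<bar>g x $ i\<bar> + p / (p - 1) * \<epsilon> * \<bar>h x $ i\<bar>\<bar>"
    proof (rule AE_I2)
      fix x
      have "\<bar>gw x $ i\<bar> \<le> \<bar>lifted_abs' p \<epsilon> (v x) * g x $ i\<bar> + \<bar>d x * h x $ i\<bar>" by (simp add: gw_def abs_triangle_ineq)
      also have "\<dots> \<le> 1 * \<bar>g x $ i\<bar> + p / (p - 1) * \<epsilon> * \<bar>h x $ i\<bar>"
        unfolding abs_mult using l0 d[of x] by (intro add_mono mult_right_mono) auto
      finally show "\<bar>gw x $ i\<bar> \<le> \<bar>\<bar>g x $ i\<bar> + p / (p - 1) * \<epsilon> * \<bar>h x $ i\<bar>\<bar>" by simp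
    qed
  qed (use p in auto)
  have q: "critical_exponent CARD('n) p > 0" using critical_exponent_gt[of p "CARD('n)"] p by simp
  have wq: "w \<in> Lp (critical_exponent CARD('n) p)"
  proof (rule Lp_bound)
    \<comment> \<open>The competitor exceeds |u| by at most a multiple of the Gaussian, which keeps
      it in the critical Lebesgue space.\<close>
    show "(\<lambda>x. \<bar>u x\<bar> + \<epsilon> / (p - 1) * gauss x) \<in> Lp (critical_exponent CARD('n) p)"
    proof (intro Lp_add Lp_cmult gauss_Lp q)
      show "(\<lambda>x. \<bar>u x\<bar>) \<in> Lp (critical_exponent CARD('n) p)" using u by (auto simp: Lp_def)
    qed (use q in auto)
    show "w \<in> borel_measurable lebesgue"
      using ww by (auto intro: locally_integrable_measurable simp: weak_partial_def)
    show "AE x in lebesgue. \<bar>w x\<bar> \<le> \<bar>\<bar>u x\<bar> + \<epsilon> / (p - 1) * gauss x\<bar>"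
    proof (rule AE_I2)
      fix x
      have "0 \<le> lifted_abs p \<epsilon> (v x)" using lp(4)[of "v x"] by linarith
      then have "\<bar>w x\<bar> = lifted_abs p \<epsilon> (v x) * gauss x" using gauss_pos[of x] by (simp add: w_def)
      also have "\<dots> \<le> (\<bar>v x\<bar> + \<epsilon> / (p - 1)) * gauss x"
        using lp(5)[of "v x"] gauss_pos[of x] by (intro mult_right_mono) auto
      also have "\<dots> = \<bar>u x\<bar> + \<epsilon> / (p - 1) * gauss x"
        using gauss_pos[of x] by (simp add: v_def algebra_simps abs_divide)
      finally show "\<bar>w x\<bar> \<le> \<bar>\<bar>u x\<bar> + \<epsilon> / (p - 1) * gauss x\<bar>" by simp
    qed
  qed (use q in auto)
  have uw: "\<bar>u x\<bar> \<le> \<bar>w x\<bar>" for x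
  proof -
    have "\<bar>u x\<bar> = \<bar>v x\<bar> * gauss x" using gauss_pos[of x] by (simp add: v_def abs_divide)
    also have "\<dots> \<le> lifted_abs p \<epsilon> (v x) * gauss x" using lp(4)[of "v x"] gauss_pos[of x] by (intro mult_right_mono) auto
    also have "\<dots> \<le> \<bar>w x\<bar>" by (simp add: w_def)
    finally show ?thesis .
  qed
  have wD: "w \<in> D1p p" by (rule D1pI[OF wq ww gwL])
  have p0: "p > 0" using p by simp
  have ineq: "(LINT x|lebesgue. norm (g x) powr p) \<le> (LINT x|lebesgue. norm (gw x) powr p)"
    using min[OF wD uw] unfolding D1p_norm_powr[OF g(1) p0] D1p_norm_powr[OF ww p0] .
  define K where "K = (p / (p - 1)) powr p * \<epsilon> powr p"
  have pw: "norm (gw x) powr p \<le> norm (g x) powr p - \<rho> x powr p * norm (g x) powr p + K * norm (h x) powr p" for x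
  proof -
    define l where "l = \<rho> x powr p"
    have r: "0 < \<rho> x" "\<rho> x \<le> 1" using lp(1,2)[of "v x"] by (auto simp: \<rho>)
    have l: "0 \<le> l" "l \<le> 1" using r p by (auto simp: l_def intro!: powr_le1)
    define Y where "Y = p / (p - 1) * (\<epsilon> / \<rho> x) * norm (h x)"
    have Y: "Y \<ge> 0" unfolding Y_def using p e r by (intro mult_nonneg_nonneg) auto
    have "norm (gw x) \<le> \<bar>lifted_abs' p \<epsilon> (v x)\<bar> * norm (g x) + d x * norm (h x)"
      unfolding gw_def using norm_triangle_ineq[of "lifted_abs' p \<epsilon> (v x) *\<^sub>R g x" "d x *\<^sub>R h x"] d(1)[of x] by simp
    also have "\<dots> \<le> (1 - l) * norm (g x) + (l * (p / (p - 1) * (\<epsilon> / \<rho> x))) * norm (h x)"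
      using lp(3,7)[of "v x"] by (intro add_mono mult_right_mono) (auto simp: l_def \<rho> d_def)
    also have "\<dots> = (1 - l) * norm (g x) + l * Y" by (simp add: Y_def)
    finally have "norm (gw x) powr p \<le> ((1 - l) * norm (g x) + l * Y) powr p" using p by (intro powr_mono2) auto
    also have "\<dots> \<le> (1 - l) * norm (g x) powr p + l * Y powr p"
      using p l Y by (intro powr_convex_combination) auto
    \<comment> \<open>The weight l = \<rho>^p cancels the power of 1 / \<rho> contained in Y; the
      slope 1 - \<rho>^p of the profile is designed for this.\<close>
    also have "l * Y powr p = K * norm (h x) powr p"
    proof -
      have "Y powr p = (p / (p - 1)) powr p * (\<epsilon> powr p / \<rho> x powr p) * norm (h x) powr p"
        unfolding Y_def using p e r by (simp add: powr_mult powr_divide)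
      then show ?thesis using r by (simp add: l_def K_def)
    qed
    finally show ?thesis by (simp add: l_def left_diff_distrib)
  qed
  have ig: "integrable lebesgue (\<lambda>x. norm (g x) powr p)" "integrable lebesgue (\<lambda>x. norm (h x) powr p)"
    "integrable lebesgue (\<lambda>x. norm (gw x) powr p)"
    using p0 by (intro integrable_norm_powr g hL gwL; simp)+
  have [measurable]: "u \<in> borel_measurable lebesgue" "gauss \<in> borel_measurable (lebesgue :: (real^'n) measure)"
    using Lp_measurable[OF u] measurable_smooth[OF smooth_gauss] by auto
  have m\<rho>: "(\<lambda>x. \<rho> x powr p) \<in> borel_measurable lebesgue" unfolding \<rho>_def by measurable
  show i\<rho>: "integrable lebesgue (\<lambda>x. \<rho> x powr p * norm (g x) powr p)"
  proof (rule Bochner_Integration.integrable_bound[OF ig(1)])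
    show "(\<lambda>x. \<rho> x powr p * norm (g x) powr p) \<in> borel_measurable lebesgue"
      using m\<rho> ig(1) by (intro borel_measurable_times) auto
    have "\<rho> x powr p \<le> 1 powr p" for x
      using lp(1,2)[of "v x"] p unfolding \<rho> by (intro powr_mono2) (auto intro: less_imp_le)
    then show "AE x in lebesgue. norm (\<rho> x powr p * norm (g x) powr p) \<le> norm (norm (g x) powr p)"
      by (intro AE_I2) (simp add: abs_mult mult_left_le_one_le)
  qed
  have "(LINT x|lebesgue. norm (gw x) powr p) \<le>
     (LINT x|lebesgue. norm (g x) powr p - \<rho> x powr p * norm (g x) powr p + K * norm (h x) powr p)"
    using pw ig i\<rho> by (intro integral_mono) auto
  also have "\<dots> = (LINT x|lebesgue. norm (g x) powr p) - (LINT x|lebesgue. \<rho> x powr p * norm (g x) powr p)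
     + K * (LINT x|lebesgue. norm (h x) powr p)"
    using ig i\<rho> by simp
  finally show "(LINT x|lebesgue. \<rho> x powr p * norm (g x) powr p) \<le> (p / (p - 1)) powr p * \<epsilon> powr p *
      (LINT x|lebesgue. norm (\<chi> i. - 2 * x $ i * gauss x :: real^'n) powr p)"
    using ineq by (simp add: K_def h_def)
qed

text \<open>With \<epsilon> = exp(-k) this is ln(sqrt(\<epsilon>^2 + s^2) / \<epsilon>) divided by
  ln(1 / \<epsilon>): a normalized logarithm, even and smooth in s, that is 0 at s = 0 and tends to
  1 elsewhere.\<close>

definition log_profile :: "nat \<Rightarrow> real \<Rightarrow> real" where
  "log_profile k s = ln (1 + s\<^sup>2 * exp (2 * real k)) / (2 * real k)"

lemma log_profile_deriv:
  assumes "k > 0"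
  shows "(log_profile k has_field_derivative (s / (exp (- real k)^2 + s\<^sup>2)) / real k) (at s)"
proof -
  have pos: "0 < 1 + s\<^sup>2 * exp (2 * real k)" by (simp add: add_pos_nonneg)
  have "(log_profile k has_field_derivative (2 * s * exp (2 * real k) / (1 + s\<^sup>2 * exp (2 * real k))) / (2 * real k)) (at s)"
    unfolding log_profile_def[abs_def] using pos assms
    by (auto intro!: derivative_eq_intros simp: divide_simps)
  moreover have "2 * s * exp (2 * real k) / (1 + s\<^sup>2 * exp (2 * real k)) = 2 * (s / (exp (- real k)^2 + s\<^sup>2))"
  proof -
    have E: "exp (- real k)^2 * exp (2 * real k) = 1" by (simp add: power2_eq_square flip: exp_add)
    have "s / (exp (- real k)^2 + s\<^sup>2) = (s * exp (2 * real k)) / ((exp (- real k)^2 + s\<^sup>2) * exp (2 * real k))" by simp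
    also have "(exp (- real k)^2 + s\<^sup>2) * exp (2 * real k) = 1 + s\<^sup>2 * exp (2 * real k)" by (simp add: distrib_right E)
    finally show ?thesis by simp
  qed
  ultimately show ?thesis by simp
qed

text \<open>Passes from the smooth regularization of 1 / |s| to 1 / (|s| + e), the form in which the
  logarithmic estimate is available.\<close>

lemma log_profile_deriv_bound:
  fixes s e :: real
  assumes "e > 0" shows "\<bar>s / (e\<^sup>2 + s\<^sup>2)\<bar> \<le> 2 / (\<bar>s\<bar> + e)"
proof -
  have "2 * (\<bar>s\<bar> * e) \<le> s\<^sup>2 + e\<^sup>2" using sum_squares_bound[of "\<bar>s\<bar>" e] by simp
  then have "\<bar>s\<bar> * (\<bar>s\<bar> + e) \<le> 2 * (e\<^sup>2 + s\<^sup>2)"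
    by (simp add: distrib_left power2_eq_square) (smt (verit) zero_le_square)
  moreover have "0 < e\<^sup>2 + s\<^sup>2" "0 < \<bar>s\<bar> + e" using assms by (auto intro: add_pos_nonneg)
  ultimately show ?thesis by (simp add: abs_divide divide_le_eq le_divide_eq mult_ac)
qed

text \<open>Uniform in k, so that 1 + |u| is a dominating function. The reason is 1 + s^2 E <= (1 +
  |s|)^2 E with E = exp(2 k), followed by ln(1 + |s|) <= |s|.\<close>

lemma log_profile_bound:
  assumes "k > 0" shows "\<bar>log_profile k s\<bar> \<le> 1 + \<bar>s\<bar>"
proof -
  have "0 \<le> log_profile k s" unfolding log_profile_def by (intro divide_nonneg_nonneg ln_ge_zero) auto
  have "1 + s\<^sup>2 * exp (2 * real k) \<le> (1 + \<bar>s\<bar>)\<^sup>2 * exp (2 * real k)"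
  proof -
    have "1 \<le> exp (2 * real k)" by simp
    then have "1 + s\<^sup>2 * exp (2 * real k) \<le> (1 + s\<^sup>2) * exp (2 * real k)" by (simp add: distrib_right)
    also have "\<dots> \<le> (1 + \<bar>s\<bar>)\<^sup>2 * exp (2 * real k)" by (intro mult_right_mono) (auto simp: power2_sum)
    finally show ?thesis .
  qed
  then have "ln (1 + s\<^sup>2 * exp (2 * real k)) \<le> ln ((1 + \<bar>s\<bar>)\<^sup>2 * exp (2 * real k))"
    by (subst ln_le_cancel_iff) (auto intro: add_pos_nonneg)
  also have "\<dots> = 2 * ln (1 + \<bar>s\<bar>) + 2 * real k" by (simp add: ln_mult ln_realpow add_pos_nonneg)
  also have "\<dots> \<le> 2 * \<bar>s\<bar> + 2 * real k" using ln_add_one_self_le_self[of "\<bar>s\<bar>"] by simp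
  also have "\<dots> \<le> (1 + \<bar>s\<bar>) * (2 * real k)"
  proof -
    have "\<bar>s\<bar> * 1 \<le> \<bar>s\<bar> * real k" using assms by (intro mult_left_mono) auto
    then show ?thesis by (simp add: distrib_right)
  qed
  finally have "log_profile k s \<le> 1 + \<bar>s\<bar>" unfolding log_profile_def using assms by (simp add: divide_le_eq)
  with \<open>0 \<le> log_profile k s\<close> show ?thesis by simp
qed

lemma log_profile_tendsto: "(\<lambda>k. log_profile k s) \<longlonglongrightarrow> (if s = 0 then 0 else 1)"
proof (cases "s = 0")
  case False
  define c where "c = s\<^sup>2"
  have "c > 0" using False by (simp add: c_def)
  then have "(\<lambda>k. ln (1 + c * exp (2 * real k)) / (2 * real k)) \<longlonglongrightarrow> 1" by real_asymp
  then show ?thesis using False by (simp add: log_profile_def c_def)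
qed (simp add: log_profile_def)

text \<open>The k-th normalized logarithm of u has a weak gradient of size at most 2 G k / k with G
  k = |grad u| / (|u| + exp(-k)), and the integral of (G k)^p over a fixed cube is bounded
  independently of k. In the limit the indicator of the set where u is nonzero has zero weak
  gradient.\<close>

lemma minimizer_nonzero_AE:
  fixes u :: "real^'n::finite \<Rightarrow> real"
  assumes p: "1 < p" "p < real CARD('n)" and uD: "u \<in> D1p p" and nz: "\<not> (AE x in lebesgue. u x = 0)"
    and min: "\<And>w. w \<in> D1p p \<Longrightarrow> (\<And>x. \<bar>u x\<bar> \<le> \<bar>w x\<bar>) \<Longrightarrow> D1p_norm p u powr p \<le> D1p_norm p w powr p"
  shows "AE x in lebesgue. u x \<noteq> 0"
proof -
  obtain g where u: "u \<in> Lp (critical_exponent CARD('n) p)" and g: "\<And>i. weak_partial i u (\<lambda>x. g x $ i)" "\<And>i. (\<lambda>x. g x $ i) \<in> Lp p"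
    by (rule D1pE[OF uD]) blast
  have lu: "locally_integrable u" using g by (simp add: weak_partial_def)
  have [measurable]: "u \<in> borel_measurable lebesgue" by (rule Lp_measurable[OF u])
  have mg: "(\<lambda>x. norm (g x)) \<in> borel_measurable lebesgue"
    using g(2) by (intro measurable_norm_vec) (simp add: Lp_def)
  define H where "H = (p / (p - 1)) powr p * (LINT x|lebesgue. norm (\<chi> i. - 2 * x $ i * gauss x :: real^'n) powr p)"
  define G where "G k x = norm (g x) / (\<bar>u x\<bar> + exp (- real k))" for k :: nat and x
  \<comment> \<open>On a cube the Gaussian is at least m, so |u| / gauss + \<epsilon> may be
    replaced by |u| + \<epsilon> at the cost of a factor 1/m. The power \<epsilon>^p in the
    logarithmic estimate cancels, and the bound H / m^p is independent of k.\<close>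
  have local: "\<exists>M. \<forall>k. integrable lebesgue (\<lambda>x. indicator (cube r) x * G k x powr p) \<and>
     (LINT x|lebesgue. indicator (cube r) x * G k x powr p) \<le> M" for r
  proof -
    define m where "m = exp (- (real CARD('n) * r\<^sup>2))"
    have m: "0 < m" "m \<le> 1" by (auto simp: m_def)
    have gm: "m \<le> gauss x" if x: "x \<in> cube r" for x :: "real^'n"
    proof -
      have "x \<bullet> x = (\<Sum>i\<in>UNIV. (x $ i)\<^sup>2)" by (simp add: inner_vec_def power2_eq_square)
      also have "\<dots> \<le> (\<Sum>i\<in>(UNIV::'n set). r\<^sup>2)"
      proof (rule sum_mono)
        fix i
        have "\<bar>x $ i\<bar> < r" using x unfolding mem_cube by blast
        then have "\<bar>x $ i\<bar>\<^sup>2 \<le> r\<^sup>2" by (intro power_mono) auto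
        then show "(x $ i)\<^sup>2 \<le> r\<^sup>2" by simp
      qed
      finally show ?thesis by (simp add: m_def gauss_def)
    qed
    have "integrable lebesgue (\<lambda>x. indicator (cube r) x * G k x powr p) \<and>
      (LINT x|lebesgue. indicator (cube r) x * G k x powr p) \<le> H / m powr p" for k
    proof -
      define e where "e = exp (- real k)"
      have e: "e > 0" by (simp add: e_def)
      define \<rho> where "\<rho> x = e / (\<bar>u x / gauss x\<bar> + e)" for x
      note le = log_estimate[OF p e u g min, folded \<rho>_def]
      have i: "integrable lebesgue (\<lambda>x. 1 / (m * e) powr p * (\<rho> x powr p * norm (g x) powr p))"
        by (intro integrable_mult_right le(1))
      have pw: "indicator (cube r) x * G k x powr p \<le> 1 / (m * e) powr p * (\<rho> x powr p * norm (g x) powr p)" for x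
      proof (cases "x \<in> cube r")
        case True
        have "m * (\<bar>u x / gauss x\<bar> + e) \<le> \<bar>u x\<bar> + e"
        proof -
          have "m * (\<bar>u x\<bar> / gauss x) \<le> gauss x * (\<bar>u x\<bar> / gauss x)"
            using gm[OF True] gauss_pos[of x] by (intro mult_right_mono) auto
          moreover have "m * e \<le> e" using m e by simp
          ultimately show ?thesis using gauss_pos[of x] by (simp add: distrib_left abs_divide)
        qed
        then have "1 / (\<bar>u x\<bar> + e) \<le> 1 / (m * (\<bar>u x / gauss x\<bar> + e))"
          using m e by (intro divide_left_mono) (auto intro!: mult_pos_pos add_nonneg_pos)
        also have "\<dots> = \<rho> x / (m * e)" using e by (simp add: \<rho>_def)
        finally have "norm (g x) * (1 / (\<bar>u x\<bar> + e)) \<le> norm (g x) * (\<rho> x / (m * e))"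
          by (intro mult_left_mono) auto
        then have "G k x \<le> \<rho> x * norm (g x) / (m * e)" by (simp add: G_def e_def mult_ac)
        moreover have "0 \<le> G k x" by (auto simp: G_def intro!: divide_nonneg_nonneg add_nonneg_nonneg)
        ultimately have "G k x powr p \<le> (\<rho> x * norm (g x) / (m * e)) powr p" using p by (intro powr_mono2) auto
        also have "\<dots> = 1 / (m * e) powr p * (\<rho> x powr p * norm (g x) powr p)"
          using m e by (simp add: powr_mult powr_divide \<rho>_def)
        finally show ?thesis using True by simp
      qed simp
      have mG: "(\<lambda>x. indicator (cube r) x * G k x powr p) \<in> borel_measurable lebesgue"
        unfolding G_def using mg by (intro borel_measurable_times borel_measurable_indicator) auto
      have 1: "integrable lebesgue (\<lambda>x. indicator (cube r) x * G k x powr p)"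
      proof (rule Bochner_Integration.integrable_bound[OF i mG], rule AE_I2)
        fix x
        have "norm (indicator (cube r) x * G k x powr p) = indicator (cube r) x * G k x powr p" by simp
        then show "norm (indicator (cube r) x * G k x powr p) \<le> norm (1 / (m * e) powr p * (\<rho> x powr p * norm (g x) powr p))"
          using pw[of x] by simp
      qed
      have "(LINT x|lebesgue. indicator (cube r) x * G k x powr p) \<le> (LINT x|lebesgue. 1 / (m * e) powr p * (\<rho> x powr p * norm (g x) powr p))"
        using pw by (intro integral_mono 1 i)
      also have "\<dots> = 1 / (m * e) powr p * (LINT x|lebesgue. \<rho> x powr p * norm (g x) powr p)" by (rule integral_mult_right_zero)
      also have "\<dots> \<le> 1 / (m * e) powr p * ((p / (p - 1)) powr p * e powr p *
      (LINT x|lebesgue. norm (\<chi> i. - 2 * x $ i * gauss x :: real^'n) powr p))"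
        by (intro mult_left_mono le(2)) auto
      also have "\<dots> = H / m powr p" using m e by (simp add: H_def powr_mult)
      finally show ?thesis using 1 by simp
    qed
    then show ?thesis by blast
  qed
  have l1: "(\<lambda>x. indicat_real {x. u x \<noteq> 0} x) \<in> borel_measurable lebesgue"
  proof -
    have "{x \<in> space lebesgue. u x \<noteq> 0} \<in> sets lebesgue" by measurable
    then show ?thesis by (intro borel_measurable_indicator) simp
  qed
  have lI: "locally_integrable (indicat_real {x. u x \<noteq> 0})"
    by (rule locally_integrable_bound[OF locally_integrable_continuous[OF continuous_on_const[of _ 1]] l1]) (auto simp: indicator_def)
  have w0: "weak_partial i (indicat_real {x. u x \<noteq> 0}) (\<lambda>_. 0)" for i
    unfolding weak_partial_def
  proof (intro conjI allI impI)
    show "locally_integrable (indicat_real {x. u x \<noteq> 0})" by (rule lI)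
    show "locally_integrable (\<lambda>_::real^'n. 0 :: real)" by (intro locally_integrable_continuous continuous_on_const)
    fix \<phi> :: "real^'n \<Rightarrow> real" assume \<phi>: "test_function \<phi>"
    obtain r where r: "r > 0" "\<And>x. x \<notin> cube r \<Longrightarrow> \<phi> x = 0" using test_function_support[OF \<phi>] by blast
    obtain B where B: "B > 0" "\<And>x. \<bar>\<phi> x\<bar> \<le> B" using test_function_bounded[OF \<phi>] by blast
    note \<phi>' = test_function_partial_deriv[OF \<phi>, of i]
    obtain M where M: "\<And>k. integrable lebesgue (\<lambda>x. indicator (cube r) x * G k x powr p)"
     "\<And>k. (LINT x|lebesgue. indicator (cube r) x * G k x powr p) \<le> M" using local[of r] by blast
    \<comment> \<open>The index starts at \<open>Suc k\<close> because the profile carries the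
      divisor 2 k.\<close>
    define a where "a k = (LINT x|lebesgue. log_profile (Suc k) (u x) * partial_deriv i \<phi> x)" for k
    have a1: "a \<longlonglongrightarrow> (LINT x|lebesgue. indicator {x. u x \<noteq> 0} x * partial_deriv i \<phi> x)"
      unfolding a_def
    proof (rule integral_dominated_convergence[where w = "\<lambda>x. \<bar>(1 + \<bar>u x\<bar>) * partial_deriv i \<phi> x\<bar>"])
      have "locally_integrable (\<lambda>x. 1 + \<bar>u x\<bar>)"
        using locally_integrable_add[OF locally_integrable_continuous[OF continuous_on_const] locally_integrable_abs[OF lu]] by blast
      then show "integrable lebesgue (\<lambda>x. \<bar>(1 + \<bar>u x\<bar>) * partial_deriv i \<phi> x\<bar>)"
        by (intro integrable_abs integrable_mult_test \<phi>')
      show "(\<lambda>x. indicator {x. u x \<noteq> 0} x * partial_deriv i \<phi> x) \<in> borel_measurable lebesgue"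
        by (intro borel_measurable_times l1 measurable_test \<phi>')
      show "(\<lambda>x. log_profile (Suc k) (u x) * partial_deriv i \<phi> x) \<in> borel_measurable lebesgue" for k
        unfolding log_profile_def by (rule borel_measurable_times[OF _ measurable_test[OF \<phi>']]) measurable
      show "AE x in lebesgue. (\<lambda>k. log_profile (Suc k) (u x) * partial_deriv i \<phi> x) \<longlonglongrightarrow> indicator {x. u x \<noteq> 0} x * partial_deriv i \<phi> x"
      proof (rule AE_I2)
        fix x
        have "(\<lambda>k. log_profile (Suc k) (u x)) \<longlonglongrightarrow> indicator {x. u x \<noteq> 0} x"
          using LIMSEQ_Suc[OF log_profile_tendsto[of "u x"]] by (cases "u x = 0") simp_all
        then show "(\<lambda>k. log_profile (Suc k) (u x) * partial_deriv i \<phi> x) \<longlonglongrightarrow> indicator {x. u x \<noteq> 0} x * partial_deriv i \<phi> x"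
          by (intro tendsto_intros)
      qed
      show "AE x in lebesgue. norm (log_profile (Suc k) (u x) * partial_deriv i \<phi> x) \<le> \<bar>(1 + \<bar>u x\<bar>) * partial_deriv i \<phi> x\<bar>" for k
        using log_profile_bound[of "Suc k"] by (intro AE_I2) (simp add: abs_mult mult_right_mono)
    qed
    define V where "V = (LINT x|lebesgue. indicat_real (cube r) (x::real^'n) * 1)"
    have iV: "integrable lebesgue (\<lambda>x::real^'n. indicat_real (cube r) x * 1)"
      by (intro locally_integrable_cube locally_integrable_continuous continuous_on_const)
    have ab: "\<bar>a k\<bar> \<le> 2 * B * (V + M) / real (Suc k)" for k
    proof -
      define e where "e = exp (- real (Suc k))"
      have e: "e > 0" by (simp add: e_def)
      let ?F' = "\<lambda>s. s / (exp (- real (Suc k))^2 + s\<^sup>2) / real (Suc k)"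
      have F'b: "\<bar>?F' s\<bar> \<le> 2 / (\<bar>s\<bar> + e) / real (Suc k)" for s
      proof -
        have "\<bar>?F' s\<bar> = \<bar>s / (exp (- real (Suc k))^2 + s\<^sup>2)\<bar> / real (Suc k)" by (simp only: abs_divide abs_of_nat)
        also have "\<dots> \<le> 2 / (\<bar>s\<bar> + exp (- real (Suc k))) / real (Suc k)"
          by (rule divide_right_mono[OF log_profile_deriv_bound]) auto
        finally show ?thesis by (simp only: e_def)
      qed
      have F'L: "\<bar>?F' s\<bar> \<le> 2 / e / real (Suc k)" for s
      proof -
        have "2 / (\<bar>s\<bar> + e) \<le> 2 / e" using e by (intro divide_left_mono) auto
        then have "2 / (\<bar>s\<bar> + e) / real (Suc k) \<le> 2 / e / real (Suc k)" by (intro divide_right_mono) auto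
        then show ?thesis using F'b[of s] by linarith
      qed
      have mF': "?F' \<in> borel_measurable borel" by measurable
      have wk: "weak_partial i (\<lambda>x. log_profile (Suc k) (u x)) (\<lambda>x. ?F' (u x) * g x $ i)"
        by (rule weak_partial_chain[OF g(1) log_profile_deriv F'L mF']) simp
      then have "a k = - (LINT x|lebesgue. ?F' (u x) * g x $ i * \<phi> x)"
        using \<phi> by (simp add: a_def weak_partial_def)
      then have "\<bar>a k\<bar> \<le> (LINT x|lebesgue. \<bar>?F' (u x) * g x $ i * \<phi> x\<bar>)"
        using integral_abs_bound[of lebesgue "\<lambda>x. ?F' (u x) * g x $ i * \<phi> x"] by simp
      also have "\<dots> \<le> (LINT x|lebesgue. 2 * B / real (Suc k) * (indicat_real (cube r) x * 1 + indicator (cube r) x * G (Suc k) x powr p))"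
      proof (rule integral_mono)
        have "locally_integrable (\<lambda>x. ?F' (u x) * g x $ i)" using wk by (simp add: weak_partial_def)
        then show "integrable lebesgue (\<lambda>x. \<bar>?F' (u x) * g x $ i * \<phi> x\<bar>)" by (intro integrable_abs integrable_mult_test \<phi>)
        show "integrable lebesgue (\<lambda>x. 2 * B / real (Suc k) * (indicat_real (cube r) x * 1 + indicator (cube r) x * G (Suc k) x powr p))"
          by (intro integrable_mult_right Bochner_Integration.integrable_add iV M(1))
        fix x
        show "\<bar>?F' (u x) * g x $ i * \<phi> x\<bar> \<le> 2 * B / real (Suc k) * (indicat_real (cube r) x * 1 + indicator (cube r) x * G (Suc k) x powr p)"
        proof (cases "x \<in> cube r")
          case True
          have "\<bar>?F' (u x) * g x $ i * \<phi> x\<bar> = \<bar>?F' (u x)\<bar> * \<bar>g x $ i\<bar> * \<bar>\<phi> x\<bar>" by (simp only: abs_mult)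
          also have "\<dots> \<le> 2 / (\<bar>u x\<bar> + e) / real (Suc k) * norm (g x) * B"
            using F'b[of "u x"] component_le_norm_cart[of "g x" i] B(2)[of x] e
            by (intro mult_mono) (auto intro!: mult_nonneg_nonneg divide_nonneg_nonneg add_nonneg_nonneg)
          also have "\<dots> = 2 * B / real (Suc k) * G (Suc k) x" by (simp add: G_def e_def mult_ac)
          \<comment> \<open>The inequality t <= 1 + t^p takes the place of Hoelder's; after
            integration the constant 1 contributes the volume V of the cube.\<close>
          also have "\<dots> \<le> 2 * B / real (Suc k) * (1 + G (Suc k) x powr p)"
          proof (rule mult_left_mono)
            show "G (Suc k) x \<le> 1 + G (Suc k) x powr p"
            proof (cases "G (Suc k) x \<le> 1")
              case False
              then have "G (Suc k) x powr 1 \<le> G (Suc k) x powr p" using p by (intro powr_mono) auto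
              then show ?thesis using False by simp
            qed (simp add: add_increasing2)
          qed (use B in auto)
          finally show ?thesis using True by simp
        qed (simp add: r)
      qed
      also have "\<dots> = 2 * B / real (Suc k) * ((LINT x|lebesgue. indicat_real (cube r) (x::real^'n) * 1) + (LINT x|lebesgue. indicator (cube r) x * G (Suc k) x powr p))"
        by (subst integral_mult_right_zero, subst Bochner_Integration.integral_add[OF iV M(1)]) simp
      also have "\<dots> \<le> 2 * B / real (Suc k) * (V + M)"
        unfolding V_def using M(2)[of "Suc k"] B by (intro mult_left_mono add_left_mono) auto
      finally show ?thesis by simp
    qed
    have "(\<lambda>k. 2 * B * (V + M) / real (Suc k)) \<longlonglongrightarrow> 0" by real_asymp
    then have "a \<longlonglongrightarrow> 0" using ab by (intro Lim_null_comparison[of a]) (auto intro!: always_eventually)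
    from LIMSEQ_unique[OF a1 this]
    show "(LINT x|lebesgue. indicator {x. u x \<noteq> 0} x * partial_deriv i \<phi> x) = - (LINT x|lebesgue. 0 * \<phi> x)" by simp
  qed
  obtain c where c: "AE x in lebesgue. indicat_real {x. u x \<noteq> 0} x = c" by (rule zero_weak_gradient_const[OF w0])
  have "c \<noteq> 0"
  proof
    assume "c = 0"
    then have "AE x in lebesgue. u x = 0" using c by (auto elim!: eventually_mono simp: indicator_def of_bool_def split: if_splits)
    then show False using nz by simp
  qed
  with c show ?thesis by (auto elim!: eventually_mono simp: indicator_def)
qed

theorem theorem1p2:
  fixes p :: real and \<beta> :: "'l::finite \<Rightarrow> 'l \<Rightarrow> real"
  assumes "CARD('n::finite) \<ge> 2"
    and "CARD('l) \<ge> 2"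
    and "2 * real CARD('n) / (real CARD('n) + 2) < p"
    and "p < real CARD('n)"
    and "\<And>i. \<beta> i i > 0"
    and "\<And>i j. i \<noteq> j \<Longrightarrow> \<beta> i j < 0"
  shows "\<not> (\<exists>u :: 'l \<Rightarrow> real^'n \<Rightarrow> real. least_energy_fully_nontrivial_solution p \<beta> u)"
proof
  assume "\<exists>u :: 'l \<Rightarrow> real^'n \<Rightarrow> real. least_energy_fully_nontrivial_solution p \<beta> u"
  then obtain u :: "'l \<Rightarrow> real^'n \<Rightarrow> real" where u: "least_energy_fully_nontrivial_solution p \<beta> u" by blast
  \<comment> \<open>Since N >= 2, the lower bound for p is at least 1. Thus p > 1, which makes t^p
    convex and 1 / (p - 1) positive.\<close>
  have "1 \<le> 2 * real CARD('n) / (real CARD('n) + 2)" using assms(1) by (simp add: le_divide_eq)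
  then have p: "1 < p" "p < real CARD('n)" using assms(3,4) by linarith+
  then have p0: "0 < p" by simp
  have disjoint: "coupling p (u j) (u i) = 0" if "i \<noteq> j" for i j
    by (rule least_energy_consequences(1)[OF p0 p(2) assms(5,6) u that])
  have min: "D1p_norm p (u i) powr p \<le> D1p_norm p w powr p" if "w \<in> D1p p" "\<And>x. \<bar>u i x\<bar> \<le> \<bar>w x\<bar>" for i w
    by (rule least_energy_consequences(2)[OF p0 p(2) assms(5,6) u that])
  have uN: "u i \<in> D1p p" "\<not> (AE x in lebesgue. u i x = 0)" for i
    using u by (auto simp: least_energy_fully_nontrivial_solution_def nehari_def)
  have nz: "AE x in lebesgue. u i x \<noteq> 0" for i
    by (rule minimizer_nonzero_AE[OF p uN min])
  obtain i j :: 'l where ij: "i \<noteq> j"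
    using assms(2) card_le_Suc0_iff_eq[of "UNIV :: 'l set"] by (auto simp: numeral_2_eq_2)
  have uq: "u i \<in> Lp (critical_exponent CARD('n) p)" for i using uN(1)[of i] by (simp add: D1p_def)
  \<comment> \<open>A vanishing coupling is the integral of a nonnegative product, so the product is
    zero almost everywhere although neither factor is.\<close>
  have "AE x in lebesgue. \<bar>u j x\<bar> powr (critical_exponent CARD('n) p / 2) * \<bar>u i x\<bar> powr (critical_exponent CARD('n) p / 2) = 0"
    using disjoint[OF ij] integral_nonneg_eq_0_iff_AE[OF coupling_integrable[OF uq uq, of j i]]
    unfolding coupling_def by simp
  with nz[of i] nz[of j] have "AE x in (lebesgue :: (real^'n) measure). False"
    by eventually_elim simp
  \<comment> \<open>Once falsity holds almost everywhere, so does every property; the one chosen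
    contradicts the nontriviality of u i.\<close>
  then have "AE x in lebesgue. u i x = 0" by eventually_elim simp
  then show False using uN(2)[of i] by simp
qed

end
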